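(* Let $C(\varepsilon)=C+\varepsilon\tilde C$ with $\tilde C=\mathrm{diag}(\tilde c_i:i\in\mathcal S)$, and assume $\tilde c_i\neq0$ for all $i\in\mathcal S_0$. Put $\mathcal S_\oplus=\{i\in\mathcal S_0:\tilde c_i>0\}$ and $\mathcal S_\ominus=\{i\in\mathcal S_0:\tilde c_i<0\}$, so that $\tilde C$ has diagonal blocks $\tilde C_+,\tilde C_\oplus,\tilde C_\ominus,\tilde C_-$. For small $\varepsilon>0$ let $$\boldsymbol\Psi(\varepsilon)=\begin{bmatrix}\Psi_{+\ominus}(\varepsilon)&\Psi_{+-}(\varepsilon)\\ \Psi_{\oplus\ominus}(\varepsilon)&\Psi_{\oplus-}(\varepsilon)\end{bmatrix}$$ be the matrix of first return probabilities to the initial level from above of the perturbed model, with phase generator $A$ and rate matrix $C(\varepsilon)$, that is, the minimal nonnegative solution $X$ of $$\begin{bmatrix}C_++\varepsilon\tilde C_+&0\\0&\varepsilon\tilde C_\oplus\end{bmatrix}^{-1}\left(\begin{bmatrix}A_{+\ominus}&A_{+-}\\ A_{\oplus\ominus}&A_{\oplus-}\end{bmatrix}+\begin{bmatrix}A_{++}&A_{+\oplus}\\ A_{\oplus+}&A_{\oplus\oplus}\end{bmatrix}X\right)+X\begin{bmatrix}|\varepsilon\tilde C_\ominus|&0\\0&|C_-+\varepsilon\tilde C_-|\end{bmatrix}^{-1}\left(\begin{bmatrix}A_{\ominus\ominus}&A_{\ominus-}\\ A_{-\ominus}&A_{--}\end{bmatrix}+\begin{bmatrix}A_{\ominus+}&A_{\ominus\oplus}\\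 A_{-+}&A_{-\oplus}\end{bmatrix}X\right)=0 .$$ Then $\boldsymbol\Psi(\varepsilon)$ is analytic near zero and may be written as $\boldsymbol\Psi(\varepsilon)=\overline\Psi+\varepsilon\Psi^{(1)}+O(\varepsilon^2)$, where $$\overline\Psi=\begin{bmatrix}0&\Psi\\ \Psi_{\oplus\ominus}&\Psi_{\oplus-}\end{bmatrix}.$$ The block $\Psi$ is the matrix of first return probabilities of the unperturbed model, $$\Psi_{\oplus-}=(-K^{(-1)}_{\oplus\oplus})^{-1}\left(\tilde C_\oplus^{-1}(A_{\oplus-}+A_{\oplus+}\Psi)+\Psi_{\oplus\ominus}|\tilde C_\ominus^{-1}|(A_{\ominus-}+A_{\ominus+}\Psi)\right),$$ and $\Psi_{\oplus\ominus}$ is the minimal nonnegative solution of the Riccati equation $$\tilde C_\oplus^{-1}A_{\oplus\ominus}+\tilde C_\oplus^{-1}A_{\oplus\oplus}X+X|\tilde C_\ominus^{-1}|A_{\ominus\ominus}+X|\tilde C_\ominus^{-1}|A_{\ominus\oplus}X=0.$$ Furthermore, $$\Psi^{(1)}=\begin{bmatrix}\Psi^{(1)}_{+\ominus}&\Psi^{(1)}_{+-}\\ \Psi^{(1)}_{\oplus\ominus}&\Psi^{(1)}_{\oplus-}\end{bmatrix}$$ with $$\Psi^{(1)}_{+\ominus}=\left(C_+^{-1}(A_{+\ominus}+A_{+\oplus}\Psi_{\oplus\ominus})+\Psi|C_-^{-1}|(A_{-\ominus}+A_{-\oplus}\Psi_{\oplus\ominus})\right)(-U^{(-1)}_{\ominus\ominus})^{-1};$$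 $\Psi^{(1)}_{\oplus\ominus}$ is the unique solution $X$ of the Sylvester equation $$K^{(-1)}_{\oplus\oplus}X+XU^{(-1)}_{\ominus\ominus}=-(\tilde C_\oplus^{-1}A_{\oplus+}+\Psi_{\oplus\ominus}|\tilde C_\ominus^{-1}|A_{\ominus+})\Psi^{(1)}_{+\ominus}-\Psi_{\oplus-}|C_-^{-1}|(A_{-\ominus}+A_{-+}\Psi_{+\ominus}+A_{-\oplus}\Psi_{\oplus\ominus}),$$ where $\Psi_{+\ominus}=0$ is the $(+,\ominus)$ block of $\overline\Psi$; $$\Psi^{(1)}_{\oplus-}=(-K^{(-1)}_{\oplus\oplus})^{-1}\left(K^{(-1)}_{\oplus+}\Psi^{(1)}_{+-}+\Psi_{\oplus\ominus}|C_-^{-1}|U^{(-1)}_{\ominus-}-\Psi_{\oplus-}U^{(0)}_{--}\right);$$ and $\Psi^{(1)}_{+-}$ is the unique solution of the Sylvester equation $$(C_+^{-1}A_{++}+\Psi|C_-^{-1}|A_{-+})\Psi^{(1)}_{+-}+\Psi^{(1)}_{+-}U^{(0)}_{--}+(C_+^{-1}A_{+\oplus}+\Psi|C_-^{-1}|A_{-\oplus})\Psi^{(1)}_{\oplus-}+\Psi^{(2)}_{+\ominus}U^{(-1)}_{\ominus-}$$ $$=C_+^{-1}\tilde C_+C_+^{-1}(A_{+-}+A_{++}\Psi+A_{+\oplus}\Psi_{\oplus-})-\Psi|C_-^{-1}|\tilde C_-U^{(0)}_{--},$$ where $$\Psi^{(2)}_{+\ominus}=\Big(-C_+^{-1}\tilde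 C_+C_+^{-1}(A_{+\ominus}+A_{+\oplus}\Psi_{\oplus\ominus})+C_+^{-1}(A_{++}\Psi^{(1)}_{+\ominus}+A_{+\oplus}\Psi^{(1)}_{\oplus\ominus})$$ $$\qquad+(\Psi^{(1)}_{+-}+\Psi|C_-^{-1}|\tilde C_-)U^{(0)}_{-\ominus}+\Psi|C_-^{-1}|(A_{-+}\Psi^{(1)}_{+\ominus}+A_{-\oplus}\Psi^{(1)}_{\oplus\ominus})\Big)(-U^{(0)}_{\ominus\ominus})^{-1}.$$
   Context: Markov modulated fluid model: $\varphi(t)$ is a continuous-time Markov chain (the phase process) on a finite set $\mathcal S$ with generator $A$, and $Y(t)=Y(0)+\int_0^t c_{\varphi(s)}\,\mathrm ds$ with real rates $c_i$, $i\in\mathcal S$. Partition $\mathcal S=\mathcal S_+\cup\mathcal S_0\cup\mathcal S_-$ according to $c_i>0$, $c_i=0$, $c_i<0$; in the claim $\mathcal S_0$ is further split as $\mathcal S_\oplus\cup\mathcal S_\ominus$, and $A$ is partitioned into blocks $A_{ab}$ with $a,b\in\{+,\oplus,\ominus,-\}$. Put $C_+=\mathrm{diag}(c_i:i\in\mathcal S_+)$, $C_-=\mathrm{diag}(c_i:i\in\mathcal S_-)$, and let $C$ be the block-diagonal matrix with diagonal blocks $C_+,0,C_-$; $|\cdot|$ denotes entrywise absolute value and $\mathbf 1$ is the column vector of ones. Standing assumption (positive recurrence): $\boldsymbol\xi C\mathbf 1<0$, where $\boldsymbol\xi$ is the stationary probability vector of the phase process, the unique solution of $\boldsymbol\xi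 A=0$, $\boldsymbol\xi\mathbf 1=1$. First return probabilities from above: for a phase $i$ of positive rate and a phase $j$ of negative rate, the $(i,j)$ entry is $\mathbb P[\tau_-<\infty,\ \varphi(\tau_-)=j\mid Y(0)=0,\varphi(0)=i]$ with $\tau_-=\inf\{t>0:Y(t)<0\}$. For the unperturbed model this is the $|\mathcal S_+|\times|\mathcal S_-|$ matrix $\Psi$, which is the minimal nonnegative solution of $C_+^{-1}Q_{+-}+C_+^{-1}Q_{++}X+X|C_-^{-1}|Q_{--}+X|C_-^{-1}|Q_{-+}X=0$, with $$\begin{bmatrix}Q_{++}&Q_{+-}\\ Q_{-+}&Q_{--}\end{bmatrix}=\begin{bmatrix}A_{++}&A_{+-}\\ A_{-+}&A_{--}\end{bmatrix}+\begin{bmatrix}A_{+0}\\ A_{-0}\end{bmatrix}(-A_{00}^{-1})\begin{bmatrix}A_{0+}&A_{0-}\end{bmatrix},$$ the subscript $0$ referring to $\mathcal S_0$. It is assumed that $\varepsilon$ is small enough that the diagonal elements of $C_++\varepsilon\tilde C_+$ are strictly positive and those of $C_-+\varepsilon\tilde C_-$ are strictly negative. In the perturbed model the phases of positive rate are $\mathcal S_+\cup\mathcal S_\oplus$ and those of negative rate are $\mathcal S_\ominus\cup\mathcal S_-$. $\Psi^{(2)}_{+\ominus}$ is the notation for the coefficient of $\varepsilon^2$ in $\Psi_{+\ominus}(\varepsilon)$. For the perturbed model let $$U(\varepsilon)=\begin{bmatrix}|\varepsilon\tilde C_\ominus|&0\\0&|C_-+\varepsilon\tilde C_-|\end{bmatrix}^{-1}\left(\begin{bmatrix}A_{\ominus\ominus}&A_{\ominus-}\\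 A_{-\ominus}&A_{--}\end{bmatrix}+\begin{bmatrix}A_{\ominus+}&A_{\ominus\oplus}\\ A_{-+}&A_{-\oplus}\end{bmatrix}\boldsymbol\Psi(\varepsilon)\right),$$ $$K(\varepsilon)=\begin{bmatrix}C_++\varepsilon\tilde C_+&0\\0&\varepsilon\tilde C_\oplus\end{bmatrix}^{-1}\begin{bmatrix}A_{++}&A_{+\oplus}\\ A_{\oplus+}&A_{\oplus\oplus}\end{bmatrix}+\boldsymbol\Psi(\varepsilon)\begin{bmatrix}|\varepsilon\tilde C_\ominus|&0\\0&|C_-+\varepsilon\tilde C_-|\end{bmatrix}^{-1}\begin{bmatrix}A_{\ominus+}&A_{\ominus\oplus}\\ A_{-+}&A_{-\oplus}\end{bmatrix}.$$ A superscript $(n)$ on a block of $U$ or $K$ denotes the coefficient of $\varepsilon^n$ ($n\ge-1$) in the expansion of the corresponding block of $U(\varepsilon)$ or $K(\varepsilon)$. In particular $U^{(-1)}_{\ominus\ominus}=|\tilde C_\ominus^{-1}|A_{\ominus\ominus}+|\tilde C_\ominus^{-1}|A_{\ominus\oplus}\Psi_{\oplus\ominus}$ and $K^{(-1)}_{\oplus\oplus}=\tilde C_\oplus^{-1}A_{\oplus\oplus}+\Psi_{\oplus\ominus}|\tilde C_\ominus^{-1}|A_{\ominus\oplus}$; the other coefficients used are $U^{(-1)}_{\ominus-}=|\tilde C_\ominus^{-1}|(A_{\ominus-}+A_{\ominus+}\Psi+A_{\ominus\oplus}\Psi_{\oplus-})$, $U^{(0)}_{\ominus\ominus}=|\tilde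 C_\ominus^{-1}|(A_{\ominus+}\Psi^{(1)}_{+\ominus}+A_{\ominus\oplus}\Psi^{(1)}_{\oplus\ominus})$, $U^{(0)}_{-\ominus}=|C_-^{-1}|(A_{-\ominus}+A_{-\oplus}\Psi_{\oplus\ominus})$, $U^{(0)}_{--}=|C_-^{-1}|(A_{--}+A_{-+}\Psi+A_{-\oplus}\Psi_{\oplus-})$, $K^{(-1)}_{\oplus+}=\tilde C_\oplus^{-1}A_{\oplus+}+\Psi_{\oplus\ominus}|\tilde C_\ominus^{-1}|A_{\ominus+}$.
   Formalization: In Ψ^(1)_{⊕-} the last two terms are +Ψ^(1)_{⊕⊖}U^(-1)_{⊖-}+Ψ_{⊕-}U^(0)_{--}; in Ψ^(2)_{+⊖} the term Ψ^(1)_{+⊖}U^(0)_{⊖⊖} is added and the inverse is (-U^(-1)_{⊖⊖})^{-1}; the last Sylvester equation gains Ψ^(1)_{+⊖}U^(0)_{⊖-} on the left. *)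

theory Defs
  imports "HOL-Analysis.Analysis" "HOL-Library.Landau_Symbols"
begin

text \<open>
  The phase space is a finite type. The block with rows in \<open>I\<close> and columns in \<open>J\<close> of a matrix
  indexed by phases is kept as a matrix of full size that vanishes outside \<open>I \<times> J\<close>. Products and
  sums of conformable blocks are then the ordinary ones, a partitioned matrix is the sum of its
  blocks, and any of the sets of phases may be empty. The order and the absolute value on
  \<open>real ^ 's ^ 's\<close> are the entrywise ones of the library.
\<close>

definition blk :: "real ^ 's ^ 's \<Rightarrow> 's set \<Rightarrow> 's set \<Rightarrow> real ^ 's ^ 's"
    ("_\<langle>_, _\<rangle>" [1000, 0, 0] 1000) where
  "M\<langle>I, J\<rangle> = (\<chi> i j. if i \<in> I \<and> j \<in> J then M $ i $ j else 0)"

definition diag_mat :: "('s \<Rightarrow> real) \<Rightarrow> real ^ 's ^ 's" where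
  "diag_mat d = (\<chi> i j. if i = j then d i else 0)"

definition is_blk_inverse :: "'s::finite set \<Rightarrow> real ^ 's ^ 's \<Rightarrow> real ^ 's ^ 's \<Rightarrow> bool" where
  "is_blk_inverse I M N \<longleftrightarrow>
     N = N\<langle>I, I\<rangle> \<and> M ** N = (mat 1)\<langle>I, I\<rangle> \<and> N ** M = (mat 1)\<langle>I, I\<rangle>"

definition blk_invertible :: "'s::finite set \<Rightarrow> real ^ 's ^ 's \<Rightarrow> bool" where
  "blk_invertible I M \<longleftrightarrow> (\<exists>N. is_blk_inverse I M N)"

text \<open>Inverse of an \<open>I \<times> I\<close> block; there is at most one \<open>N\<close> as required.\<close>

definition blk_inv :: "'s::finite set \<Rightarrow> real ^ 's ^ 's \<Rightarrow> real ^ 's ^ 's" where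
  "blk_inv I M = (THE N. is_blk_inverse I M N)"

definition generator :: "real ^ 's ^ 's \<Rightarrow> bool" where
  "generator A \<longleftrightarrow> (\<forall>i j. i \<noteq> j \<longrightarrow> 0 \<le> A $ i $ j) \<and> (\<forall>i. (\<Sum>j\<in>UNIV. A $ i $ j) = 0)"

definition stationary_vector :: "real ^ 's ^ 's \<Rightarrow> real ^ 's \<Rightarrow> bool" where
  "stationary_vector A \<xi> \<longleftrightarrow>
     0 \<le> \<xi> \<and> \<xi> v* A = 0 \<and> \<xi> \<bullet> 1 = 1 \<and> (\<forall>x. x v* A = 0 \<and> x \<bullet> 1 = 1 \<longrightarrow> x = \<xi>)"

text \<open>
  Left-hand side of the Riccati equation for return from above, for a fluid model with phase
  generator (or subgenerator) \<open>T\<close>, rate matrix \<open>D\<close>, phases \<open>P\<close> of positive and \<open>N\<close> of negative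
  rate. Since \<open>D\<close> is diagonal, \<open>|D\<^sub>N\<^sub>N|\<^sup>-\<^sup>1 = |D\<^sub>N\<^sub>N\<^sup>-\<^sup>1|\<close>.
\<close>

definition riccati :: "'s::finite set \<Rightarrow> 's set \<Rightarrow> real ^ 's ^ 's \<Rightarrow> real ^ 's ^ 's \<Rightarrow>
    real ^ 's ^ 's \<Rightarrow> real ^ 's ^ 's" where
  "riccati P N T D X =
     blk_inv P (D\<langle>P, P\<rangle>) ** (T\<langle>P, N\<rangle> + T\<langle>P, P\<rangle> ** X)
     + X ** blk_inv N \<bar>D\<langle>N, N\<rangle>\<bar> ** (T\<langle>N, N\<rangle> + T\<langle>N, P\<rangle> ** X)"

definition min_nonneg_solution :: "'s::finite set \<Rightarrow> 's set \<Rightarrow> real ^ 's ^ 's \<Rightarrow> real ^ 's ^ 's \<Rightarrow>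
    real ^ 's ^ 's \<Rightarrow> bool" where
  "min_nonneg_solution P N T D X \<longleftrightarrow>
     X = X\<langle>P, N\<rangle> \<and> 0 \<le> X \<and> riccati P N T D X = 0 \<and>
     (\<forall>Y. Y = Y\<langle>P, N\<rangle> \<and> 0 \<le> Y \<and> riccati P N T D Y = 0 \<longrightarrow> X \<le> Y)"

text \<open>
  The matrix of first return probabilities from above. A minimal nonnegative solution is unique
  when it exists.
\<close>

definition first_return :: "'s::finite set \<Rightarrow> 's set \<Rightarrow> real ^ 's ^ 's \<Rightarrow> real ^ 's ^ 's \<Rightarrow>
    real ^ 's ^ 's" where
  "first_return P N T D = (THE X. min_nonneg_solution P N T D X)"

text \<open>
  Generator of the phase process observed only while it is outside the set \<open>Z\<close> of phases of
  rate zero (the matrix \<open>Q\<close>).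
\<close>

definition censored :: "'s::finite set \<Rightarrow> real ^ 's ^ 's \<Rightarrow> real ^ 's ^ 's" where
  "censored Z A = A\<langle>- Z, - Z\<rangle> + A\<langle>- Z, Z\<rangle> ** (- blk_inv Z (A\<langle>Z, Z\<rangle>)) ** A\<langle>Z, - Z\<rangle>"

definition U_mat :: "'s::finite set \<Rightarrow> 's set \<Rightarrow> real ^ 's ^ 's \<Rightarrow> real ^ 's ^ 's \<Rightarrow>
    real ^ 's ^ 's \<Rightarrow> real ^ 's ^ 's" where
  "U_mat P N T D X = blk_inv N \<bar>D\<langle>N, N\<rangle>\<bar> ** (T\<langle>N, N\<rangle> + T\<langle>N, P\<rangle> ** X)"

definition K_mat :: "'s::finite set \<Rightarrow> 's set \<Rightarrow> real ^ 's ^ 's \<Rightarrow> real ^ 's ^ 's \<Rightarrow>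
    real ^ 's ^ 's \<Rightarrow> real ^ 's ^ 's" where
  "K_mat P N T D X = blk_inv P (D\<langle>P, P\<rangle>) ** T\<langle>P, P\<rangle> + X ** blk_inv N \<bar>D\<langle>N, N\<rangle>\<bar> ** T\<langle>N, P\<rangle>"

end

theory Submission
  imports Defs
begin

text \<open>
  As \<open>\<epsilon>\<close> tends to zero the phases in \<open>Op\<close> and \<open>Om\<close> become slow, and the Riccati
  equation for \<open>\<Psi>(\<epsilon>)\<close> is singular. It becomes regular after a change of scale: the
  rows of the equation that belong to \<open>Op\<close> are multiplied by \<open>\<epsilon>\<close>, and the block of the
  unknown at \<open>(Pl, Om)\<close> is written as \<open>\<epsilon>\<close> times a new unknown. All coefficients are
  then analytic in \<open>\<epsilon>\<close>, and at \<open>\<epsilon> = 0\<close> a limit Riccati equation remains. The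
  theorem follows once the limit equation has a nonnegative solution \<open>y0\<close> at which its
  linearisation is stable, in the sense that some entrywise positive direction \<open>H\<close> is mapped to
  an entrywise negative matrix. The rest is order theory, power series and comparison of
  coefficients.

  Existence and stability come from the drift condition. The Poisson equation of the phase
  process gives \<open>\<theta> > 0\<close> and a positive vector \<open>h\<close> with \<open>(A + \<theta> C) h < 0\<close>
  (\<open>negative_drift_lyapunov\<close>), and then also a positive row vector \<open>g\<close> with \<open>g (A + \<theta> C)
  < 0\<close>. Replacing \<open>A\<close> by \<open>A + \<theta> C\<close> does not change the limit equation, because the two
  contributions of \<open>C\<close> to each entry cancel (\<open>ric_diagonal\<close>, \<open>weights_cancel\<close>). For the tilted
  matrix the monotone iteration from zero preserves one bound in terms of \<open>h\<close> and one in terms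
  of \<open>g\<close>. These bound all entries, so the iteration converges (\<open>bounded_solution_exists\<close>), and
  they survive in the limit, where they make the matrices \<open>K\<close> and \<open>U\<close> of the limit stable
  (\<open>stable_vectors\<close>). The linearisation has the form \<open>K (s D) + (f D) U\<close> with weights \<open>s\<close> and
  \<open>f\<close> equal to zero on one block each, and a positive direction is built from the stability
  vectors of \<open>K\<close> and \<open>U\<close> (\<open>singular_certificate\<close>).

  Stability makes the linearisation an invertible Metzler operator, and \<open>y0\<close> extends to a
  convergent power series that solves the scaled equation (\<open>analytic_branch\<close>). For small
  \<open>\<epsilon>\<close> the matrix \<open>y0 + \<eta> H\<close> is a strict supersolution lying above the series.
  Below a supersolution there is a least solution; the difference of two solutions lies in the
  kernel of the linearisation at their midpoint, and stability at the supersolution makes this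
  kernel trivial (\<open>dominance\<close>). So the series is the least solution, which is
  \<open>\<Psi>(\<epsilon>)\<close> (\<open>branch_is_least\<close>, \<open>X_minimal\<close>).

  The formulas for the coefficients are the equations of orders zero and one, read block by
  block. The same kernel argument gives uniqueness in the Sylvester equations. When the other
  blocks are eliminated from the equation for the block of the first coefficient at \<open>(Pl, Mi)\<close>,
  its homogeneous form is the kernel equation of the full limit linearisation
  (\<open>linearization_injective\<close>). The block of \<open>y0\<close> at \<open>(Op, Om)\<close> solves a closed subsystem and is
  minimal there for the same reason as \<open>y0\<close> itself (\<open>min_Op_Om\<close>). For the block at \<open>(Pl, Mi)\<close>,
  eliminating the other blocks is the same as censoring the phases of rate zero
  (\<open>censored_riccati\<close>); every nonnegative solution of the censored equation extends to a
  nonnegative solution of the limit equation, so that minimality of \<open>y0\<close> passes to the block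
  (\<open>min_Pl_Mi\<close>).
\<close>

section \<open>Metzler matrices with a strict certificate\<close>

text \<open>
  At an index where \<open>\<bar>D\<bar> / H\<close> is largest, with value \<open>r\<close>, the step inequality forces
  \<open>0 \<le> r * w\<close>, so \<open>r = 0\<close>. Kernel arguments for operators with nonnegative off-diagonal part
  are instances: \<open>d\<close> is a shift that makes the diagonal nonnegative, and \<open>w\<close> is the negative
  image of \<open>H\<close>.
\<close>

lemma positive_ratio_zero:
  fixes H D w :: "'p \<Rightarrow> real"
  assumes "finite J" and H: "\<And>p. p \<in> J \<Longrightarrow> 0 < H p"
    and w: "\<And>p. p \<in> J \<Longrightarrow> w p < 0"
    and step: "\<And>p r. p \<in> J \<Longrightarrow> 0 \<le> r \<Longrightarrow> (\<And>q. q \<in> J \<Longrightarrow> \<bar>D q\<bar> \<le> r * H q)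
                 \<Longrightarrow> d * \<bar>D p\<bar> \<le> r * (d * H p + w p)"
    and "p \<in> J"
  shows "D p = 0"
proof -
  define r where "r = Max ((\<lambda>p. \<bar>D p\<bar> / H p) ` J)"
  have fin: "finite ((\<lambda>p. \<bar>D p\<bar> / H p) ` J)" and ne: "(\<lambda>p. \<bar>D p\<bar> / H p) ` J \<noteq> {}"
    using assms by auto
  have le: "\<bar>D q\<bar> \<le> r * H q" if "q \<in> J" for q
  proof -
    have "\<bar>D q\<bar> / H q \<le> r" unfolding r_def using fin that by (intro Max_ge) auto
    then show ?thesis using H[OF that] by (simp add: field_simps)
  qed
  have r0: "0 \<le> r"
    using le[OF \<open>p \<in> J\<close>] H[OF \<open>p \<in> J\<close>]
    by (smt (verit) mult_neg_pos)
  obtain q where q: "q \<in> J" "r = \<bar>D q\<bar> / H q"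
    using Max_in[OF fin ne] unfolding r_def by auto
  have "\<bar>D q\<bar> = r * H q" using q H[OF q(1)] by simp
  with step[OF q(1) r0 le] have "0 \<le> r * w q" by (simp add: algebra_simps)
  with w[OF q(1)] r0 have "r = 0"
    by (smt (verit) mult_pos_neg)
  then show ?thesis using le[OF \<open>p \<in> J\<close>] by simp
qed

text \<open>
  The minimum principle: at an index where \<open>x / h\<close> is smallest and negative, the off-diagonal
  terms only help, and \<open>M h < 0\<close> contradicts \<open>M x \<le> 0\<close>.
\<close>

lemma metzler_monotone:
  fixes M :: "'p \<Rightarrow> 'p \<Rightarrow> real"
  assumes "finite I" and off: "\<And>i j. i \<in> I \<Longrightarrow> j \<in> I \<Longrightarrow> i \<noteq> j \<Longrightarrow> 0 \<le> M i j"
    and h: "\<And>i. i \<in> I \<Longrightarrow> 0 < h i" and Mh: "\<And>i. i \<in> I \<Longrightarrow> (\<Sum>j\<in>I. M i j * h j) < 0"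
    and Mx: "\<And>i. i \<in> I \<Longrightarrow> (\<Sum>j\<in>I. M i j * x j) \<le> 0"
    and "k \<in> I"
  shows "0 \<le> x k"
proof (rule ccontr)
  assume neg: "\<not> 0 \<le> x k"
  define r where "r = Min ((\<lambda>i. x i / h i) ` I)"
  have fin: "finite ((\<lambda>i. x i / h i) ` I)" and ne: "(\<lambda>i. x i / h i) ` I \<noteq> {}"
    using assms by auto
  have le: "r * h q \<le> x q" if "q \<in> I" for q
  proof -
    have "r \<le> x q / h q" unfolding r_def using fin that by (intro Min_le) auto
    then show ?thesis using h[OF that] by (simp add: field_simps)
  qed
  have r0: "r < 0"
    using le[OF \<open>k \<in> I\<close>] h[OF \<open>k \<in> I\<close>] neg
    by (smt (verit) mult_nonneg_nonneg)
  obtain q where q: "q \<in> I" "r = x q / h q"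
    using Min_in[OF fin ne] unfolding r_def by auto
  have xq: "x q = r * h q" using q h[OF q(1)] by simp
  have "(\<Sum>j\<in>I. M q j * (r * h j)) \<le> (\<Sum>j\<in>I. M q j * x j)"
  proof (rule sum_mono)
    fix j assume "j \<in> I"
    then show "M q j * (r * h j) \<le> M q j * x j"
      using xq off[OF q(1) \<open>j \<in> I\<close>] le[OF \<open>j \<in> I\<close>] by (cases "j = q") (auto intro: mult_left_mono)
  qed
  also have "\<dots> \<le> 0" using Mx q by blast
  finally have "r * (\<Sum>j\<in>I. M q j * h j) \<le> 0"
    by (simp add: sum_distrib_left algebra_simps)
  with Mh[OF q(1)] r0 show False by (smt (verit) mult_neg_neg)
qed

text \<open>
  Nonnegativity of the inverse is the minimum principle applied to its columns. Stating the
  inverse of \<open>- M\<close> as a matrix \<open>B\<close> with \<open>M B = B M = - 1\<close> on \<open>I\<close> keeps minus signs out of the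
  sums.
\<close>

lemma metzler_inverse:
  fixes M :: "'p::finite \<Rightarrow> 'p \<Rightarrow> real"
  assumes off: "\<And>i j. i \<in> I \<Longrightarrow> j \<in> I \<Longrightarrow> i \<noteq> j \<Longrightarrow> 0 \<le> M i j"
    and h: "\<And>i. i \<in> I \<Longrightarrow> 0 < h i" and Mh: "\<And>i. i \<in> I \<Longrightarrow> (\<Sum>j\<in>I. M i j * h j) < 0"
  obtains B where "\<And>i j. i \<in> I \<Longrightarrow> j \<in> I \<Longrightarrow> (0::real) \<le> B i j"
    and "\<And>i j. i \<in> I \<Longrightarrow> j \<in> I \<Longrightarrow> (\<Sum>k\<in>I. M i k * B k j) = (if i = j then - 1 else 0)"
    and "\<And>i j. i \<in> I \<Longrightarrow> j \<in> I \<Longrightarrow> (\<Sum>k\<in>I. B i k * M k j) = (if i = j then - 1 else 0)"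
proof -
  (* Extending M by - 1 on the diagonal outside I turns the block into a full matrix with the
     same minimum principle. *)
  define N :: "real ^ 'p ^ 'p" where
    "N = (\<chi> i j. if i \<in> I \<and> j \<in> I then M i j else if i = j then - 1 else 0)"
  have row: "(\<Sum>k\<in>UNIV. N $ i $ k * y k) = (\<Sum>k\<in>I. M i k * y k)" if "i \<in> I" for i y
  proof -
    have "(\<Sum>k\<in>UNIV. N $ i $ k * y k) = (\<Sum>k\<in>I. N $ i $ k * y k)"
      by (rule sum.mono_neutral_right) (use that in \<open>auto simp: N_def\<close>)
    then show ?thesis using that by (simp add: N_def)
  qed
  have row': "(\<Sum>k\<in>UNIV. N $ i $ k * y k) = - y i" if "i \<notin> I" for i y
  proof -
    have "(\<Sum>k\<in>UNIV. N $ i $ k * y k) = (\<Sum>k\<in>{i}. N $ i $ k * y k)"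
      by (rule sum.mono_neutral_right) (use that in \<open>auto simp: N_def\<close>)
    then show ?thesis using that by (simp add: N_def)
  qed
  have mono: "0 \<le> y k" if "\<And>i. (\<Sum>k\<in>UNIV. N $ i $ k * y k) \<le> 0" for y :: "'p \<Rightarrow> real" and k
  proof (cases "k \<in> I")
    case True
    have "(\<Sum>j\<in>I. M i j * y j) \<le> 0" if "i \<in> I" for i
      using \<open>\<And>i. (\<Sum>k\<in>UNIV. N $ i $ k * y k) \<le> 0\<close>[of i] row[OF that, of y] by simp
    then show ?thesis
      using metzler_monotone[of I M h y k] off h Mh True by auto
  next
    case False
    then show ?thesis using that[of k] by (simp add: row')
  qed
  have "x = 0" if "N *v x = 0" for x
  proof -
    have 1: "(\<Sum>k\<in>UNIV. N $ i $ k * x $ k) = 0" for i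
      using that by (simp add: vec_eq_iff matrix_vector_mult_def)
    have "0 \<le> x $ k" for k using mono[of "\<lambda>k. x $ k"] 1 by simp
    moreover have "0 \<le> - x $ k" for k
      using mono[of "\<lambda>k. - x $ k"] 1 by (simp add: sum_negf)
    ultimately show "x = 0" by (simp add: vec_eq_iff antisym)
  qed
  then have "invertible N"
    using matrix_left_invertible_ker[of N] invertible_left_inverse[of N] by auto
  then obtain R where R: "N ** R = mat 1" "R ** N = mat 1" unfolding invertible_def by auto
  define B where "B i j = - R $ i $ j" for i j
  have NR: "(\<Sum>k\<in>UNIV. N $ i $ k * R $ k $ j) = (if i = j then 1 else 0)" for i j
    using R(1) by (simp add: vec_eq_iff matrix_matrix_mult_def mat_def)
  have RN: "(\<Sum>k\<in>UNIV. R $ i $ k * N $ k $ j) = (if i = j then 1 else 0)" for i j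
    using R(2) by (simp add: vec_eq_iff matrix_matrix_mult_def mat_def)
  show ?thesis
  proof (rule that[of B])
    fix i j assume ij: "i \<in> I" "j \<in> I"
    have "0 \<le> B i j"
      by (rule mono) (use NR[of _ j] in \<open>auto simp: B_def sum_negf\<close>)
    then show "0 \<le> B i j" .
    show "(\<Sum>k\<in>I. M i k * B k j) = (if i = j then - 1 else 0)"
      using NR[of i j] row[OF ij(1), of "\<lambda>k. R $ k $ j"] by (simp add: B_def sum_negf)
    have "(\<Sum>k\<in>UNIV. R $ i $ k * N $ k $ j) = (\<Sum>k\<in>I. R $ i $ k * N $ k $ j)"
      by (rule sum.mono_neutral_right) (use ij in \<open>auto simp: N_def\<close>)
    then show "(\<Sum>k\<in>I. B i k * M k j) = (if i = j then - 1 else 0)"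
      using RN[of i j] ij by (simp add: B_def N_def sum_negf)
  qed
qed

text \<open>
  The column sums of the nonnegative inverse of \<open>- M\<close> form such a row vector. Strict
  certificates on the right and on the left are therefore interchangeable.
\<close>

lemma metzler_left_vector:
  fixes M :: "'p::finite \<Rightarrow> 'p \<Rightarrow> real"
  assumes off: "\<And>i j. i \<in> I \<Longrightarrow> j \<in> I \<Longrightarrow> i \<noteq> j \<Longrightarrow> 0 \<le> M i j"
    and h: "\<And>i. i \<in> I \<Longrightarrow> 0 < h i" and Mh: "\<And>i. i \<in> I \<Longrightarrow> (\<Sum>j\<in>I. M i j * h j) < 0"
  obtains b where "\<And>i. i \<in> I \<Longrightarrow> (0::real) < b i" and "\<And>j. j \<in> I \<Longrightarrow> (\<Sum>i\<in>I. b i * M i j) < 0"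
proof -
  obtain B where B: "\<And>i j. i \<in> I \<Longrightarrow> j \<in> I \<Longrightarrow> (0::real) \<le> B i j"
    "\<And>i j. i \<in> I \<Longrightarrow> j \<in> I \<Longrightarrow> (\<Sum>k\<in>I. B i k * M k j) = (if i = j then - 1 else 0)"
    by (rule metzler_inverse[of I M h]) (use off h Mh in auto)
  define b where "b k = (\<Sum>i\<in>I. B i k)" for k
  have bM: "(\<Sum>i\<in>I. b i * M i j) = - 1" if "j \<in> I" for j
  proof -
    have "(\<Sum>i\<in>I. b i * M i j) = (\<Sum>i\<in>I. \<Sum>k\<in>I. B i k * M k j)"
      unfolding b_def sum_distrib_right by (rule sum.swap)
    also have "\<dots> = (\<Sum>i\<in>I. if i = j then - 1 else 0)"
      using B(2)[OF _ that] by (intro sum.cong) auto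
    finally show ?thesis using that by simp
  qed
  have b0: "0 \<le> b k" if "k \<in> I" for k unfolding b_def by (intro sum_nonneg B(1) that)
  have "0 < b k" if k: "k \<in> I" for k
  proof (rule ccontr)
    assume "\<not> 0 < b k"
    with b0[OF k] have "b k = 0" by simp
    then have "0 \<le> (\<Sum>i\<in>I. b i * M i k)"
    proof (intro sum_nonneg)
      fix i assume "i \<in> I"
      then show "0 \<le> b i * M i k"
        using off[OF \<open>i \<in> I\<close> k] b0[OF \<open>i \<in> I\<close>] \<open>b k = 0\<close> by (cases "i = k") auto
    qed
    then show False using bM[OF k] by simp
  qed
  then show ?thesis using that[of b] bM by auto
qed

lemma metzler_right_vector:
  fixes M :: "'p::finite \<Rightarrow> 'p \<Rightarrow> real"
  assumes off: "\<And>i j. i \<in> I \<Longrightarrow> j \<in> I \<Longrightarrow> i \<noteq> j \<Longrightarrow> 0 \<le> M i j"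
    and g: "\<And>i. i \<in> I \<Longrightarrow> 0 < g i" and gM: "\<And>j. j \<in> I \<Longrightarrow> (\<Sum>i\<in>I. g i * M i j) < 0"
  obtains a where "\<And>i. i \<in> I \<Longrightarrow> (0::real) < a i" and "\<And>i. i \<in> I \<Longrightarrow> (\<Sum>j\<in>I. M i j * a j) < 0"
proof -
  obtain a where "\<And>i. i \<in> I \<Longrightarrow> (0::real) < a i" "\<And>j. j \<in> I \<Longrightarrow> (\<Sum>i\<in>I. a i * M j i) < 0"
    by (rule metzler_left_vector[of I "\<lambda>i j. M j i" g])
       (use off g gM in \<open>auto simp: mult.commute\<close>)
  then show ?thesis using that[of a] by (simp add: mult.commute)
qed

section \<open>Riccati maps with weights\<close>

text \<open>
  \<open>lin\<close> is the matrix product \<open>A (s Y)\<close> with rows in all phases, the weight \<open>s\<close> acting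
  entrywise. In \<open>ric\<close>, \<open>f i l\<close> is the weight of \<open>Y i l\<close> as left factor of the quadratic part.
  For the unscaled fluid equation \<open>s\<close> is one and \<open>f i l\<close> depends on \<open>l\<close> only; the entrywise
  weights describe the scaled equation, whose limit has vanishing weights on some blocks. The
  coefficients lie in an arbitrary commutative ring so that the same map serves for real
  matrices and for power series.
\<close>

definition lin :: "'s set \<Rightarrow> ('s \<Rightarrow> 's \<Rightarrow> 'a) \<Rightarrow> ('s \<Rightarrow> 's \<Rightarrow> 'a) \<Rightarrow> ('s \<Rightarrow> 's \<Rightarrow> 'a) \<Rightarrow> 's \<Rightarrow> 's \<Rightarrow> 'a::comm_ring_1" where
  "lin P s A Y l j = (\<Sum>k\<in>P. A l k * (s k j * Y k j))"

definition ric :: "'s set \<Rightarrow> 's set \<Rightarrow> ('s \<Rightarrow> 'a) \<Rightarrow> ('s \<Rightarrow> 's \<Rightarrow> 'a) \<Rightarrow> ('s \<Rightarrow> 's \<Rightarrow> 'a) \<Rightarrow>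
    ('s \<Rightarrow> 's \<Rightarrow> 'a) \<Rightarrow> ('s \<Rightarrow> 's \<Rightarrow> 'a) \<Rightarrow> 's \<Rightarrow> 's \<Rightarrow> 'a::comm_ring_1" where
  "ric P N e f s A Y i j = e i * (A i j + lin P s A Y i j)
     + (\<Sum>l\<in>N. f i l * Y i l * (A l j + lin P s A Y l j))"

text \<open>
  The derivative of \<open>ric\<close> at \<open>Y\<close> in the direction \<open>D\<close>.
\<close>

definition dric :: "'s set \<Rightarrow> 's set \<Rightarrow> ('s \<Rightarrow> 'a) \<Rightarrow> ('s \<Rightarrow> 's \<Rightarrow> 'a) \<Rightarrow> ('s \<Rightarrow> 's \<Rightarrow> 'a) \<Rightarrow>
    ('s \<Rightarrow> 's \<Rightarrow> 'a) \<Rightarrow> ('s \<Rightarrow> 's \<Rightarrow> 'a) \<Rightarrow> ('s \<Rightarrow> 's \<Rightarrow> 'a) \<Rightarrow> 's \<Rightarrow> 's \<Rightarrow> 'a::comm_ring_1" where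
  "dric P N e f s A Y D i j = e i * lin P s A D i j
     + (\<Sum>l\<in>N. f i l * Y i l * lin P s A D l j + f i l * D i l * (A l j + lin P s A Y l j))"

lemma lin_cong:
  assumes "\<And>k. k \<in> P \<Longrightarrow> Y k j = Z k j"
  shows "lin P s A Y l j = lin P s A Z l j"
  unfolding lin_def using assms by (intro sum.cong) auto

lemma ric_cong:
  assumes "i \<in> P" "j \<in> N" "\<And>k l. k \<in> P \<Longrightarrow> l \<in> N \<Longrightarrow> Y k l = Z k l"
  shows "ric P N e f s A Y i j = ric P N e f s A Z i j"
proof -
  have "lin P s A Y l j = lin P s A Z l j" for l by (rule lin_cong) (use assms in auto)
  then show ?thesis unfolding ric_def using assms by simp
qed

lemma lin_add: "lin P s A (\<lambda>k l. X k l + Y k l) l j = lin P s A X l j + lin P s A Y l j"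
  unfolding lin_def by (simp add: algebra_simps sum.distrib)

lemma lin_diff: "lin P s A (\<lambda>k l. X k l - Y k l) l j = lin P s A X l j - lin P s A Y l j"
  unfolding lin_def by (simp add: algebra_simps sum_subtractf)

lemma lin_scale: "lin P s A (\<lambda>k l. c * Y k l) l j = c * lin P s A Y l j"
  unfolding lin_def by (simp add: algebra_simps sum_distrib_left)

lemma ric_add_scale:
  "ric P N e f s A (\<lambda>k l. Y k l + c * D k l) i j
     = ric P N e f s A Y i j + c * dric P N e f s A Y D i j
       + c * c * (\<Sum>l\<in>N. f i l * D i l * lin P s A D l j)"
proof -
  have "(\<Sum>l\<in>N. f i l * (Y i l + c * D i l) * (A l j + (lin P s A Y l j + c * lin P s A D l j)))
     = (\<Sum>l\<in>N. f i l * Y i l * (A l j + lin P s A Y l j))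
       + c * (\<Sum>l\<in>N. f i l * Y i l * lin P s A D l j + f i l * D i l * (A l j + lin P s A Y l j))
       + c * c * (\<Sum>l\<in>N. f i l * D i l * lin P s A D l j)"
    unfolding sum_distrib_left sum.distrib[symmetric] by (intro sum.cong) (auto simp: algebra_simps)
  then show ?thesis unfolding ric_def dric_def lin_add lin_scale by (simp add: algebra_simps)
qed

lemma dric_add_scale:
  "dric P N e f s A (\<lambda>k l. Y k l + c * D k l) H i j
     = dric P N e f s A Y H i j
       + c * (\<Sum>l\<in>N. f i l * D i l * lin P s A H l j + f i l * H i l * lin P s A D l j)"
proof -
  have "(\<Sum>l\<in>N. f i l * (Y i l + c * D i l) * lin P s A H l j
          + f i l * H i l * (A l j + (lin P s A Y l j + c * lin P s A D l j)))
     = (\<Sum>l\<in>N. f i l * Y i l * lin P s A H l j + f i l * H i l * (A l j + lin P s A Y l j))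
       + c * (\<Sum>l\<in>N. f i l * D i l * lin P s A H l j + f i l * H i l * lin P s A D l j)"
    unfolding sum_distrib_left sum.distrib[symmetric] by (intro sum.cong) (auto simp: algebra_simps)
  then show ?thesis unfolding dric_def lin_add lin_scale by (simp add: algebra_simps)
qed

text \<open>
  For a quadratic map the difference of two values is exactly the derivative at the midpoint. So
  the difference of two solutions is in the kernel of one linearisation.
\<close>

lemma ric_diff:
  fixes A :: "'s \<Rightarrow> 's \<Rightarrow> real"
  shows "ric P N e f s A Y i j - ric P N e f s A X i j
     = dric P N e f s A (\<lambda>k l. (X k l + Y k l) / 2) (\<lambda>k l. Y k l - X k l) i j"
proof -
  have half: "lin P s A (\<lambda>k l. (X k l + Y k l) / 2) l j = (lin P s A X l j + lin P s A Y l j) / 2" for l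
    using lin_scale[of P s A "1/2" "\<lambda>k l. X k l + Y k l" l j] by (simp add: lin_add)
  have "(\<Sum>l\<in>N. f i l * Y i l * (A l j + lin P s A Y l j))
      - (\<Sum>l\<in>N. f i l * X i l * (A l j + lin P s A X l j))
    = (\<Sum>l\<in>N. f i l * ((X i l + Y i l) / 2) * (lin P s A Y l j - lin P s A X l j)
         + f i l * (Y i l - X i l) * (A l j + (lin P s A X l j + lin P s A Y l j) / 2))"
    unfolding sum_subtractf[symmetric] by (intro sum.cong) (auto simp: field_simps)
  then show ?thesis unfolding ric_def dric_def half lin_diff by (simp add: algebra_simps)
qed

locale riccati_data =
  fixes P N :: "'s::finite set" and e :: "'s \<Rightarrow> real" and f s A :: "'s \<Rightarrow> 's \<Rightarrow> real"
  assumes disj: "P \<inter> N = {}"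
    and e: "\<And>i. i \<in> P \<Longrightarrow> 0 \<le> e i"
    and f: "\<And>i l. i \<in> P \<Longrightarrow> l \<in> N \<Longrightarrow> 0 \<le> f i l"
    and s: "\<And>k j. k \<in> P \<Longrightarrow> j \<in> N \<Longrightarrow> 0 \<le> s k j"
    and off: "\<And>i j. i \<in> P \<union> N \<Longrightarrow> j \<in> P \<union> N \<Longrightarrow> i \<noteq> j \<Longrightarrow> 0 \<le> A i j"
begin

text \<open>
  A constant so large that adding it to the diagonal makes the linear part of the map, and also
  its derivatives at nonnegative matrices, monotone.
\<close>

definition dl where
  "dl = 1 + (\<Sum>i\<in>UNIV. \<bar>e i * A i i\<bar>) + (\<Sum>i\<in>UNIV. \<Sum>j\<in>UNIV. \<bar>e i * A i i * s i j\<bar>)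
          + (\<Sum>i\<in>UNIV. \<Sum>j\<in>UNIV. \<bar>f i j * A j j\<bar>)"

lemma dl_bounds: "0 < dl" "\<bar>e i * A i i\<bar> \<le> dl" "\<bar>f i j * A j j\<bar> \<le> dl"
  "\<bar>e i * A i i * s i j\<bar> + \<bar>f i j * A j j\<bar> \<le> dl"
proof -
  have 1: "\<bar>g i\<bar> \<le> (\<Sum>i\<in>UNIV. \<bar>g i\<bar>)" for g :: "'s \<Rightarrow> real" and i
    by (rule member_le_sum) auto
  have 2: "\<bar>g i j\<bar> \<le> (\<Sum>i\<in>UNIV. \<Sum>j\<in>UNIV. \<bar>g i j\<bar>)" for g :: "'s \<Rightarrow> 's \<Rightarrow> real" and i j
  proof -
    have "\<bar>g i j\<bar> \<le> (\<Sum>j\<in>UNIV. \<bar>g i j\<bar>)" by (rule member_le_sum) auto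
    also have "\<dots> \<le> (\<Sum>i\<in>UNIV. \<Sum>j\<in>UNIV. \<bar>g i j\<bar>)"
      by (rule member_le_sum[of i UNIV "\<lambda>i. \<Sum>j\<in>UNIV. \<bar>g i j\<bar>"]) (auto intro: sum_nonneg)
    finally show ?thesis .
  qed
  note b = 1[of "\<lambda>i. e i * A i i" i] 2[of "\<lambda>i j. e i * A i i * s i j" i j] 2[of "\<lambda>i j. f i j * A j j" i j]
  show "0 < dl" "\<bar>e i * A i i\<bar> \<le> dl" "\<bar>f i j * A j j\<bar> \<le> dl"
    "\<bar>e i * A i i * s i j\<bar> + \<bar>f i j * A j j\<bar> \<le> dl"
    unfolding dl_def using b by linarith+
qed

abbreviation "Lin \<equiv> lin P s A"
abbreviation "Ric \<equiv> ric P N e f s A"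
abbreviation "DRic \<equiv> dric P N e f s A"

definition shifted where
  "shifted D i j = dl * D i j + e i * Lin D i j + (\<Sum>l\<in>N. f i l * D i l * A l j)"

lemma Lin_mono:
  assumes "l \<in> N" "j \<in> N" "\<And>k. k \<in> P \<Longrightarrow> X k j \<le> Y k j"
  shows "Lin X l j \<le> Lin Y l j"
  unfolding lin_def
  using assms disj by (intro sum_mono mult_left_mono s off) auto

lemma Lin_abs_le:
  assumes "l \<in> N" "j \<in> N" "\<And>k. k \<in> P \<Longrightarrow> \<bar>X k j\<bar> \<le> Y k j"
  shows "\<bar>Lin X l j\<bar> \<le> Lin Y l j"
proof -
  have "Lin X l j \<le> Lin Y l j" by (rule Lin_mono) (use assms in \<open>auto simp: abs_le_iff\<close>)
  moreover have "Lin (\<lambda>k l. - 1 * X k l) l j \<le> Lin Y l j"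
    by (rule Lin_mono) (use assms in \<open>auto simp: abs_le_iff\<close>)
  ultimately show ?thesis unfolding lin_scale by (simp add: abs_le_iff)
qed

lemma shifted_nonneg:
  assumes ij: "i \<in> P" "j \<in> N" and D: "\<And>k l. k \<in> P \<Longrightarrow> l \<in> N \<Longrightarrow> 0 \<le> D k l"
  shows "0 \<le> shifted D i j"
proof -
  have "Lin D i j = A i i * (s i j * D i j) + (\<Sum>k\<in>P - {i}. A i k * (s k j * D k j))"
    unfolding lin_def using ij by (intro sum.remove) auto
  moreover have "0 \<le> (\<Sum>k\<in>P - {i}. A i k * (s k j * D k j))"
    using ij D by (intro sum_nonneg mult_nonneg_nonneg off s) auto
  ultimately have 1: "e i * A i i * s i j * D i j \<le> e i * Lin D i j"
    using e[OF ij(1)] by (simp add: algebra_simps)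
  have "(\<Sum>l\<in>N. f i l * D i l * A l j) = f i j * D i j * A j j + (\<Sum>l\<in>N - {j}. f i l * D i l * A l j)"
    using ij by (intro sum.remove) auto
  moreover have "0 \<le> (\<Sum>l\<in>N - {j}. f i l * D i l * A l j)"
    using ij D by (intro sum_nonneg mult_nonneg_nonneg off f) auto
  ultimately have 2: "f i j * A j j * D i j \<le> (\<Sum>l\<in>N. f i l * D i l * A l j)"
    by (simp add: algebra_simps)
  have "0 \<le> (dl + e i * A i i * s i j + f i j * A j j) * D i j"
    using dl_bounds(4)[of i j] D[OF ij] by (intro mult_nonneg_nonneg) auto
  then show ?thesis unfolding shifted_def using 1 2 by (simp add: algebra_simps)
qed

lemma shifted_diff: "shifted (\<lambda>k l. X k l - Y k l) i j = shifted X i j - shifted Y i j"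
  unfolding shifted_def lin_diff by (simp add: algebra_simps sum_subtractf sum.distrib)

lemma shifted_scale: "shifted (\<lambda>k l. c * Y k l) i j = c * shifted Y i j"
  unfolding shifted_def lin_scale by (simp add: algebra_simps sum_distrib_left)

lemma shifted_mono:
  assumes "i \<in> P" "j \<in> N" "\<And>k l. k \<in> P \<Longrightarrow> l \<in> N \<Longrightarrow> X k l \<le> Y k l"
  shows "shifted X i j \<le> shifted Y i j"
  using shifted_nonneg[of i j "\<lambda>k l. Y k l - X k l"] assms by (simp add: shifted_diff)

lemma shifted_abs_le:
  assumes "i \<in> P" "j \<in> N" "\<And>k l. k \<in> P \<Longrightarrow> l \<in> N \<Longrightarrow> \<bar>X k l\<bar> \<le> Y k l"
  shows "\<bar>shifted X i j\<bar> \<le> shifted Y i j"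
proof -
  have "shifted X i j \<le> shifted Y i j" by (rule shifted_mono) (use assms in \<open>auto simp: abs_le_iff\<close>)
  moreover have "shifted (\<lambda>k l. - 1 * X k l) i j \<le> shifted Y i j"
    by (rule shifted_mono) (use assms in \<open>auto simp: abs_le_iff\<close>)
  ultimately show ?thesis unfolding shifted_scale by (simp add: abs_le_iff)
qed

lemma Ric_shifted: "dl * Y i j + Ric Y i j = shifted Y i j + e i * A i j + (\<Sum>l\<in>N. f i l * Y i l * Lin Y l j)"
  unfolding ric_def shifted_def by (simp add: algebra_simps sum.distrib)

lemma DRic_shifted: "dl * D i j + DRic Y D i j
   = shifted D i j + (\<Sum>l\<in>N. f i l * Y i l * Lin D l j + f i l * D i l * Lin Y l j)"
  unfolding dric_def shifted_def by (simp add: algebra_simps sum.distrib)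

lemma Ric_mono:
  assumes "i \<in> P" "j \<in> N" "\<And>k l. k \<in> P \<Longrightarrow> l \<in> N \<Longrightarrow> 0 \<le> X k l \<and> X k l \<le> Y k l"
  shows "dl * X i j + Ric X i j \<le> dl * Y i j + Ric Y i j"
proof -
  have "0 \<le> Lin X l j" if "l \<in> N" for l
    using Lin_mono[of l j "\<lambda>_ _. 0" X] that assms by (auto simp: lin_def)
  then have "(\<Sum>l\<in>N. f i l * X i l * Lin X l j) \<le> (\<Sum>l\<in>N. f i l * Y i l * Lin Y l j)"
    using assms by (intro sum_mono mult_mono Lin_mono mult_nonneg_nonneg f) (auto intro: order_trans)
  then show ?thesis unfolding Ric_shifted using shifted_mono[of i j X Y] assms by auto
qed

lemma Ric_zero: "i \<in> P \<Longrightarrow> j \<in> N \<Longrightarrow> 0 \<le> Ric (\<lambda>_ _. 0) i j"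
  unfolding ric_def lin_def using disj e off by (auto intro!: mult_nonneg_nonneg)

text \<open>
  A derivative taken at \<open>M\<close> is, off the diagonal, dominated entrywise by the one at \<open>E\<close> when
  \<open>\<bar>M\<bar> \<le> E\<close>. A positive direction that the derivative at \<open>E\<close> makes negative thus
  excludes nonzero kernel elements at every such \<open>M\<close>. Applied with \<open>M\<close> the midpoint of two
  solutions below \<open>E\<close> it gives uniqueness, and applied with \<open>M = E\<close> it gives injectivity of the
  linearisation.
\<close>

lemma dominance:
  assumes H: "\<And>i j. i \<in> P \<Longrightarrow> j \<in> N \<Longrightarrow> 0 < H i j"
    and cert: "\<And>i j. i \<in> P \<Longrightarrow> j \<in> N \<Longrightarrow> DRic E H i j < 0"
    and M: "\<And>i j. i \<in> P \<Longrightarrow> j \<in> N \<Longrightarrow> \<bar>M i j\<bar> \<le> E i j"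
    and D: "\<And>i j. i \<in> P \<Longrightarrow> j \<in> N \<Longrightarrow> DRic M D i j = 0"
    and ij: "i \<in> P" "j \<in> N"
  shows "D i j = 0"
proof -
  have "(\<lambda>(i, j). D i j) (i, j) = 0"
  proof (rule positive_ratio_zero[where J = "P \<times> N" and H = "\<lambda>(i, j). H i j"
        and w = "\<lambda>(i, j). DRic E H i j" and d = dl])
    fix p and r :: real
    assume p: "p \<in> P \<times> N" and r: "0 \<le> r"
      and le: "\<And>q. q \<in> P \<times> N \<Longrightarrow> \<bar>case q of (i, j) \<Rightarrow> D i j\<bar> \<le> r * (case q of (i, j) \<Rightarrow> H i j)"
    obtain i j where p_def: "p = (i, j)" and ij: "i \<in> P" "j \<in> N" using p by auto
    have D_le: "\<bar>D k l\<bar> \<le> r * H k l" if "k \<in> P" "l \<in> N" for k l using le[of "(k, l)"] that by auto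
    have E0: "0 \<le> E k l" if "k \<in> P" "l \<in> N" for k l using M[OF that] by linarith
    have LE0: "0 \<le> Lin E l j" if "l \<in> N" for l
      using Lin_mono[of l j "\<lambda>_ _. 0" E] that E0 ij by (auto simp: lin_def)
    have *: "\<bar>\<Sum>l\<in>N. f i l * M i l * Lin D l j + f i l * D i l * Lin M l j\<bar>
      \<le> (\<Sum>l\<in>N. f i l * E i l * Lin (\<lambda>k l. r * H k l) l j + f i l * (r * H i l) * Lin E l j)"
    proof (rule order_trans[OF sum_abs], rule sum_mono)
      fix l assume l: "l \<in> N"
      have 1: "\<bar>Lin D l j\<bar> \<le> Lin (\<lambda>k l. r * H k l) l j"
        by (rule Lin_abs_le) (use l ij D_le in auto)
      have 2: "\<bar>Lin M l j\<bar> \<le> Lin E l j"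
        by (rule Lin_abs_le) (use l ij M in auto)
      have "\<bar>f i l * M i l * Lin D l j\<bar> \<le> f i l * E i l * Lin (\<lambda>k l. r * H k l) l j"
        unfolding abs_mult using 1 M[OF ij(1) l] f[OF ij(1) l] E0[OF ij(1) l] by (intro mult_mono) auto
      moreover have "\<bar>f i l * D i l * Lin M l j\<bar> \<le> f i l * (r * H i l) * Lin E l j"
        unfolding abs_mult using 2 D_le[OF ij(1) l] f[OF ij(1) l] r H[OF ij(1) l]
        by (intro mult_mono) auto
      ultimately show "\<bar>f i l * M i l * Lin D l j + f i l * D i l * Lin M l j\<bar>
        \<le> f i l * E i l * Lin (\<lambda>k l. r * H k l) l j + f i l * (r * H i l) * Lin E l j" by linarith
    qed
    have "dl * D i j = shifted D i j + (\<Sum>l\<in>N. f i l * M i l * Lin D l j + f i l * D i l * Lin M l j)"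
      using DRic_shifted[of D i j M] D[OF ij] by simp
    then have "\<bar>dl * D i j\<bar> \<le> shifted (\<lambda>k l. r * H k l) i j
        + (\<Sum>l\<in>N. f i l * E i l * Lin (\<lambda>k l. r * H k l) l j + f i l * (r * H i l) * Lin E l j)"
      using shifted_abs_le[of i j D "\<lambda>k l. r * H k l"] ij D_le * by auto
    also have "\<dots> = r * (shifted H i j + (\<Sum>l\<in>N. f i l * E i l * Lin H l j + f i l * H i l * Lin E l j))"
      unfolding shifted_scale lin_scale by (simp add: algebra_simps sum_distrib_left)
    also have "\<dots> = r * (dl * H i j + DRic E H i j)"
      using DRic_shifted[of H i j E] by simp
    finally show "dl * \<bar>case p of (i, j) \<Rightarrow> D i j\<bar>
        \<le> r * (dl * (case p of (i, j) \<Rightarrow> H i j) + (case p of (i, j) \<Rightarrow> DRic E H i j))"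
      using dl_bounds(1) by (simp add: p_def abs_mult)
  qed (use H cert ij in auto)
  then show ?thesis by simp
qed

text \<open>
  The infimum of all nonnegative supersolutions is a supersolution by monotonicity, and it is
  fixed by the iteration map because that map sends supersolutions to smaller ones.
\<close>

lemma least_solution_exists:
  assumes E: "\<And>i j. i \<in> P \<Longrightarrow> j \<in> N \<Longrightarrow> 0 \<le> E i j \<and> Ric E i j \<le> 0"
  obtains L where "\<And>i j. i \<in> P \<Longrightarrow> j \<in> N \<Longrightarrow> 0 \<le> L i j \<and> Ric L i j = 0 \<and> L i j \<le> E i j"
    and "\<And>Y i j. (\<And>i j. i \<in> P \<Longrightarrow> j \<in> N \<Longrightarrow> 0 \<le> Y i j \<and> Ric Y i j \<le> 0) \<Longrightarrow>
           i \<in> P \<Longrightarrow> j \<in> N \<Longrightarrow> L i j \<le> Y i j"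
proof -
  define Sup where "Sup = {Y. \<forall>i\<in>P. \<forall>j\<in>N. 0 \<le> Y i j \<and> Ric Y i j \<le> 0}"
  define L where "L i j = Inf ((\<lambda>Y. Y i j) ` Sup)" for i j
  define \<Phi> where "\<Phi> Y i j = Y i j + Ric Y i j / dl" for Y i j
  have E': "E \<in> Sup" using E by (auto simp: Sup_def)
  have low: "L i j \<le> Y i j" if "Y \<in> Sup" "i \<in> P" "j \<in> N" for Y i j
    unfolding L_def using that by (intro cINF_lower) (auto simp: Sup_def bdd_below_def)
  have great: "x \<le> L i j" if "\<And>Y. Y \<in> Sup \<Longrightarrow> x \<le> Y i j" for x i j
    unfolding L_def using E' that by (intro cINF_greatest) auto
  have L0: "0 \<le> L i j" if "i \<in> P" "j \<in> N" for i j
    by (rule great) (use that in \<open>auto simp: Sup_def\<close>)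
  have mono: "\<Phi> X i j \<le> \<Phi> Y i j"
    if "i \<in> P" "j \<in> N" "\<And>k l. k \<in> P \<Longrightarrow> l \<in> N \<Longrightarrow> 0 \<le> X k l \<and> X k l \<le> Y k l" for X Y i j
  proof -
    have "\<Phi> Z i j = (dl * Z i j + Ric Z i j) / dl" for Z
      using dl_bounds(1) by (simp add: \<Phi>_def add_divide_distrib)
    then show ?thesis using Ric_mono[of i j X Y] that dl_bounds(1) by (simp add: divide_right_mono)
  qed
  have le: "\<Phi> L i j \<le> L i j" if ij: "i \<in> P" "j \<in> N" for i j
  proof (rule great)
    fix Y assume Y: "Y \<in> Sup"
    have "\<Phi> L i j \<le> \<Phi> Y i j" by (rule mono) (use ij L0 low Y in auto)
    also have "\<dots> \<le> Y i j"
      using Y ij dl_bounds(1) by (auto simp: \<Phi>_def Sup_def divide_nonpos_pos)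
    finally show "\<Phi> L i j \<le> Y i j" .
  qed
  have \<Phi>0: "0 \<le> \<Phi> L i j" if "i \<in> P" "j \<in> N" for i j
    using mono[of i j "\<lambda>_ _. 0" L] L0 that Ric_zero[of i j] dl_bounds(1)
    by (auto simp: \<Phi>_def intro: order_trans[OF divide_nonneg_pos])
  have "\<Phi> L \<in> Sup"
  proof -
    have "Ric (\<Phi> L) i j \<le> 0" if ij: "i \<in> P" "j \<in> N" for i j
      using mono[of i j "\<Phi> L" L] ij \<Phi>0 le dl_bounds(1) unfolding \<Phi>_def[of "\<Phi> L"]
      by (smt (verit) \<Phi>_def divide_pos_pos)
    then show ?thesis using \<Phi>0 by (auto simp: Sup_def)
  qed
  then have "L i j \<le> \<Phi> L i j" if "i \<in> P" "j \<in> N" for i j using low that by blast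
  with le have "\<Phi> L i j = L i j" if "i \<in> P" "j \<in> N" for i j using that by force
  then have "Ric L i j = 0" if "i \<in> P" "j \<in> N" for i j
    using that dl_bounds(1) by (auto simp: \<Phi>_def)
  then show ?thesis
    using that[of L] L0 low E' by (auto simp: Sup_def)
qed

text \<open>
  Two solutions below the supersolution \<open>E\<close> coincide by dominance at their midpoint; in
  particular \<open>X\<close> equals the least solution below \<open>E\<close>. Nonnegativity of \<open>X\<close> is a conclusion,
  since only \<open>\<bar>X\<bar> \<le> E\<close> is known for the values of a power series whose constant
  term may vanish.
\<close>

lemma certified_solution_least:
  assumes E: "\<And>i j. i \<in> P \<Longrightarrow> j \<in> N \<Longrightarrow> 0 \<le> E i j \<and> Ric E i j \<le> 0"
    and H: "\<And>i j. i \<in> P \<Longrightarrow> j \<in> N \<Longrightarrow> 0 < H i j"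
    and cert: "\<And>i j. i \<in> P \<Longrightarrow> j \<in> N \<Longrightarrow> DRic E H i j < 0"
    and X: "\<And>i j. i \<in> P \<Longrightarrow> j \<in> N \<Longrightarrow> \<bar>X i j\<bar> \<le> E i j \<and> Ric X i j = 0"
  shows "\<And>i j. i \<in> P \<Longrightarrow> j \<in> N \<Longrightarrow> 0 \<le> X i j"
    and "\<And>Y i j. (\<And>i j. i \<in> P \<Longrightarrow> j \<in> N \<Longrightarrow> 0 \<le> Y i j \<and> Ric Y i j \<le> 0) \<Longrightarrow>
           i \<in> P \<Longrightarrow> j \<in> N \<Longrightarrow> X i j \<le> Y i j"
proof -
  obtain L where L: "\<And>i j. i \<in> P \<Longrightarrow> j \<in> N \<Longrightarrow> 0 \<le> L i j \<and> Ric L i j = 0 \<and> L i j \<le> E i j"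
    and least: "\<And>Y i j. (\<And>i j. i \<in> P \<Longrightarrow> j \<in> N \<Longrightarrow> 0 \<le> Y i j \<and> Ric Y i j \<le> 0) \<Longrightarrow>
           i \<in> P \<Longrightarrow> j \<in> N \<Longrightarrow> L i j \<le> Y i j"
    using least_solution_exists[of E] E by blast
  have "X i j - L i j = 0" if "i \<in> P" "j \<in> N" for i j
  proof (rule dominance[OF H cert])
    fix i j assume ij: "i \<in> P" "j \<in> N"
    show "\<bar>(L i j + X i j) / 2\<bar> \<le> E i j" using X[OF ij] L[OF ij] by (simp add: abs_le_iff)
    show "DRic (\<lambda>k l. (L k l + X k l) / 2) (\<lambda>k l. X k l - L k l) i j = 0"
      unfolding ric_diff[symmetric] using X[OF ij] L[OF ij] by simp
  qed (use that in auto)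
  then have eq: "X i j = L i j" if "i \<in> P" "j \<in> N" for i j using that by simp
  show "\<And>i j. i \<in> P \<Longrightarrow> j \<in> N \<Longrightarrow> 0 \<le> X i j" using eq L by simp
  show "\<And>Y i j. (\<And>i j. i \<in> P \<Longrightarrow> j \<in> N \<Longrightarrow> 0 \<le> Y i j \<and> Ric Y i j \<le> 0) \<Longrightarrow>
           i \<in> P \<Longrightarrow> j \<in> N \<Longrightarrow> X i j \<le> Y i j" using eq least by simp
qed

end

section \<open>Solutions bounded by excessive vectors\<close>

text \<open>
  \<open>h\<close> is a strictly excessive column vector and \<open>g\<close> a strictly excessive row vector for the
  generator \<open>A\<close>. Where \<open>s i j\<close> vanishes the bound with \<open>h\<close> gives no information about \<open>Y i j\<close>,
  and where \<open>f i j\<close> vanishes the one with \<open>g\<close> gives none; no entry is lost by both.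
\<close>

locale excessive_riccati = riccati_data P N e f s A
  for P N :: "'s::finite set" and e :: "'s \<Rightarrow> real" and f s A :: "'s \<Rightarrow> 's \<Rightarrow> real" +
  fixes h g :: "'s \<Rightarrow> real"
  assumes h: "\<And>i. i \<in> P \<union> N \<Longrightarrow> 0 < h i" and g: "\<And>i. i \<in> P \<union> N \<Longrightarrow> 0 < g i"
    and Ah: "\<And>i. i \<in> P \<union> N \<Longrightarrow> (\<Sum>j\<in>P. A i j * h j) + (\<Sum>j\<in>N. A i j * h j) < 0"
    and gA: "\<And>j. j \<in> P \<union> N \<Longrightarrow> (\<Sum>i\<in>P. g i * A i j) + (\<Sum>i\<in>N. g i * A i j) < 0"
    and e_pos: "\<And>i. i \<in> P \<Longrightarrow> 0 < e i"
    and s_le: "\<And>k j. k \<in> P \<Longrightarrow> j \<in> N \<Longrightarrow> s k j \<le> 1"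
    and s_or_f: "\<And>k j. k \<in> P \<Longrightarrow> j \<in> N \<Longrightarrow> 0 < s k j \<or> 0 < f k j"
begin

text \<open>
  Where \<open>s\<close> is one, \<open>row Y i\<close> is in the fluid model the mean of \<open>h\<close> at the phase of the first
  return from phase \<open>i\<close>. An excessive function cannot increase in mean, so the bound to be kept
  is \<open>row Y i \<le> h i\<close>.
\<close>

definition row where "row Y i = (\<Sum>j\<in>N. s i j * Y i j * h j)"
text \<open>
  The dual of \<open>row\<close>: for the equation read from the right, with \<open>K\<close> in place of \<open>U\<close>, the row
  vector \<open>g / e\<close> plays the role of \<open>h\<close>.
\<close>

definition col where "col Y l = (\<Sum>i\<in>P. g i / e i * (f i l * Y i l))"

lemma Lin_h: "(\<Sum>j\<in>N. Lin Y l j * h j) = (\<Sum>k\<in>P. A l k * row Y k)"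
  unfolding lin_def row_def sum_distrib_right sum_distrib_left
  by (subst sum.swap) (simp add: algebra_simps)

lemma U_h: "(\<Sum>j\<in>N. (A l j + Lin Y l j) * h j) = (\<Sum>j\<in>N. A l j * h j) + (\<Sum>k\<in>P. A l k * row Y k)"
  unfolding Lin_h[symmetric] by (simp add: algebra_simps sum.distrib)

text \<open>
  As long as \<open>row Y \<le> h\<close>, the vector \<open>h\<close> is strictly excessive for the matrix \<open>U\<close> belonging
  to \<open>Y\<close>, because replacing \<open>row Y\<close> by \<open>h\<close> turns the sum into the one for \<open>A\<close>.
\<close>

lemma U_h_neg:
  assumes "l \<in> N" "\<And>k. k \<in> P \<Longrightarrow> row Y k \<le> h k"
  shows "(\<Sum>j\<in>N. (A l j + Lin Y l j) * h j) < 0"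
proof -
  have "(\<Sum>k\<in>P. A l k * row Y k) \<le> (\<Sum>k\<in>P. A l k * h k)"
    using assms disj by (intro sum_mono mult_left_mono off) auto
  then show ?thesis unfolding U_h using Ah[of l] assms(1) by simp
qed

text \<open>
  One step of the iteration \<open>Y + Ric Y / dl\<close> keeps \<open>row Y \<le> h\<close>: the quadratic term is
  negative against \<open>h\<close> by \<open>U_h_neg\<close>, and the linear term is at most the gap \<open>h i - row Y i\<close>
  times the diagonal entry of \<open>A\<close>, which \<open>dl\<close> bounds.
\<close>

lemma row_step:
  assumes i: "i \<in> P" and Y: "\<And>l. l \<in> N \<Longrightarrow> 0 \<le> Y i l" and R: "\<And>j. j \<in> N \<Longrightarrow> 0 \<le> Ric Y i j"
    and row: "\<And>k. k \<in> P \<Longrightarrow> row Y k \<le> h k"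
  shows "(\<Sum>j\<in>N. s i j * Ric Y i j * h j) \<le> dl * (h i - row Y i)"
proof -
  have "(\<Sum>j\<in>N. s i j * Ric Y i j * h j) \<le> (\<Sum>j\<in>N. Ric Y i j * h j)"
  proof (rule sum_mono)
    fix j assume j: "j \<in> N"
    have "0 \<le> Ric Y i j * h j" using R[OF j] h[of j] j by simp
    then show "s i j * Ric Y i j * h j \<le> Ric Y i j * h j"
      using s_le[OF i j] by (simp add: mult_left_le_one_le s[OF i j] mult.assoc)
  qed
  also have "\<dots> = e i * (\<Sum>j\<in>N. (A i j + Lin Y i j) * h j)
      + (\<Sum>l\<in>N. f i l * Y i l * (\<Sum>j\<in>N. (A l j + Lin Y l j) * h j))"
  proof -
    have "(\<Sum>j\<in>N. (\<Sum>l\<in>N. f i l * Y i l * (A l j + Lin Y l j)) * h j)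
        = (\<Sum>l\<in>N. f i l * Y i l * (\<Sum>j\<in>N. (A l j + Lin Y l j) * h j))"
      unfolding sum_distrib_right sum_distrib_left by (subst sum.swap) (simp add: mult.assoc)
    then show ?thesis
      by (simp add: ric_def distrib_right[of _ _ "h _"] sum.distrib sum_distrib_left mult.assoc
          distrib_left[of "e i"])
  qed
  also have "\<dots> \<le> e i * (\<Sum>j\<in>N. (A i j + Lin Y i j) * h j)"
    using U_h_neg row f[OF i] Y by (simp add: sum_nonpos mult_nonneg_nonpos less_imp_le)
  also have "\<dots> \<le> e i * (- A i i * (h i - row Y i))"
  proof (rule mult_left_mono)
    have "(\<Sum>k\<in>P. A i k * row Y k) = A i i * row Y i + (\<Sum>k\<in>P - {i}. A i k * row Y k)"
      using i by (intro sum.remove) auto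
    also have "(\<Sum>k\<in>P - {i}. A i k * row Y k) \<le> (\<Sum>k\<in>P - {i}. A i k * h k)"
      using row i by (intro sum_mono mult_left_mono off) auto
    also have "(\<Sum>k\<in>P - {i}. A i k * h k) = (\<Sum>k\<in>P. A i k * h k) - A i i * h i"
      using sum.remove[of P i "\<lambda>k. A i k * h k"] i by simp
    finally show "(\<Sum>j\<in>N. (A i j + Lin Y i j) * h j) \<le> - A i i * (h i - row Y i)"
      unfolding U_h using Ah[of i] i by (simp add: algebra_simps)
  qed (use e_pos[OF i] in simp)
  also have "\<dots> = (- (e i * A i i)) * (h i - row Y i)" by simp
  also have "\<dots> \<le> dl * (h i - row Y i)"
    using dl_bounds(2)[of i] row[OF i] by (intro mult_right_mono) auto
  finally show ?thesis .
qed

lemma K_g: "(\<Sum>i\<in>P. g i / e i * (e i * A i k + (\<Sum>l\<in>N. f i l * Y i l * A l k)))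
   = (\<Sum>i\<in>P. g i * A i k) + (\<Sum>l\<in>N. col Y l * A l k)"
proof -
  have "(\<Sum>i\<in>P. g i / e i * (\<Sum>l\<in>N. f i l * Y i l * A l k)) = (\<Sum>l\<in>N. col Y l * A l k)"
    unfolding col_def sum_distrib_left sum_distrib_right
    by (subst sum.swap) (simp add: algebra_simps)
  moreover have "(\<Sum>i\<in>P. g i / e i * (e i * A i k)) = (\<Sum>i\<in>P. g i * A i k)"
    using e_pos by (intro sum.cong) (auto simp: less_imp_neq[symmetric])
  ultimately show ?thesis by (simp add: distrib_left sum.distrib)
qed

lemma g_K_neg:
  assumes "k \<in> P" "\<And>l. l \<in> N \<Longrightarrow> col Y l \<le> g l"
  shows "(\<Sum>i\<in>P. g i / e i * (e i * A i k + (\<Sum>l\<in>N. f i l * Y i l * A l k))) < 0"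
proof -
  have "(\<Sum>l\<in>N. col Y l * A l k) \<le> (\<Sum>l\<in>N. g l * A l k)"
    using assms disj by (intro sum_mono mult_right_mono off) auto
  then show ?thesis unfolding K_g using gA[of k] assms(1) by simp
qed

text \<open>
  The same with the factors in the opposite order. The weight \<open>f i j\<close> depends on the row, so it
  is first replaced by its maximum \<open>F\<close> over the rows; this is possible because \<open>Ric Y\<close> is
  nonnegative along the iteration.
\<close>

lemma col_step:
  assumes j: "j \<in> N" and Y: "\<And>k. k \<in> P \<Longrightarrow> 0 \<le> Y k j" and R: "\<And>i. i \<in> P \<Longrightarrow> 0 \<le> Ric Y i j"
    and col: "\<And>l. l \<in> N \<Longrightarrow> col Y l \<le> g l"
  shows "(\<Sum>i\<in>P. g i / e i * (f i j * Ric Y i j)) \<le> dl * (g j - col Y j)"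
proof -
  define Kf where "Kf i k = e i * A i k + (\<Sum>l\<in>N. f i l * Y i l * A l k)" for i k
  have Ric_K: "Ric Y i j = Kf i j + (\<Sum>k\<in>P. Kf i k * (s k j * Y k j))" for i
  proof -
    have "(\<Sum>l\<in>N. f i l * Y i l * Lin Y l j)
        = (\<Sum>k\<in>P. (\<Sum>l\<in>N. f i l * Y i l * A l k) * (s k j * Y k j))"
      unfolding lin_def sum_distrib_right sum_distrib_left by (subst sum.swap) (simp add: mult.assoc)
    moreover have "e i * Lin Y i j = (\<Sum>k\<in>P. e i * A i k * (s k j * Y k j))"
      unfolding lin_def sum_distrib_left by (simp add: mult.assoc)
    ultimately show ?thesis unfolding ric_def Kf_def
      by (simp add: distrib_left distrib_right[of _ _ "s _ _ * Y _ _"] sum.distrib)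
  qed
  have "(\<Sum>i\<in>P. g i / e i * Ric Y i j)
    = (\<Sum>i\<in>P. g i / e i * Kf i j) + (\<Sum>k\<in>P. (\<Sum>i\<in>P. g i / e i * Kf i k) * (s k j * Y k j))"
    unfolding Ric_K distrib_left sum.distrib sum_distrib_left sum_distrib_right
    by (subst (2) sum.swap) (simp add: algebra_simps)
  also have "\<dots> \<le> (\<Sum>i\<in>P. g i / e i * Kf i j)"
    using g_K_neg[OF _ col] s j Y unfolding Kf_def
    by (simp add: sum_nonpos mult_nonpos_nonneg less_imp_le)
  also have "\<dots> = (\<Sum>i\<in>P. g i * A i j) + (\<Sum>l\<in>N. col Y l * A l j)"
    unfolding Kf_def K_g ..
  also have "\<dots> \<le> (g j - col Y j) * (- A j j)"
  proof -
    have "(\<Sum>l\<in>N. col Y l * A l j) = col Y j * A j j + (\<Sum>l\<in>N - {j}. col Y l * A l j)"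
      using j by (intro sum.remove) auto
    also have "(\<Sum>l\<in>N - {j}. col Y l * A l j) \<le> (\<Sum>l\<in>N - {j}. g l * A l j)"
      using col j by (intro sum_mono mult_right_mono off) auto
    also have "(\<Sum>l\<in>N - {j}. g l * A l j) = (\<Sum>l\<in>N. g l * A l j) - g j * A j j"
      using sum.remove[of N j "\<lambda>l. g l * A l j"] j by simp
    finally show ?thesis using gA[of j] j by (simp add: algebra_simps)
  qed
  finally have S: "(\<Sum>i\<in>P. g i / e i * Ric Y i j) \<le> (g j - col Y j) * (- A j j)" .
  define F where "F = Max (insert 0 ((\<lambda>i. f i j) ` P))"
  have F: "0 \<le> F" "\<And>i. i \<in> P \<Longrightarrow> f i j \<le> F" unfolding F_def by auto
  have F_dl: "F * (- A j j) \<le> dl"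
  proof -
    have "F \<in> insert 0 ((\<lambda>i. f i j) ` P)" unfolding F_def by (rule Max_in) auto
    then show ?thesis using dl_bounds(3)[of _ j] dl_bounds(1) by (auto simp: abs_le_iff)
  qed
  have "(\<Sum>i\<in>P. g i / e i * (f i j * Ric Y i j)) \<le> (\<Sum>i\<in>P. F * (g i / e i * Ric Y i j))"
  proof (rule sum_mono)
    fix i assume i: "i \<in> P"
    have "0 \<le> g i / e i * Ric Y i j" using R[OF i] g[of i] e_pos[OF i] i by simp
    then have "f i j * (g i / e i * Ric Y i j) \<le> F * (g i / e i * Ric Y i j)"
      using F(2)[OF i] by (rule mult_right_mono[rotated])
    then show "g i / e i * (f i j * Ric Y i j) \<le> F * (g i / e i * Ric Y i j)"
      by (simp add: algebra_simps)
  qed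
  also have "\<dots> = F * (\<Sum>i\<in>P. g i / e i * Ric Y i j)" by (simp add: sum_distrib_left)
  also have "\<dots> \<le> F * ((g j - col Y j) * (- A j j))" by (rule mult_left_mono[OF S F(1)])
  also have "\<dots> = (F * (- A j j)) * (g j - col Y j)" by simp
  also have "\<dots> \<le> dl * (g j - col Y j)" using F_dl col[OF j] by (intro mult_right_mono) auto
  finally show ?thesis .
qed

text \<open>
  The iteration from zero increases and stays below both bounds, which together bound every
  entry.
\<close>

lemma bounded_solution_exists:
  obtains Y where "\<And>i j. i \<in> P \<Longrightarrow> j \<in> N \<Longrightarrow> 0 \<le> Y i j \<and> Ric Y i j = 0"
    and "\<And>i. i \<in> P \<Longrightarrow> row Y i \<le> h i" and "\<And>l. l \<in> N \<Longrightarrow> col Y l \<le> g l"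
proof -
  define \<Phi> where "\<Phi> Y i j = (dl * Y i j + Ric Y i j) / dl" for Y i j
  define y where "y n = (\<Phi> ^^ n) (\<lambda>_ _. 0)" for n
  have y_Suc: "y (Suc n) i j = y n i j + Ric (y n) i j / dl" for n i j
    using dl_bounds(1) by (simp add: y_def \<Phi>_def add_divide_distrib)
  have nn: "0 \<le> y n i j \<and> 0 \<le> Ric (y n) i j" if "i \<in> P" "j \<in> N" for n i j
    using that
  proof (induction n arbitrary: i j)
    case 0
    then show ?case using Ric_zero by (simp add: y_def)
  next
    case (Suc n)
    have le: "0 \<le> y n k l \<and> y n k l \<le> y (Suc n) k l" if "k \<in> P" "l \<in> N" for k l
      using Suc.IH[OF that] dl_bounds(1) by (simp add: y_Suc)
    have "dl * y (Suc n) i j = dl * y n i j + Ric (y n) i j"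
      using dl_bounds(1) by (simp add: y_Suc field_simps)
    also have "\<dots> \<le> dl * y (Suc n) i j + Ric (y (Suc n)) i j"
      by (rule Ric_mono) (use Suc.prems le in auto)
    finally show ?case using le[OF Suc.prems] by auto
  qed
  have row_y: "row (y n) i \<le> h i" if "i \<in> P" for n i
    using that
  proof (induction n arbitrary: i)
    case 0
    then show ?case using h[of i] by (simp add: y_def row_def)
  next
    case (Suc n)
    have "row (y (Suc n)) i = row (y n) i + (\<Sum>j\<in>N. s i j * Ric (y n) i j * h j) / dl"
      unfolding row_def y_Suc by (simp add: algebra_simps sum.distrib sum_divide_distrib)
    moreover have "(\<Sum>j\<in>N. s i j * Ric (y n) i j * h j) \<le> dl * (h i - row (y n) i)"
      by (rule row_step) (use Suc nn in auto)
    then have "(\<Sum>j\<in>N. s i j * Ric (y n) i j * h j) / dl \<le> h i - row (y n) i"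
      using dl_bounds(1) by (simp add: pos_divide_le_eq mult.commute)
    ultimately show ?case by simp
  qed
  have col_y: "col (y n) l \<le> g l" if "l \<in> N" for n l
    using that
  proof (induction n arbitrary: l)
    case 0
    then show ?case using g[of l] by (simp add: y_def col_def)
  next
    case (Suc n)
    have "col (y (Suc n)) l = col (y n) l + (\<Sum>i\<in>P. g i / e i * (f i l * Ric (y n) i l)) / dl"
      unfolding col_def y_Suc by (simp add: algebra_simps sum.distrib sum_divide_distrib)
    moreover have "(\<Sum>i\<in>P. g i / e i * (f i l * Ric (y n) i l)) \<le> dl * (g l - col (y n) l)"
      by (rule col_step) (use Suc nn in auto)
    then have "(\<Sum>i\<in>P. g i / e i * (f i l * Ric (y n) i l)) / dl \<le> g l - col (y n) l"
      using dl_bounds(1) by (simp add: pos_divide_le_eq mult.commute)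
    ultimately show ?case by simp
  qed
  have bdd: "\<exists>b. \<forall>n. y n i j \<le> b" if ij: "i \<in> P" "j \<in> N" for i j
  proof -
    consider "0 < s i j" | "0 < f i j" using s_or_f[OF ij] by auto
    then show ?thesis
    proof cases
      case 1
      have "y n i j \<le> h i / (s i j * h j)" for n
      proof -
        have "s i j * y n i j * h j \<le> row (y n) i"
          unfolding row_def
          by (rule member_le_sum) (use ij nn s h in \<open>auto intro!: mult_nonneg_nonneg simp: less_imp_le\<close>)
        then have "s i j * y n i j * h j \<le> h i" using row_y[OF ij(1), of n] by linarith
        then show ?thesis using 1 h[of j] ij by (simp add: field_simps)
      qed
      then show ?thesis by blast
    next
      case 2
      have pos: "0 < g i / e i * f i j" using 2 g[of i] e_pos[OF ij(1)] ij by simp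
      have "y n i j \<le> g j / (g i / e i * f i j)" for n
      proof -
        have "g i / e i * (f i j * y n i j) \<le> col (y n) j"
          unfolding col_def
          by (rule member_le_sum)
             (use ij nn f g e_pos in \<open>auto intro!: mult_nonneg_nonneg divide_nonneg_pos simp: less_imp_le\<close>)
        then have "g i / e i * (f i j * y n i j) \<le> g j" using col_y[OF ij(2), of n] by linarith
        then have "y n i j * (g i / e i * f i j) \<le> g j" by (simp add: algebra_simps)
        then show ?thesis by (simp only: pos_le_divide_eq[OF pos])
      qed
      then show ?thesis by blast
    qed
  qed
  have "\<exists>L. (\<lambda>n. y n i j) \<longlonglongrightarrow> L" if ij: "i \<in> P" "j \<in> N" for i j
  proof -
    have inc: "incseq (\<lambda>n. y n i j)"
      by (rule incseq_SucI) (use nn[OF ij] dl_bounds(1) in \<open>simp add: y_Suc\<close>)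
    obtain b where b: "\<And>n. y n i j \<le> b" using bdd[OF ij] by blast
    then show ?thesis using incseq_convergent[OF inc, of b] by blast
  qed
  then obtain L where lim: "\<And>i j. i \<in> P \<Longrightarrow> j \<in> N \<Longrightarrow> (\<lambda>n. y n i j) \<longlonglongrightarrow> L i j"
    by metis
  have Ric_lim: "(\<lambda>n. Ric (y n) i j) \<longlonglongrightarrow> Ric L i j" if "i \<in> P" "j \<in> N" for i j
    unfolding ric_def lin_def by (intro tendsto_intros lim that)
  have "Ric L i j = 0" if ij: "i \<in> P" "j \<in> N" for i j
  proof -
    have "(\<lambda>n. dl * (y (Suc n) i j - y n i j)) \<longlonglongrightarrow> dl * (L i j - L i j)"
      by (intro tendsto_intros lim that LIMSEQ_Suc[of "\<lambda>n. y n i j"])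
    moreover have "(\<lambda>n. dl * (y (Suc n) i j - y n i j)) = (\<lambda>n. Ric (y n) i j)"
      using dl_bounds(1) by (auto simp: y_Suc)
    ultimately show ?thesis using Ric_lim[OF ij] LIMSEQ_unique by fastforce
  qed
  moreover have "0 \<le> L i j" if "i \<in> P" "j \<in> N" for i j
    using LIMSEQ_le_const[OF lim[OF that]] nn[OF that] by blast
  moreover have "row L i \<le> h i" if "i \<in> P" for i
  proof -
    have "(\<lambda>n. row (y n) i) \<longlonglongrightarrow> row L i" unfolding row_def by (intro tendsto_intros lim that)
    then show ?thesis using LIMSEQ_le_const2 row_y[OF that] by blast
  qed
  moreover have "col L l \<le> g l" if "l \<in> N" for l
  proof -
    have "(\<lambda>n. col (y n) l) \<longlonglongrightarrow> col L l" unfolding col_def by (intro tendsto_intros lim that)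
    then show ?thesis using LIMSEQ_le_const2 col_y[OF that] by blast
  qed
  ultimately show ?thesis using that[of L] by blast
qed

text \<open>
  In the limit the two bounds make \<open>g / e\<close> strictly excessive for \<open>K\<close> from the left and \<open>h\<close> for
  \<open>U\<close> from the right. The linearisation multiplies \<open>K\<close> from the left and \<open>U\<close> from the right, so
  the certificates are needed on the other sides, which Metzler duality supplies.
\<close>

lemma stable_vectors:
  assumes Y: "\<And>i j. i \<in> P \<Longrightarrow> j \<in> N \<Longrightarrow> 0 \<le> Y i j"
    and row: "\<And>i. i \<in> P \<Longrightarrow> row Y i \<le> h i" and col: "\<And>l. l \<in> N \<Longrightarrow> col Y l \<le> g l"
  obtains a b where "\<And>i. i \<in> P \<Longrightarrow> 0 < a i"
    and "\<And>i. i \<in> P \<Longrightarrow> (\<Sum>k\<in>P. (e i * A i k + (\<Sum>l\<in>N. f i l * Y i l * A l k)) * a k) < 0"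
    and "\<And>l. l \<in> N \<Longrightarrow> 0 < b l"
    and "\<And>j. j \<in> N \<Longrightarrow> (\<Sum>l\<in>N. b l * (A l j + Lin Y l j)) < 0"
proof -
  have offs: "0 \<le> A l k" "0 \<le> A k l" if "l \<in> N" "k \<in> P" for l k
    using that disj off by (metis IntI Un_iff empty_iff)+
  have Kpos: "0 \<le> e i * A i k + (\<Sum>l\<in>N. f i l * Y i l * A l k)" if "i \<in> P" "k \<in> P" "i \<noteq> k" for i k
    using that e f Y off offs by (intro add_nonneg_nonneg sum_nonneg mult_nonneg_nonneg) auto
  have Upos: "0 \<le> A l j + Lin Y l j" if "l \<in> N" "j \<in> N" "l \<noteq> j" for l j
    using that s Y off offs unfolding lin_def
    by (intro add_nonneg_nonneg sum_nonneg mult_nonneg_nonneg) auto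
  obtain a where "\<And>i. i \<in> P \<Longrightarrow> 0 < a i"
    "\<And>i. i \<in> P \<Longrightarrow> (\<Sum>k\<in>P. (e i * A i k + (\<Sum>l\<in>N. f i l * Y i l * A l k)) * a k) < 0"
    by (rule metzler_right_vector[of P "\<lambda>i k. e i * A i k + (\<Sum>l\<in>N. f i l * Y i l * A l k)" "\<lambda>i. g i / e i"])
       (use Kpos g e_pos g_K_neg col in auto)
  moreover obtain b where "\<And>l. l \<in> N \<Longrightarrow> 0 < b l"
    "\<And>j. j \<in> N \<Longrightarrow> (\<Sum>l\<in>N. b l * (A l j + Lin Y l j)) < 0"
    by (rule metzler_left_vector[of N "\<lambda>l j. A l j + Lin Y l j" h])
       (use Upos h U_h_neg row in auto)
  ultimately show ?thesis using that by blast
qed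

end

section \<open>Strictly negative directions of the linearisation\<close>

text \<open>
  In matrix form the derivative is \<open>K (s D) + (f D) U\<close>, a weighted Sylvester operator.
\<close>

lemma dric_K_U:
  "dric P N e f s A Y D i j
     = (\<Sum>k\<in>P. (e i * A i k + (\<Sum>l\<in>N. f i l * Y i l * A l k)) * (s k j * D k j))
       + (\<Sum>l\<in>N. f i l * D i l * (A l j + lin P s A Y l j))"
proof -
  have "(\<Sum>l\<in>N. f i l * Y i l * lin P s A D l j)
      = (\<Sum>k\<in>P. (\<Sum>l\<in>N. f i l * Y i l * A l k) * (s k j * D k j))"
    unfolding lin_def sum_distrib_right sum_distrib_left by (subst sum.swap) (simp add: mult.assoc)
  moreover have "e i * lin P s A D i j = (\<Sum>k\<in>P. e i * A i k * (s k j * D k j))"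
    unfolding lin_def sum_distrib_left by (simp add: mult.assoc)
  ultimately show ?thesis unfolding dric_def
    by (simp add: distrib_right[of _ _ "s _ _ * D _ _"] sum.distrib)
qed

lemma small_perturbation_negative:
  fixes x y :: real
  assumes "y < 0"
  shows "\<forall>\<^sub>F c in at_right 0. c * x + y < 0"
proof -
  have "((\<lambda>c. c * x + y) \<longlongrightarrow> 0 * x + y) (at_right 0)" by (intro tendsto_intros)
  then show ?thesis using assms by (intro order_tendstoD(2)[where y = "0 * x + y"]) auto
qed

text \<open>
  With \<open>a\<close> and \<open>b\<close> the vectors that make \<open>K a\<close> and \<open>b U\<close> negative, the rank one matrix \<open>a i * b
  j / v j\<close> would do if all weights were positive. In the rows \<open>P0\<close> the product \<open>f D\<close> sees only
  the columns \<open>N0\<close>, and in the columns \<open>N0\<close> the product \<open>s D\<close> sees only the rows \<open>P0\<close>. A small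
  factor \<open>c\<close> on the block \<open>(P0, N0)\<close> therefore multiplies precisely the contributions that are
  not full sums: on the two mixed blocks they may be positive and are made small, and on \<open>(P0,
  N0)\<close> both contributions carry \<open>c\<close> and are negative, since dropping nonnegative off-diagonal
  terms keeps \<open>K a\<close> and \<open>b U\<close> negative.
\<close>

lemma singular_certificate:
  fixes A Y s :: "'s::finite \<Rightarrow> 's \<Rightarrow> real"
  assumes P: "P = P1 \<union> P0" "P1 \<inter> P0 = {}" and N: "N = N0 \<union> N1" "N0 \<inter> N1 = {}"
    and s: "\<And>k j. k \<in> P \<Longrightarrow> j \<in> N \<Longrightarrow> s k j = (if k \<in> P1 \<and> j \<in> N0 then 0 else 1)"
    and f: "\<And>i l. i \<in> P \<Longrightarrow> l \<in> N \<Longrightarrow> f i l = (if i \<in> P0 \<and> l \<in> N1 then 0 else v l)"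
    and v: "\<And>l. l \<in> N \<Longrightarrow> 0 < v l"
    and K_off: "\<And>i k. i \<in> P \<Longrightarrow> k \<in> P \<Longrightarrow> i \<noteq> k \<Longrightarrow> 0 \<le> e i * A i k + (\<Sum>l\<in>N. f i l * Y i l * A l k)"
    and U_off: "\<And>l j. l \<in> N \<Longrightarrow> j \<in> N \<Longrightarrow> l \<noteq> j \<Longrightarrow> 0 \<le> A l j + lin P s A Y l j"
    and a: "\<And>i. i \<in> P \<Longrightarrow> 0 < a i"
    and Ka: "\<And>i. i \<in> P \<Longrightarrow> (\<Sum>k\<in>P. (e i * A i k + (\<Sum>l\<in>N. f i l * Y i l * A l k)) * a k) < 0"
    and b: "\<And>l. l \<in> N \<Longrightarrow> 0 < b l"
    and bU: "\<And>j. j \<in> N \<Longrightarrow> (\<Sum>l\<in>N. b l * (A l j + lin P s A Y l j)) < 0"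
  obtains H where "\<And>i j. i \<in> P \<Longrightarrow> j \<in> N \<Longrightarrow> (0::real) < H i j"
    and "\<And>i j. i \<in> P \<Longrightarrow> j \<in> N \<Longrightarrow> dric P N e f s A Y H i j < 0"
proof -
  define K where "K i k = e i * A i k + (\<Sum>l\<in>N. f i l * Y i l * A l k)" for i k
  define U where "U l j = A l j + lin P s A Y l j" for l j
  (* The division by v compensates that U carries no rates here. *)
  define H where "H c i j = (if i \<in> P0 \<and> j \<in> N0 then c else 1) * a i * b j / v j" for c :: real and i j
  have sumP: "(\<Sum>k\<in>P. q k) = (\<Sum>k\<in>P1. q k) + (\<Sum>k\<in>P0. q k)" for q :: "'s \<Rightarrow> real"
    unfolding P(1) by (intro sum.union_disjoint P(2)) auto
  have sumN: "(\<Sum>l\<in>N. q l) = (\<Sum>l\<in>N0. q l) + (\<Sum>l\<in>N1. q l)" for q :: "'s \<Rightarrow> real"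
    unfolding N(1) by (intro sum.union_disjoint N(2)) auto
  have K0: "(\<Sum>k\<in>P0. K i k * a k) < 0" if "i \<in> P0" for i
  proof -
    have "0 \<le> (\<Sum>k\<in>P1. K i k * a k)"
      using that P K_off a unfolding K_def by (intro sum_nonneg mult_nonneg_nonneg) (auto simp: less_imp_le)
    then show ?thesis using Ka[of i] that P sumP[of "\<lambda>k. K i k * a k"] by (simp add: K_def)
  qed
  have U0: "(\<Sum>l\<in>N0. b l * U l j) < 0" if "j \<in> N0" for j
  proof -
    have "0 \<le> (\<Sum>l\<in>N1. b l * U l j)"
      using that N U_off b unfolding U_def by (intro sum_nonneg mult_nonneg_nonneg) (auto simp: less_imp_le)
    then show ?thesis using bU[of j] that N sumN[of "\<lambda>l. b l * U l j"] by (simp add: U_def)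
  qed
  have D: "dric P N e f s A Y (H c) i j
      = (\<Sum>k\<in>P. K i k * (s k j * H c k j)) + (\<Sum>l\<in>N. f i l * H c i l * U l j)" for c i j
    unfolding dric_K_U K_def U_def ..
  have part1: "(\<Sum>k\<in>P. K i k * (s k j * H c k j)) =
     (if j \<in> N0 then c * (\<Sum>k\<in>P0. K i k * a k) else (\<Sum>k\<in>P. K i k * a k)) * (b j / v j)"
    if "j \<in> N" for i j c
  proof (cases "j \<in> N0")
    case True
    have 1: "(\<Sum>k\<in>P1. K i k * (s k j * H c k j)) = 0"
      using True P s that by (intro sum.neutral) auto
    have 2: "(\<Sum>k\<in>P0. K i k * (s k j * H c k j)) = (\<Sum>k\<in>P0. c * (K i k * a k) * (b j / v j))"
      using True P s that by (intro sum.cong) (auto simp: H_def)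
    show ?thesis unfolding sumP 1 2 using True
      by (simp add: sum_distrib_left sum_distrib_right sum_divide_distrib)
  next
    case False
    have "(\<Sum>k\<in>P. K i k * (s k j * H c k j)) = (\<Sum>k\<in>P. (K i k * a k) * (b j / v j))"
      using False s that by (intro sum.cong) (auto simp: H_def)
    then show ?thesis using False by (simp add: sum_distrib_right sum_divide_distrib)
  qed
  have part2: "(\<Sum>l\<in>N. f i l * H c i l * U l j) =
     (if i \<in> P0 then c * (\<Sum>l\<in>N0. b l * U l j) else (\<Sum>l\<in>N. b l * U l j)) * a i"
    if "i \<in> P" for i j c
  proof (cases "i \<in> P0")
    case True
    have 1: "(\<Sum>l\<in>N1. f i l * H c i l * U l j) = 0"
      using True N f that by (intro sum.neutral) auto
    have 2: "(\<Sum>l\<in>N0. f i l * H c i l * U l j) = (\<Sum>l\<in>N0. c * (b l * U l j) * a i)"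
    proof (rule sum.cong)
      fix l assume "l \<in> N0"
      then have "f i l = v l" "v l \<noteq> 0" using True N f[OF that] v[of l] by auto
      then show "f i l * H c i l * U l j = c * (b l * U l j) * a i"
        using True \<open>l \<in> N0\<close> by (simp add: H_def)
    qed simp
    show ?thesis unfolding sumN 1 2 using True by (simp add: sum_distrib_left sum_distrib_right)
  next
    case False
    have "(\<Sum>l\<in>N. f i l * H c i l * U l j) = (\<Sum>l\<in>N. (b l * U l j) * a i)"
    proof (rule sum.cong)
      fix l assume "l \<in> N"
      then have "f i l = v l" "v l \<noteq> 0" using False f[OF that] v[of l] by auto
      then show "f i l * H c i l * U l j = (b l * U l j) * a i"
        using False by (simp add: H_def)
    qed simp
    then show ?thesis using False by (simp add: sum_distrib_right)
  qed
  have ev: "\<forall>\<^sub>F c in at_right 0. dric P N e f s A Y (H c) i j < 0" if ij: "i \<in> P" "j \<in> N" for i j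
  proof -
    have q: "0 < b j / v j" "0 < a i" using a b v ij by auto
    have neg: "(\<Sum>k\<in>P. K i k * a k) * (b j / v j) < 0" "(\<Sum>l\<in>N. b l * U l j) * a i < 0"
      unfolding K_def U_def
      by (rule mult_neg_pos[OF Ka[OF ij(1)] q(1)], rule mult_neg_pos[OF bU[OF ij(2)] q(2)])
    consider "i \<in> P0" "j \<in> N0" | "i \<in> P0" "j \<notin> N0" | "i \<notin> P0" "j \<in> N0" | "i \<notin> P0" "j \<notin> N0" by blast
    then show ?thesis
    proof cases
      case 1
      have "(\<Sum>k\<in>P0. K i k * a k) * (b j / v j) + (\<Sum>l\<in>N0. b l * U l j) * a i < 0"
        using K0[OF 1(1)] U0[OF 1(2)] q by (intro add_neg_neg mult_neg_pos) auto
      then have "c * ((\<Sum>k\<in>P0. K i k * a k) * (b j / v j) + (\<Sum>l\<in>N0. b l * U l j) * a i) < 0"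
        if "0 < c" for c using that by (intro mult_pos_neg)
      then show ?thesis
        unfolding D part1[OF ij(2)] part2[OF ij(1)] using 1
        by (auto simp: eventually_at_right_less algebra_simps intro!: eventually_mono[OF eventually_at_right_less])
    next
      case 2
      then show ?thesis
        unfolding D part1[OF ij(2)] part2[OF ij(1)]
        using small_perturbation_negative[OF neg(1), of "(\<Sum>l\<in>N0. b l * U l j) * a i"]
        by (simp add: algebra_simps)
    next
      case 3
      then show ?thesis
        unfolding D part1[OF ij(2)] part2[OF ij(1)]
        using small_perturbation_negative[OF neg(2), of "(\<Sum>k\<in>P0. K i k * a k) * (b j / v j)"]
        by (simp add: algebra_simps)
    next
      case 4
      then show ?thesis unfolding D part1[OF ij(2)] part2[OF ij(1)] using neg by simp
    qed
  qed
  have "\<forall>\<^sub>F c in at_right 0. \<forall>p\<in>P \<times> N. dric P N e f s A Y (H c) (fst p) (snd p) < 0"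
    by (rule eventually_ball_finite) (use ev in auto)
  then have "\<forall>\<^sub>F c in at_right 0. 0 < c \<and> (\<forall>p\<in>P \<times> N. dric P N e f s A Y (H c) (fst p) (snd p) < 0)"
    by (rule eventually_conj[OF eventually_at_right_less])
  then obtain c where "0 < c" "\<forall>p\<in>P \<times> N. dric P N e f s A Y (H c) (fst p) (snd p) < 0"
    using eventually_happens'[OF trivial_limit_at_right_real] by blast
  then show ?thesis using that[of "H c"] a b v by (auto simp: H_def)
qed

section \<open>Convergent power series solutions\<close>

text \<open>
  Some weighted absolute sum of this kind is finite exactly when the radius of convergence is
  positive. The sums are submultiplicative, which reduces convergence to bounds on partial sums.
\<close>

definition bd :: "real \<Rightarrow> real fps \<Rightarrow> real \<Rightarrow> bool" where
  "bd t f b \<longleftrightarrow> (\<forall>m. (\<Sum>n\<le>m. \<bar>fps_nth f n\<bar> * t ^ n) \<le> b)"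

definition agree :: "nat \<Rightarrow> real fps \<Rightarrow> real fps \<Rightarrow> bool" where
  "agree n f g \<longleftrightarrow> (\<forall>i<n. fps_nth f i = fps_nth g i)"

lemma bd_add: "bd t f b \<Longrightarrow> bd t g c \<Longrightarrow> 0 \<le> t \<Longrightarrow> bd t (f + g) (b + c)"
  unfolding bd_def
proof
  fix m assume a: "\<forall>m. (\<Sum>n\<le>m. \<bar>fps_nth f n\<bar> * t ^ n) \<le> b" "\<forall>m. (\<Sum>n\<le>m. \<bar>fps_nth g n\<bar> * t ^ n) \<le> c" "0 \<le> t"
  have "(\<Sum>n\<le>m. \<bar>fps_nth (f + g) n\<bar> * t ^ n)
      \<le> (\<Sum>n\<le>m. \<bar>fps_nth f n\<bar> * t ^ n + \<bar>fps_nth g n\<bar> * t ^ n)"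
    unfolding distrib_right[symmetric] using a(3) by (intro sum_mono mult_right_mono) auto
  also have "\<dots> \<le> b + c" unfolding sum.distrib using a by (intro add_mono) auto
  finally show "(\<Sum>n\<le>m. \<bar>fps_nth (f + g) n\<bar> * t ^ n) \<le> b + c" .
qed

lemma bd_nonneg: "bd t f b \<Longrightarrow> 0 \<le> b"
  unfolding bd_def by (drule spec[of _ 0]) auto

lemma bd_mult:
  assumes "bd t f b" "bd t g c" "0 \<le> t"
  shows "bd t (f * g) (b * c)"
  unfolding bd_def
proof
  fix m
  let ?F = "\<lambda>n. \<bar>fps_nth f n\<bar> * t ^ n" and ?G = "\<lambda>n. \<bar>fps_nth g n\<bar> * t ^ n"
  have "(\<Sum>n\<le>m. \<bar>fps_nth (f * g) n\<bar> * t ^ n) \<le> (\<Sum>n\<le>m. \<Sum>i\<le>n. ?F i * ?G (n - i))"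
  proof (rule sum_mono)
    fix n
    have "\<bar>fps_nth (f * g) n\<bar> * t ^ n \<le> (\<Sum>i\<le>n. \<bar>fps_nth f i * fps_nth g (n - i)\<bar>) * t ^ n"
      unfolding fps_mult_nth atLeast0AtMost using assms by (intro mult_right_mono sum_abs) auto
    also have "\<dots> = (\<Sum>i\<le>n. ?F i * ?G (n - i))"
      unfolding sum_distrib_right
    proof (rule sum.cong)
      fix i assume "i \<in> {..n}"
      then have "t ^ n = t ^ i * t ^ (n - i)" by (simp flip: power_add)
      then show "\<bar>fps_nth f i * fps_nth g (n - i)\<bar> * t ^ n = ?F i * ?G (n - i)"
        by (simp add: abs_mult)
    qed simp
    finally show "\<bar>fps_nth (f * g) n\<bar> * t ^ n \<le> (\<Sum>i\<le>n. ?F i * ?G (n - i))" .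
  qed
  also have "\<dots> = (\<Sum>(i, j)\<in>{(i, j). i + j \<le> m}. ?F i * ?G j)"
    using sum.triangle_reindex_eq[of "\<lambda>i j. ?F i * ?G j" m] by simp
  also have "\<dots> \<le> (\<Sum>(i, j)\<in>{..m} \<times> {..m}. ?F i * ?G j)"
    using assms(3) by (intro sum_mono2) auto
  also have "\<dots> = (\<Sum>i\<le>m. ?F i) * (\<Sum>j\<le>m. ?G j)"
    by (simp add: sum_product sum.cartesian_product)
  also have "\<dots> \<le> b * c"
    using assms bd_nonneg unfolding bd_def by (intro mult_mono sum_nonneg) auto
  finally show "(\<Sum>n\<le>m. \<bar>fps_nth (f * g) n\<bar> * t ^ n) \<le> b * c" .
qed

lemma bd_mono: "bd t f b \<Longrightarrow> 0 \<le> t' \<Longrightarrow> t' \<le> t \<Longrightarrow> b \<le> b' \<Longrightarrow> bd t' f b'"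
  unfolding bd_def
proof
  fix m assume a: "\<forall>m. (\<Sum>n\<le>m. \<bar>fps_nth f n\<bar> * t ^ n) \<le> b" "0 \<le> t'" "t' \<le> t" "b \<le> b'"
  have "(\<Sum>n\<le>m. \<bar>fps_nth f n\<bar> * t' ^ n) \<le> (\<Sum>n\<le>m. \<bar>fps_nth f n\<bar> * t ^ n)"
    using a by (intro sum_mono mult_left_mono power_mono) auto
  then show "(\<Sum>n\<le>m. \<bar>fps_nth f n\<bar> * t' ^ n) \<le> b'" using a by (meson order_trans)
qed

lemma bd_X_mult: "bd t f b \<Longrightarrow> 0 \<le> t \<Longrightarrow> bd t (fps_X * f) (t * b)"
  by (rule bd_mult) (auto simp: bd_def fps_X_nth if_distrib[of abs] if_distrib[of "\<lambda>x. x * _"] sum.delta cong: if_cong)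

lemma bd_zero: "0 \<le> b \<Longrightarrow> bd t 0 b"
  by (simp add: bd_def)

lemma bd_iff_conv_radius:
  "(\<exists>t>0. \<exists>b. bd t f b) \<longleftrightarrow> 0 < fps_conv_radius f"
proof
  assume "\<exists>t>0. \<exists>b. bd t f b"
  then obtain t b where t: "0 < t" and b: "bd t f b" by blast
  have "summable (\<lambda>n. \<bar>fps_nth f n\<bar> * t ^ n)"
    by (rule bounded_imp_summable[of _ b]) (use t b in \<open>auto simp: bd_def\<close>)
  then have "summable (\<lambda>n. norm (fps_nth f n * t ^ n))" using t by (simp add: abs_mult)
  then have "summable (\<lambda>n. fps_nth f n * t ^ n)" by (rule summable_norm_cancel)
  then have "ereal (norm t) \<le> conv_radius (fps_nth f)" by (rule conv_radius_geI)
  then show "0 < fps_conv_radius f" unfolding fps_conv_radius_def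
    using t by (auto simp: ereal_less intro: less_le_trans[of _ "ereal t"])
next
  assume "0 < fps_conv_radius f"
  then obtain t where t: "0 < ereal t" "ereal t < conv_radius (fps_nth f)"
    unfolding fps_conv_radius_def using ereal_dense2 by blast
  have "summable (\<lambda>n. norm (fps_nth f n * t ^ n))"
    by (rule abs_summable_in_conv_radius) (use t in auto)
  then have s: "summable (\<lambda>n. \<bar>fps_nth f n\<bar> * t ^ n)" using t by (simp add: abs_mult)
  have "bd t f (\<Sum>n. \<bar>fps_nth f n\<bar> * t ^ n)"
    unfolding bd_def by (intro allI sum_le_suminf s) (use t in auto)
  then show "\<exists>t>0. \<exists>b. bd t f b" using t by auto
qed

lemma agree_add: "agree n f g \<Longrightarrow> agree n f' g' \<Longrightarrow> agree n (f + f') (g + g')"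
  by (simp add: agree_def)

lemma agree_mult: "agree n f g \<Longrightarrow> agree n f' g' \<Longrightarrow> agree n (f * f') (g * g')"
  unfolding agree_def fps_mult_nth by (auto intro!: sum.cong)

text \<open>
  Two properties of a polynomial expression in finitely many series: its coefficients below \<open>n\<close>
  depend only on the coefficients of its arguments below \<open>n\<close>, and it is bounded on bounded sets
  with a bound that does not depend on \<open>t\<close>.
\<close>

definition tame :: "real \<Rightarrow> (('k \<Rightarrow> real fps) \<Rightarrow> real fps) \<Rightarrow> bool" where
  "tame T F \<longleftrightarrow>
     (\<forall>n D D'. (\<forall>p. agree n (D p) (D' p)) \<longrightarrow> agree n (F D) (F D')) \<and>
     (\<forall>b. \<exists>c. \<forall>t D. 0 < t \<longrightarrow> t \<le> T \<longrightarrow> (\<forall>p. bd t (D p) b) \<longrightarrow> bd t (F D) c)"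

lemma tame_proj: "tame T (\<lambda>D. D p)"
  by (auto simp: tame_def)

lemma tame_const: "bd T f b \<Longrightarrow> tame T (\<lambda>_. f)"
  unfolding tame_def by (auto simp: agree_def intro!: exI[of _ b] elim: bd_mono)

lemma tame_add:
  assumes F: "tame T F" and G: "tame T G"
  shows "tame T (\<lambda>D. F D + G D)"
  unfolding tame_def
proof (intro conjI allI impI)
  fix n and D D' :: "'a \<Rightarrow> real fps" assume "\<forall>p. agree n (D p) (D' p)"
  then show "agree n (F D + G D) (F D' + G D')"
    using F G by (intro agree_add) (auto simp: tame_def)
next
  fix b
  obtain c c' where "\<forall>t D. 0 < t \<longrightarrow> t \<le> T \<longrightarrow> (\<forall>p. bd t (D p) b) \<longrightarrow> bd t (F D) c"
    "\<forall>t D. 0 < t \<longrightarrow> t \<le> T \<longrightarrow> (\<forall>p. bd t (D p) b) \<longrightarrow> bd t (G D) c'"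
    using F G unfolding tame_def by blast
  then show "\<exists>c. \<forall>t D. 0 < t \<longrightarrow> t \<le> T \<longrightarrow> (\<forall>p. bd t (D p) b) \<longrightarrow> bd t (F D + G D) c"
    by (intro exI[of _ "c + c'"]) (auto intro: bd_add)
qed

lemma tame_mult:
  assumes F: "tame T F" and G: "tame T G"
  shows "tame T (\<lambda>D. F D * G D)"
  unfolding tame_def
proof (intro conjI allI impI)
  fix n and D D' :: "'a \<Rightarrow> real fps" assume "\<forall>p. agree n (D p) (D' p)"
  then show "agree n (F D * G D) (F D' * G D')"
    using F G by (intro agree_mult) (auto simp: tame_def)
next
  fix b
  obtain c c' where "\<forall>t D. 0 < t \<longrightarrow> t \<le> T \<longrightarrow> (\<forall>p. bd t (D p) b) \<longrightarrow> bd t (F D) c"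
    "\<forall>t D. 0 < t \<longrightarrow> t \<le> T \<longrightarrow> (\<forall>p. bd t (D p) b) \<longrightarrow> bd t (G D) c'"
    using F G unfolding tame_def by blast
  then show "\<exists>c. \<forall>t D. 0 < t \<longrightarrow> t \<le> T \<longrightarrow> (\<forall>p. bd t (D p) b) \<longrightarrow> bd t (F D * G D) c"
    by (intro exI[of _ "c * c'"]) (auto intro: bd_mult)
qed

lemma tame_sum: "(\<And>q. q \<in> S \<Longrightarrow> tame T (F q)) \<Longrightarrow> tame T (\<lambda>D. \<Sum>q\<in>S. F q D)"
proof (induction S rule: infinite_finite_induct)
  case (insert x S)
  then show ?case using tame_add[of T "F x" "\<lambda>D. \<Sum>q\<in>S. F q D"] by simp
qed (use tame_const[OF bd_zero[of 0]] in auto)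

text \<open>
  Since \<open>\<Psi>\<close> is multiplied by \<open>fps_X\<close>, the iteration fixes one more coefficient in every
  step, which defines the solution. For convergence, the factor \<open>fps_X\<close> contributes a factor \<open>t\<close>
  to the bound, so for small \<open>t\<close> the iteration stays in the ball of radius \<open>s + 1\<close>, where \<open>s\<close>
  bounds the series \<open>a\<close>.
\<close>

lemma fps_fixed_point:
  fixes a :: "'k::finite \<Rightarrow> real fps" and \<Psi> :: "('k \<Rightarrow> real fps) \<Rightarrow> 'k \<Rightarrow> real fps"
  assumes T: "0 < T" and a: "\<And>p. \<exists>b. bd T (a p) b" and \<Psi>: "\<And>p. tame T (\<lambda>D. \<Psi> D p)"
  obtains D where "\<And>p. D p = a p + fps_X * \<Psi> D p" and "\<And>p. 0 < fps_conv_radius (D p)"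
proof -
  define \<Phi> where "\<Phi> D p = a p + fps_X * \<Psi> D p" for D p
  define d where "d n = (\<Phi> ^^ n) (\<lambda>_. 0)" for n
  have d_Suc: "d (Suc n) p = \<Phi> (d n) p" for n p by (simp add: d_def)
  have ag: "agree (Suc n) (\<Phi> D p) (\<Phi> D' p)" if "\<And>p. agree n (D p) (D' p)" for n D D' p
  proof -
    have "agree n (\<Psi> D p) (\<Psi> D' p)" using \<Psi>[of p] that unfolding tame_def by blast
    then show ?thesis by (auto simp: agree_def \<Phi>_def)
  qed
  have ag1: "agree n (d n p) (d (Suc n) p)" for n p
  proof (induction n arbitrary: p)
    case (Suc n)
    then show ?case using ag[of n "d n" "d (Suc n)" p] by (simp add: d_Suc)
  qed (simp add: agree_def)
  have ag2: "agree n (d n p) (d (n + k) p)" for n k p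
  proof (induction k)
    case (Suc k)
    then show ?case using ag1[of "n + k" p] by (auto simp: agree_def)
  qed (simp add: agree_def)
  define D where "D p = Abs_fps (\<lambda>n. fps_nth (d (Suc n) p) n)" for p
  have D_d: "agree n (D p) (d n p)" for n p
    unfolding agree_def
  proof (intro allI impI)
    fix i assume "i < n"
    then show "fps_nth (D p) i = fps_nth (d n p) i"
      using ag2[of "Suc i" p "n - Suc i"] by (simp add: D_def agree_def)
  qed
  have fixed: "D p = a p + fps_X * \<Psi> D p" for p
  proof (rule fps_ext)
    fix n
    have "fps_nth (D p) n = fps_nth (d (Suc n) p) n" using D_d[of "Suc n" p] by (simp add: agree_def)
    also have "\<dots> = fps_nth (\<Phi> D p) n"
      using ag[of n D "d n" p] D_d by (simp add: d_Suc agree_def)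
    finally show "fps_nth (D p) n = fps_nth (a p + fps_X * \<Psi> D p) n" by (simp add: \<Phi>_def)
  qed
  obtain \<alpha> where \<alpha>: "\<And>p. bd T (a p) (\<alpha> p)" using a by metis
  define s where "s = (\<Sum>p\<in>UNIV. \<alpha> p)"
  have s: "bd t (a p) s" if "0 < t" "t \<le> T" for t p
  proof -
    have "\<alpha> p \<le> s" unfolding s_def by (rule member_le_sum) (use \<alpha> bd_nonneg in auto)
    then show ?thesis using bd_mono[OF \<alpha>] that by simp
  qed
  have "\<forall>p. \<exists>c. \<forall>t D. 0 < t \<longrightarrow> t \<le> T \<longrightarrow> (\<forall>p. bd t (D p) (s + 1)) \<longrightarrow> bd t (\<Psi> D p) c"
    using \<Psi> unfolding tame_def by blast
  then obtain c where c: "\<And>p t D. 0 < t \<Longrightarrow> t \<le> T \<Longrightarrow> (\<forall>p. bd t (D p) (s + 1)) \<Longrightarrow> bd t (\<Psi> D p) (c p)"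
    by metis
  define \<beta> where "\<beta> = 1 + (\<Sum>p\<in>UNIV. \<bar>c p\<bar>)"
  have \<beta>: "c p \<le> \<beta>" "1 \<le> \<beta>" for p
    using member_le_sum[of p UNIV "\<lambda>p. \<bar>c p\<bar>"] sum_nonneg[of UNIV "\<lambda>p. \<bar>c p\<bar>"] unfolding \<beta>_def by auto
  (* With this t the term with fps_X contributes at most 1 to the bound. *)
  define t where "t = min T (1 / \<beta>)"
  have t: "0 < t" "t \<le> T" "t * \<beta> \<le> 1" using T \<beta>(2) by (auto simp: t_def min_def field_simps)
  have bdd: "bd t (d n p) (s + 1)" for n p
  proof (induction n arbitrary: p)
    case 0
    have "0 \<le> s" using s[OF t(1,2)] bd_nonneg by blast
    then show ?case by (simp add: d_def bd_zero)
  next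
    case (Suc n)
    have "bd t (\<Psi> (d n) p) \<beta>"
      using c[OF t(1,2), of "d n" p] Suc bd_mono[of t _ "c p" t \<beta>] \<beta>(1)[of p] t by auto
    then have "bd t (fps_X * \<Psi> (d n) p) 1"
      using bd_mono[OF bd_X_mult, of t _ \<beta> t 1] t by auto
    then show ?case unfolding d_Suc \<Phi>_def using t s by (intro bd_add) auto
  qed
  have "bd t (D p) (s + 1)" for p
    unfolding bd_def
  proof
    fix m
    have "(\<Sum>n\<le>m. \<bar>fps_nth (D p) n\<bar> * t ^ n) = (\<Sum>n\<le>m. \<bar>fps_nth (d (Suc m) p) n\<bar> * t ^ n)"
      using D_d[of "Suc m" p] by (intro sum.cong) (auto simp: agree_def)
    also have "\<dots> \<le> s + 1" using bdd[of "Suc m" p] unfolding bd_def by blast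
    finally show "(\<Sum>n\<le>m. \<bar>fps_nth (D p) n\<bar> * t ^ n) \<le> s + 1" .
  qed
  then show ?thesis using that[of D] fixed t(1) bd_iff_conv_radius by blast
qed

text \<open>
  Splitting off the constant terms of weights and unknown. The factor of \<open>x\<close> is the
  linearisation at the constant terms applied to \<open>D\<close>, a known term, and \<open>x\<close> times an expression
  that is polynomial in \<open>D\<close>; so an inverse of the linearisation turns the equation into a fixed
  point equation as above.
\<close>

lemma ric_split:
  fixes x :: "'a::comm_ring_1"
  shows "ric P N (\<lambda>i. e0 i + x * e1 i) (\<lambda>i l. f0 i l + x * f1 i l) (\<lambda>k j. s0 k j + x * s1 k j) A
      (\<lambda>k l. y0 k l + x * D k l) i j
    = ric P N e0 f0 s0 A y0 i j + x * (dric P N e0 f0 s0 A y0 D i j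
      + (e1 i * (A i j + lin P s0 A y0 i j) + e0 i * lin P s1 A y0 i j
         + (\<Sum>l\<in>N. f0 i l * y0 i l * lin P s1 A y0 l j + f1 i l * y0 i l * (A l j + lin P s0 A y0 l j)))
      + x * (e0 i * lin P s1 A D i j
         + e1 i * (lin P s1 A y0 i j + lin P s0 A D i j + x * lin P s1 A D i j)
         + (\<Sum>l\<in>N. f0 i l * y0 i l * lin P s1 A D l j + f1 i l * D i l * (A l j + lin P s0 A y0 l j)
              + (f1 i l * y0 i l + f0 i l * D i l + x * (f1 i l * D i l))
                * (lin P s1 A y0 l j + lin P s0 A D l j + x * lin P s1 A D l j))))"
proof -
  have L: "lin P (\<lambda>k j. s0 k j + x * s1 k j) A (\<lambda>k l. y0 k l + x * D k l) l j
     = lin P s0 A y0 l j + x * (lin P s1 A y0 l j + lin P s0 A D l j + x * lin P s1 A D l j)" for l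
    unfolding lin_def sum_distrib_left sum.distrib[symmetric]
    by (intro sum.cong) (auto simp: algebra_simps)
  have S: "(\<Sum>l\<in>N. (f0 i l + x * f1 i l) * (y0 i l + x * D i l)
        * (A l j + (lin P s0 A y0 l j + x * (lin P s1 A y0 l j + lin P s0 A D l j + x * lin P s1 A D l j))))
    = (\<Sum>l\<in>N. f0 i l * y0 i l * (A l j + lin P s0 A y0 l j))
      + x * ((\<Sum>l\<in>N. f0 i l * y0 i l * lin P s0 A D l j + f0 i l * D i l * (A l j + lin P s0 A y0 l j))
      + (\<Sum>l\<in>N. f0 i l * y0 i l * lin P s1 A y0 l j + f1 i l * y0 i l * (A l j + lin P s0 A y0 l j))
      + x * (\<Sum>l\<in>N. f0 i l * y0 i l * lin P s1 A D l j + f1 i l * D i l * (A l j + lin P s0 A y0 l j)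
              + (f1 i l * y0 i l + f0 i l * D i l + x * (f1 i l * D i l))
                * (lin P s1 A y0 l j + lin P s0 A D l j + x * lin P s1 A D l j)))"
    unfolding sum_distrib_left sum.distrib[symmetric]
    by (intro sum.cong) (auto simp: algebra_simps)
  show ?thesis unfolding ric_def dric_def L S by (simp add: algebra_simps)
qed

text \<open>
  The matrix of the linearisation with respect to the coordinates \<open>P \<times> N\<close>.
\<close>

definition jac where
  "jac P N e f s A Y p q =
     (if snd q = snd p then (e (fst p) * A (fst p) (fst q)
          + (\<Sum>l\<in>N. f (fst p) l * Y (fst p) l * A l (fst q))) * s (fst q) (snd p) else 0)
     + (if fst q = fst p then f (fst p) (snd q) * (A (snd q) (snd p) + lin P s A Y (snd q) (snd p)) else 0)"

lemma dric_jac: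
  assumes "finite P" "finite N" "i \<in> P" "j \<in> N"
  shows "dric P N e f s A Y D i j = (\<Sum>q\<in>P \<times> N. jac P N e f s A Y (i, j) q * D (fst q) (snd q))"
proof -
  have "(\<Sum>q\<in>P \<times> N. jac P N e f s A Y (i, j) q * D (fst q) (snd q))
    = (\<Sum>k\<in>P. \<Sum>m\<in>N. jac P N e f s A Y (i, j) (k, m) * D k m)"
    by (simp add: sum.cartesian_product case_prod_unfold)
  also have "\<dots> = (\<Sum>k\<in>P. \<Sum>m\<in>N. (if m = j then
          (e i * A i k + (\<Sum>l\<in>N. f i l * Y i l * A l k)) * s k j * D k m else 0))
      + (\<Sum>k\<in>P. \<Sum>m\<in>N. if k = i then f i m * (A m j + lin P s A Y m j) * D k m else 0)"
    unfolding sum.distrib[symmetric] jac_def by (intro sum.cong) (auto simp: distrib_right)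
  also have "(\<Sum>k\<in>P. \<Sum>m\<in>N. if k = i then f i m * (A m j + lin P s A Y m j) * D k m else 0)
     = (\<Sum>m\<in>N. f i m * (A m j + lin P s A Y m j) * D i m)"
    using assms by (subst sum.swap) (simp add: sum.delta)
  finally show ?thesis unfolding dric_K_U using assms by (simp add: sum.delta algebra_simps)
qed

lemma sum_fps_const: "(\<Sum>k\<in>S. fps_const (g k :: 'a::comm_ring_1)) = fps_const (\<Sum>k\<in>S. g k)"
  by (induction S rule: infinite_finite_induct) auto

lemma lin_const:
  "lin P (\<lambda>k j. fps_const (s k j)) (\<lambda>i j. fps_const (A i j)) (\<lambda>k l. fps_const (Y k l)) i j
     = fps_const (lin P s A Y i j)"
  by (simp add: lin_def sum_fps_const)

lemma ric_const:
  "ric P N (\<lambda>i. fps_const (e i)) (\<lambda>i l. fps_const (f i l)) (\<lambda>k j. fps_const (s k j))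
     (\<lambda>i j. fps_const (A i j)) (\<lambda>k l. fps_const (Y k l)) i j = fps_const (ric P N e f s A Y i j)"
  by (simp add: ric_def lin_const sum_fps_const)

lemma jac_const:
  "jac P N (\<lambda>i. fps_const (e i)) (\<lambda>i l. fps_const (f i l)) (\<lambda>k j. fps_const (s k j))
     (\<lambda>i j. fps_const (A i j)) (\<lambda>k l. fps_const (Y k l)) p q = fps_const (jac P N e f s A Y p q)"
  by (simp add: jac_def lin_const sum_fps_const)

lemma fps_split: "(f :: 'a::comm_ring_1 fps) = fps_const (fps_nth f 0) + fps_X * fps_shift 1 f"
  by (rule fps_ext) auto

lemma common_bound:
  assumes "finite S" "\<And>f. f \<in> S \<Longrightarrow> 0 < fps_conv_radius f"
  obtains T where "(0::real) < T" and "\<And>f. f \<in> S \<Longrightarrow> \<exists>b. bd T f b"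
proof -
  have "\<exists>T>0. \<forall>f\<in>S. \<exists>b. bd T f b"
    using assms
  proof (induction S rule: finite_induct)
    case (insert x S)
    then obtain T where T: "T > 0" "\<forall>f\<in>S. \<exists>b. bd T f b" by auto
    obtain u where u: "u > 0" "\<exists>b. bd u x b" using bd_iff_conv_radius[of x] insert by auto
    show ?case
      by (rule exI[of _ "min T u"]) (use T u in \<open>fastforce intro: bd_mono\<close>)
  qed (auto intro: exI[of _ 1])
  then show ?thesis using that by blast
qed

text \<open>
  At a nonnegative point the matrix of the linearisation is Metzler, and \<open>H\<close> is its certificate.
\<close>

lemma (in riccati_data) dric_inverse:
  assumes Y: "\<And>i j. i \<in> P \<Longrightarrow> j \<in> N \<Longrightarrow> 0 \<le> Y i j"
    and H: "\<And>i j. i \<in> P \<Longrightarrow> j \<in> N \<Longrightarrow> 0 < H i j"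
    and cert: "\<And>i j. i \<in> P \<Longrightarrow> j \<in> N \<Longrightarrow> DRic Y H i j < 0"
  obtains B where "\<And>p q. p \<in> P \<times> N \<Longrightarrow> q \<in> P \<times> N \<Longrightarrow>
    (\<Sum>r\<in>P \<times> N. jac P N e f s A Y p r * B r q) = (if p = q then - 1 else 0)"
proof (rule metzler_inverse[of "P \<times> N" "jac P N e f s A Y" "\<lambda>q. H (fst q) (snd q)"])
  have offs: "0 \<le> A l k" if "l \<in> N" "k \<in> P" for l k
    using that disj off by (metis IntI Un_iff empty_iff)
  fix p q assume pq: "p \<in> P \<times> N" "q \<in> P \<times> N" "p \<noteq> q"
  obtain i j k m where [simp]: "p = (i, j)" "q = (k, m)" by (cases p, cases q)
  have "0 \<le> (e i * A i k + (\<Sum>l\<in>N. f i l * Y i l * A l k)) * s k j" if "i \<noteq> k"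
    using that pq e f Y s off offs by (intro mult_nonneg_nonneg add_nonneg_nonneg sum_nonneg) auto
  moreover have "0 \<le> f i m * (A m j + Lin Y m j)" if "m \<noteq> j"
    using that pq e f Y s off offs unfolding lin_def
    by (intro mult_nonneg_nonneg add_nonneg_nonneg sum_nonneg) auto
  ultimately show "0 \<le> jac P N e f s A Y p q" using pq(3) by (auto simp: jac_def)
next
  fix p assume "p \<in> P \<times> N"
  then show "0 < H (fst p) (snd p)" "(\<Sum>q\<in>P \<times> N. jac P N e f s A Y p q * H (fst q) (snd q)) < 0"
    using H cert[of "fst p" "snd p"] dric_jac[of P N "fst p" "snd p" e f s A Y H]
    by (auto simp: mem_Times_iff)
qed (use that in blast)

lemma range_case_prodI: "g i j \<in> range (case_prod g)"
  using rangeI[of "case_prod g" "(i, j)"] by simp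

text \<open>
  The implicit function theorem in this setting, proved with power series in order to have the
  coefficients at hand.
\<close>

lemma analytic_branch:
  fixes e :: "'s::finite \<Rightarrow> real fps" and f s :: "'s \<Rightarrow> 's \<Rightarrow> real fps" and A y0 :: "'s \<Rightarrow> 's \<Rightarrow> real"
  assumes re: "\<And>i. 0 < fps_conv_radius (e i)" and rf: "\<And>i l. 0 < fps_conv_radius (f i l)"
    and rs: "\<And>k j. 0 < fps_conv_radius (s k j)"
    and data: "riccati_data P N (\<lambda>i. fps_nth (e i) 0) (\<lambda>i l. fps_nth (f i l) 0) (\<lambda>k j. fps_nth (s k j) 0) A"
    and y0: "\<And>i j. i \<in> P \<Longrightarrow> j \<in> N \<Longrightarrow> 0 \<le> y0 i j \<and>
      ric P N (\<lambda>i. fps_nth (e i) 0) (\<lambda>i l. fps_nth (f i l) 0) (\<lambda>k j. fps_nth (s k j) 0) A y0 i j = 0"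
    and H: "\<And>i j. i \<in> P \<Longrightarrow> j \<in> N \<Longrightarrow> 0 < H i j"
    and cert: "\<And>i j. i \<in> P \<Longrightarrow> j \<in> N \<Longrightarrow>
      dric P N (\<lambda>i. fps_nth (e i) 0) (\<lambda>i l. fps_nth (f i l) 0) (\<lambda>k j. fps_nth (s k j) 0) A y0 H i j < 0"
  obtains Y where "\<And>i j. 0 < fps_conv_radius (Y i j)"
    and "\<And>i j. fps_nth (Y i j) 0 = y0 i j"
    and "\<And>i j. i \<in> P \<Longrightarrow> j \<in> N \<Longrightarrow> ric P N e f s (\<lambda>i j. fps_const (A i j)) Y i j = 0"
proof -
  define e0 e1 where "e0 i = fps_const (fps_nth (e i) 0)" and "e1 i = fps_shift 1 (e i)" for i
  define f0 f1 where "f0 i l = fps_const (fps_nth (f i l) 0)" and "f1 i l = fps_shift 1 (f i l)" for i l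
  define s0 s1 where "s0 k j = fps_const (fps_nth (s k j) 0)" and "s1 k j = fps_shift 1 (s k j)" for k j
  define z0 where "z0 k j = fps_const (y0 k j)" for k j
  define A' where "A' i j = fps_const (A i j)" for i j
  let ?J = "jac P N (\<lambda>i. fps_nth (e i) 0) (\<lambda>i l. fps_nth (f i l) 0) (\<lambda>k j. fps_nth (s k j) 0) A y0"
  interpret R: riccati_data P N "\<lambda>i. fps_nth (e i) 0" "\<lambda>i l. fps_nth (f i l) 0" "\<lambda>k j. fps_nth (s k j) 0" A
    by (rule data)
  obtain B where B: "\<And>p q. p \<in> P \<times> N \<Longrightarrow> q \<in> P \<times> N \<Longrightarrow>
      (\<Sum>r\<in>P \<times> N. ?J p r * B r q) = (if p = q then - 1 else 0)"
    using R.dric_inverse[of y0 H] y0 H cert by blast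
  (* The equation divided by fps_X reads: linearisation of D plus \<alpha> plus fps_X times
     \<beta> is zero. *)
  define \<alpha> where "\<alpha> i j = e1 i * (A' i j + lin P s0 A' z0 i j) + e0 i * lin P s1 A' z0 i j
         + (\<Sum>l\<in>N. f0 i l * z0 i l * lin P s1 A' z0 l j + f1 i l * z0 i l * (A' l j + lin P s0 A' z0 l j))"
    for i j
  define \<beta> where "\<beta> D i j = e0 i * lin P s1 A' D i j
         + e1 i * (lin P s1 A' z0 i j + lin P s0 A' D i j + fps_X * lin P s1 A' D i j)
         + (\<Sum>l\<in>N. f0 i l * z0 i l * lin P s1 A' D l j + f1 i l * D i l * (A' l j + lin P s0 A' z0 l j)
              + (f1 i l * z0 i l + f0 i l * D i l + fps_X * (f1 i l * D i l))
                * (lin P s1 A' z0 l j + lin P s0 A' D l j + fps_X * lin P s1 A' D l j))" for D i j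
  (* All coefficients that occur, in one finite set, so that one T serves for all of them. *)
  define S where "S = range e0 \<union> range e1 \<union> range (case_prod f0) \<union> range (case_prod f1) \<union>
      range (case_prod s0) \<union> range (case_prod s1) \<union> range (case_prod z0) \<union> range (case_prod A') \<union>
      {fps_X} \<union> range (\<lambda>(p, q). fps_const (B p q))"
  have finS: "finite S" by (simp add: S_def)
  have radS: "0 < fps_conv_radius g" if "g \<in> S" for g
    using that re rf rs unfolding S_def e0_def e1_def f0_def f1_def s0_def s1_def z0_def A'_def by auto
  obtain T where T: "0 < T" "\<And>g. g \<in> S \<Longrightarrow> \<exists>b. bd T g b"
    using common_bound[OF finS radS] by blast
  have tameS: "tame T (\<lambda>_ :: 's \<times> 's \<Rightarrow> real fps. g)" if "g \<in> S" for g
    using T(2)[OF that] tame_const by blast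
  have inS: "e0 i \<in> S" "e1 i \<in> S" "f0 i j \<in> S" "f1 i j \<in> S" "s0 i j \<in> S" "s1 i j \<in> S" "z0 i j \<in> S"
    "A' i j \<in> S" "fps_X \<in> S" "fps_const (B p q) \<in> S" for i j p q
    by (simp_all only: S_def Un_iff range_case_prodI range_case_prodI[of "\<lambda>p q. fps_const (B p q)"] rangeI insertI1 simp_thms)
  note tameS' = inS[THEN tameS]
  have tame_\<beta>: "tame T (\<lambda>D. \<beta> (\<lambda>k l. D (k, l)) i j)" for i j
    unfolding \<beta>_def lin_def by (intro tame_add tame_mult tame_sum tame_proj tameS')
  have tame_\<alpha>: "tame T (\<lambda>D :: 's \<times> 's \<Rightarrow> real fps. \<alpha> i j)" for i j
    unfolding \<alpha>_def lin_def by (intro tame_add tame_mult tame_sum tame_proj tameS')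
  have bd_const: "\<exists>b. bd T g b" if "tame T (\<lambda>D :: 's \<times> 's \<Rightarrow> real fps. g)" for g
  proof -
    obtain c where "\<forall>t (D :: 's \<times> 's \<Rightarrow> real fps). 0 < t \<longrightarrow> t \<le> T \<longrightarrow> (\<forall>p. bd t (D p) 0) \<longrightarrow> bd t g c"
      using \<open>tame T (\<lambda>D. g)\<close> unfolding tame_def by blast
    from this[rule_format, of T "\<lambda>_. 0"] show ?thesis using T(1) bd_zero by auto
  qed
  obtain D where D: "\<And>p. D p = (\<Sum>q\<in>P \<times> N. fps_const (B p q) * \<alpha> (fst q) (snd q))
        + fps_X * (\<Sum>q\<in>P \<times> N. fps_const (B p q) * \<beta> (\<lambda>k l. D (k, l)) (fst q) (snd q))"
    and rD: "\<And>p. 0 < fps_conv_radius (D p)"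
  proof (rule fps_fixed_point[of T "\<lambda>p. \<Sum>q\<in>P \<times> N. fps_const (B p q) * \<alpha> (fst q) (snd q)"
        "\<lambda>D p. \<Sum>q\<in>P \<times> N. fps_const (B p q) * \<beta> (\<lambda>k l. D (k, l)) (fst q) (snd q)"])
    show "tame T (\<lambda>D. \<Sum>q\<in>P \<times> N. fps_const (B p q) * \<beta> (\<lambda>k l. D (k, l)) (fst q) (snd q))" for p
      by (intro tame_mult tame_sum tame_\<beta> tameS')
    show "\<exists>b. bd T (\<Sum>q\<in>P \<times> N. fps_const (B p q) * \<alpha> (fst q) (snd q)) b" for p
      by (intro bd_const tame_mult tame_sum tame_\<alpha> tameS')
  qed (rule T(1), rule that)
  define D' where "D' k l = D (k, l)" for k l
  define \<gamma> where "\<gamma> q = \<alpha> (fst q) (snd q) + fps_X * \<beta> D' (fst q) (snd q)" for q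
  have D\<gamma>: "D p = (\<Sum>q\<in>P \<times> N. fps_const (B p q) * \<gamma> q)" for p
    by (subst D) (simp add: \<gamma>_def D'_def[abs_def] distrib_left sum.distrib sum_distrib_left mult.left_commute)
  have drD: "dric P N e0 f0 s0 A' z0 D' i j = - \<gamma> (i, j)" if ij: "i \<in> P" "j \<in> N" for i j
  proof -
    have "dric P N e0 f0 s0 A' z0 D' i j = (\<Sum>r\<in>P \<times> N. fps_const (?J (i, j) r) * D r)"
      unfolding dric_jac[OF finite finite ij] D'_def e0_def f0_def s0_def z0_def A'_def jac_const by simp
    also have "\<dots> = (\<Sum>r\<in>P \<times> N. \<Sum>q\<in>P \<times> N. fps_const (?J (i, j) r * B r q) * \<gamma> q)"
      unfolding D\<gamma> by (simp add: sum_distrib_left mult.assoc flip: fps_const_mult)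
    also have "\<dots> = (\<Sum>q\<in>P \<times> N. fps_const (\<Sum>r\<in>P \<times> N. ?J (i, j) r * B r q) * \<gamma> q)"
      by (subst sum.swap) (simp add: sum_distrib_right flip: sum_fps_const)
    also have "\<dots> = (\<Sum>q\<in>P \<times> N. if (i, j) = q then - \<gamma> q else 0)"
    proof (rule sum.cong)
      fix q assume "q \<in> P \<times> N"
      then show "fps_const (\<Sum>r\<in>P \<times> N. ?J (i, j) r * B r q) * \<gamma> q = (if (i, j) = q then - \<gamma> q else 0)"
        using B[of "(i, j)" q] ij by (simp flip: fps_const_neg)
    qed simp
    finally show ?thesis using ij by (simp add: sum.delta')
  qed
  define Y where "Y k l = z0 k l + fps_X * D' k l" for k l
  have "ric P N e f s A' Y i j = 0" if ij: "i \<in> P" "j \<in> N" for i j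
  proof -
    have spl: "e = (\<lambda>i. e0 i + fps_X * e1 i)" "f = (\<lambda>i l. f0 i l + fps_X * f1 i l)"
      "s = (\<lambda>k j. s0 k j + fps_X * s1 k j)" "Y = (\<lambda>k l. z0 k l + fps_X * D' k l)"
      unfolding e0_def e1_def f0_def f1_def s0_def s1_def Y_def[abs_def]
      by (auto simp: fun_eq_iff intro: fps_split[unfolded One_nat_def])
    have "ric P N e f s A' Y i j = ric P N e0 f0 s0 A' z0 i j
        + fps_X * (dric P N e0 f0 s0 A' z0 D' i j + \<alpha> i j + fps_X * \<beta> D' i j)"
      unfolding \<alpha>_def \<beta>_def by (subst spl, subst spl(2), subst spl(3), subst spl(4)) (rule ric_split)
    also have "ric P N e0 f0 s0 A' z0 i j = 0"
      unfolding e0_def f0_def s0_def z0_def A'_def ric_const using y0[OF ij] by simp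
    finally show ?thesis unfolding drD[OF ij] \<gamma>_def by simp
  qed
  moreover have "0 < fps_conv_radius (Y i j)" for i j
  proof -
    have "0 < min (fps_conv_radius (z0 i j)) (fps_conv_radius (fps_X * D' i j))"
      using rD[of "(i, j)"] fps_conv_radius_mult[of fps_X "D' i j"]
      by (auto simp: D'_def z0_def intro: less_le_trans)
    then show ?thesis unfolding Y_def using fps_conv_radius_add less_le_trans by blast
  qed
  moreover have "fps_nth (Y i j) 0 = y0 i j" for i j by (simp add: Y_def z0_def)
  ultimately show ?thesis using that[of Y] unfolding A'_def by blast
qed

section \<open>The drift condition and the limit equation\<close>

text \<open>
  Uniqueness of the stationary vector makes \<open>A - 1 \<xi>\<close> invertible, where \<open>1 \<xi>\<close> has all
  rows equal to \<open>\<xi>\<close>. This solves the Poisson equation \<open>A m = \<mu> 1 - C 1\<close> with the mean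
  drift \<open>\<mu> < 0\<close>. For \<open>h = 1 + \<theta> m\<close> the terms of first order in \<open>\<theta>\<close> of \<open>(A +
  \<theta> C) h\<close> add up to \<open>\<theta> \<mu> < 0\<close>, and the remainder is of second order.
\<close>

lemma negative_drift_lyapunov:
  fixes A :: "real ^ 's ^ 's" and \<xi> :: "real ^ 's" and c :: "'s::finite \<Rightarrow> real"
  assumes gen: "generator A" and st: "stationary_vector A \<xi>" and drift: "(\<xi> v* diag_mat c) \<bullet> 1 < 0"
  obtains \<theta> h where "0 < \<theta>" and "\<And>i. (0::real) < h i"
    and "\<And>i. (\<Sum>j\<in>UNIV. A $ i $ j * h j) + \<theta> * c i * h i < 0"
proof -
  have rows: "(\<Sum>j\<in>UNIV. A $ i $ j) = 0" for i using gen by (simp add: generator_def)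
  have st': "\<xi> v* A = 0" "\<xi> \<bullet> 1 = 1" and uniq: "\<And>x. x v* A = 0 \<Longrightarrow> x \<bullet> 1 = 1 \<Longrightarrow> x = \<xi>"
    using st unfolding stationary_vector_def by blast+
  have \<xi>A: "(\<Sum>i\<in>UNIV. \<xi> $ i * A $ i $ j) = 0" for j
    using st'(1) by (simp add: vec_eq_iff vector_matrix_mult_def mult.commute)
  have \<xi>1: "(\<Sum>i\<in>UNIV. \<xi> $ i) = 1" using st'(2) by (simp add: inner_vec_def)
  define \<mu> where "\<mu> = (\<Sum>i\<in>UNIV. \<xi> $ i * c i)"
  have \<mu>: "\<mu> < 0"
    using drift
    by (simp add: \<mu>_def inner_vec_def vector_matrix_mult_def diag_mat_def if_distrib mult.commute cong: if_cong)
  define B :: "real ^ 's ^ 's" where "B = (\<chi> i j. A $ i $ j - \<xi> $ j)"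
  have "x = 0" if "transpose B *v x = 0" for x
  proof -
    have "(\<Sum>i\<in>UNIV. (A $ i $ j - \<xi> $ j) * x $ i) = 0" for j
      using that by (simp add: vec_eq_iff matrix_vector_mult_def transpose_def B_def)
    then have xA: "(\<Sum>i\<in>UNIV. x $ i * A $ i $ j) = (\<Sum>i\<in>UNIV. x $ i) * \<xi> $ j" for j
      by (simp add: algebra_simps sum_subtractf sum_distrib_left)
    have "(\<Sum>j\<in>UNIV. \<Sum>i\<in>UNIV. x $ i * A $ i $ j) = 0"
      by (subst sum.swap) (simp add: rows flip: sum_distrib_left)
    then have "(\<Sum>i\<in>UNIV. x $ i) = 0" using xA \<xi>1 by (simp flip: sum_distrib_left)
    moreover from this have "(\<xi> + x) v* A = 0"
      using xA \<xi>A by (simp add: vec_eq_iff vector_matrix_mult_def distrib_left sum.distrib mult.commute)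
    ultimately have "\<xi> + x = \<xi>"
      using \<xi>1 by (intro uniq) (simp_all add: inner_vec_def sum.distrib)
    then show "x = 0" by simp
  qed
  then have "invertible (transpose B)"
    using matrix_left_invertible_ker[of "transpose B"] invertible_left_inverse[of "transpose B"] by auto
  then obtain R' where "R' ** transpose B = mat 1" unfolding invertible_def by blast
  then have R: "B ** transpose R' = mat 1"
    using matrix_transpose_mul[of R' "transpose B"] by (simp add: transpose_mat)
  define m where "m = transpose R' *v (\<chi> i. \<mu> - c i)"
  have "B *v m = (\<chi> i. \<mu> - c i)" unfolding m_def matrix_vector_mul_assoc R by simp
  then have Bm: "(\<Sum>j\<in>UNIV. (A $ i $ j - \<xi> $ j) * m $ j) = \<mu> - c i" for i
    by (simp add: vec_eq_iff matrix_vector_mult_def B_def)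
  define \<rho> where "\<rho> = (\<Sum>j\<in>UNIV. \<xi> $ j * m $ j)"
  have Am: "(\<Sum>j\<in>UNIV. A $ i $ j * m $ j) = \<mu> - c i + \<rho>" for i
    using Bm[of i] by (simp add: algebra_simps sum_subtractf \<rho>_def)
  (* Multiplying the equation for m from the left by the stationary vector removes the
     correction term. *)
  have "0 = (\<Sum>j\<in>UNIV. (\<Sum>i\<in>UNIV. \<xi> $ i * A $ i $ j) * m $ j)" by (simp add: \<xi>A)
  also have "\<dots> = (\<Sum>i\<in>UNIV. \<xi> $ i * (\<Sum>j\<in>UNIV. A $ i $ j * m $ j))"
    unfolding sum_distrib_right sum_distrib_left by (subst sum.swap) (simp add: mult.assoc)
  also have "\<dots> = (\<Sum>i\<in>UNIV. \<mu> * \<xi> $ i - \<xi> $ i * c i + \<rho> * \<xi> $ i)"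
    unfolding Am by (simp add: algebra_simps)
  also have "\<dots> = \<rho>"
    by (simp add: sum.distrib sum_subtractf \<xi>1 flip: sum_distrib_left \<mu>_def)
  finally have \<rho>: "\<rho> = 0" by simp
  have "\<forall>\<^sub>F \<theta> in at_right 0. \<forall>i\<in>UNIV. \<theta> * (- m $ i) + (- 1) < 0 \<and> \<theta> * (c i * m $ i) + \<mu> < 0"
    by (intro eventually_ball_finite ballI eventually_conj small_perturbation_negative) (use \<mu> in auto)
  then have "\<forall>\<^sub>F \<theta> in at_right 0. 0 < \<theta> \<and> (\<forall>i\<in>UNIV. \<theta> * (- m $ i) + (- 1) < 0 \<and> \<theta> * (c i * m $ i) + \<mu> < 0)"
    by (rule eventually_conj[OF eventually_at_right_less])
  then obtain \<theta> where \<theta>0: "0 < \<theta>" and \<theta>':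
    "\<forall>i\<in>UNIV. \<theta> * (- m $ i) + (- 1) < 0 \<and> \<theta> * (c i * m $ i) + \<mu> < 0"
    using eventually_happens'[OF trivial_limit_at_right_real] by blast
  have \<theta>: "0 < \<theta>" "0 < 1 + \<theta> * m $ i" "\<theta> * (c i * m $ i) + \<mu> < 0" for i
    using \<theta>0 bspec[OF \<theta>', of i] by auto
  have "(\<Sum>j\<in>UNIV. A $ i $ j * (1 + \<theta> * m $ j)) + \<theta> * c i * (1 + \<theta> * m $ i) < 0" for i
  proof -
    have "(\<Sum>j\<in>UNIV. A $ i $ j * (1 + \<theta> * m $ j)) = (\<Sum>j\<in>UNIV. A $ i $ j) + \<theta> * (\<Sum>j\<in>UNIV. A $ i $ j * m $ j)"
      by (simp add: algebra_simps sum.distrib sum_distrib_left)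
    also have "\<dots> = \<theta> * (\<mu> - c i)" using rows Am \<rho> by simp
    finally have "(\<Sum>j\<in>UNIV. A $ i $ j * (1 + \<theta> * m $ j)) + \<theta> * c i * (1 + \<theta> * m $ i)
        = \<theta> * (\<theta> * (c i * m $ i) + \<mu>)" by (simp add: algebra_simps)
    then show ?thesis using mult_pos_neg[OF \<theta>(1,3)] by simp
  qed
  then show ?thesis using that[of \<theta> "\<lambda>i. 1 + \<theta> * m $ i", OF \<theta>(1,2)] by blast
qed

lemma lin_diagonal:
  assumes "finite P"
  shows "lin P s (\<lambda>i j. A i j + (if i = j then w i else 0)) Y l j
     = lin P s A Y l j + (if l \<in> P then w l * (s l j * Y l j) else 0)"
  unfolding lin_def using assms
  by (simp add: distrib_right sum.distrib if_distrib[of "\<lambda>x. x * _"] sum.delta' cong: if_cong)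

lemma sum_diagonal:
  assumes "finite N" "j \<in> N"
  shows "(\<Sum>l\<in>N. g l * (if l = j then w l else 0)) = g j * (w j :: 'a::comm_ring_1)"
  using assms by (simp add: if_distrib[of "\<lambda>x. _ * x"] sum.delta cong: if_cong)

text \<open>
  Adding a diagonal matrix to \<open>A\<close> changes the map by a multiple of each entry. For the rates of
  the fluid model this multiple is zero, so that \<open>A\<close> may be replaced by \<open>A + \<theta> C\<close>.
\<close>

lemma ric_diagonal:
  fixes A :: "'s \<Rightarrow> 's \<Rightarrow> 'a::comm_ring_1"
  assumes "finite P" "finite N" "P \<inter> N = {}" "i \<in> P" "j \<in> N"
  shows "ric P N e f s (\<lambda>i j. A i j + (if i = j then w i else 0)) Y i j
     = ric P N e f s A Y i j + (e i * w i * s i j + f i j * w j) * Y i j"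
proof -
  have "(\<Sum>l\<in>N. f i l * Y i l * (A l j + (if l = j then w l else 0)
        + (lin P s A Y l j + (if l \<in> P then w l * (s l j * Y l j) else 0))))
    = (\<Sum>l\<in>N. f i l * Y i l * (A l j + lin P s A Y l j) + f i l * Y i l * (if l = j then w l else 0))"
    using assms by (intro sum.cong) (auto simp: algebra_simps)
  also have "\<dots> = (\<Sum>l\<in>N. f i l * Y i l * (A l j + lin P s A Y l j)) + f i j * Y i j * w j"
    using sum_diagonal[OF assms(2,5), of "\<lambda>l. f i l * Y i l" w] by (simp add: sum.distrib)
  finally show ?thesis
    unfolding ric_def lin_diagonal[OF assms(1)] using assms by (auto simp: algebra_simps)
qed

lemma dric_diagonal:
  fixes A :: "'s \<Rightarrow> 's \<Rightarrow> 'a::comm_ring_1"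
  assumes "finite P" "finite N" "P \<inter> N = {}" "i \<in> P" "j \<in> N"
  shows "dric P N e f s (\<lambda>i j. A i j + (if i = j then w i else 0)) Y D i j
     = dric P N e f s A Y D i j + (e i * w i * s i j + f i j * w j) * D i j"
proof -
  have "(\<Sum>l\<in>N. f i l * Y i l * (lin P s A D l j + (if l \<in> P then w l * (s l j * D l j) else 0))
        + f i l * D i l * (A l j + (if l = j then w l else 0)
        + (lin P s A Y l j + (if l \<in> P then w l * (s l j * Y l j) else 0))))
    = (\<Sum>l\<in>N. (f i l * Y i l * lin P s A D l j + f i l * D i l * (A l j + lin P s A Y l j))
         + f i l * D i l * (if l = j then w l else 0))"
    using assms by (intro sum.cong) (auto simp: algebra_simps)
  also have "\<dots> = (\<Sum>l\<in>N. f i l * Y i l * lin P s A D l j + f i l * D i l * (A l j + lin P s A Y l j))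
      + f i j * D i j * w j"
    using sum_diagonal[OF assms(2,5), of "\<lambda>l. f i l * D i l" w] by (simp add: sum.distrib)
  finally show ?thesis
    unfolding dric_def lin_diagonal[OF assms(1)] using assms by (auto simp: algebra_simps)
qed

locale fluid =
  fixes A :: "real ^ 's ^ 's" and c ct :: "'s::finite \<Rightarrow> real" and \<xi> :: "real ^ 's"
  assumes gen: "generator A" and stat: "stationary_vector A \<xi>"
    and drift: "(\<xi> v* diag_mat c) \<bullet> 1 < 0" and ct: "\<And>i. c i = 0 \<Longrightarrow> ct i \<noteq> 0"
begin

definition "Pl = {i. 0 < c i}"
definition "Ze = {i. c i = 0}"
definition "Mi = {i. c i < 0}"
definition "Op = {i. c i = 0 \<and> 0 < ct i}"
definition "Om = {i. c i = 0 \<and> ct i < 0}"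
abbreviation "P \<equiv> Pl \<union> Op"
abbreviation "N \<equiv> Om \<union> Mi"
definition "A' i j = A $ i $ j"

lemmas sets = Pl_def Ze_def Mi_def Op_def Om_def

lemma set_facts: "P \<inter> N = {}" "P \<union> N = UNIV" "Pl \<inter> Op = {}" "Om \<inter> Mi = {}" "Op \<union> Om = Ze"
  "Op \<inter> Om = {}" "Pl \<inter> Mi = {}"
  using ct by (auto simp: sets) (metis linorder_neqE)+

lemma set_disjoint: "i \<in> Op \<Longrightarrow> i \<notin> Pl" "i \<in> Op \<Longrightarrow> i \<notin> Om" "i \<in> Op \<Longrightarrow> i \<notin> Mi"
  "i \<in> Om \<Longrightarrow> i \<notin> Pl" "i \<in> Om \<Longrightarrow> i \<notin> Mi" "i \<in> Mi \<Longrightarrow> i \<notin> Pl"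
  by (auto simp: sets)

lemma A_off: "i \<noteq> j \<Longrightarrow> 0 \<le> A' i j"
  using gen by (simp add: generator_def A'_def)

text \<open>
  The weights of the scaled equation at \<open>\<epsilon> = 0\<close>. The factor \<open>\<epsilon>\<close> of the rows
  \<open>Op\<close> cancels in \<open>1 / (\<epsilon> * ct i)\<close>, and in these rows it makes the quadratic weight of
  the columns \<open>Mi\<close> vanish; in the columns \<open>Om\<close> it cancels against \<open>1 / (\<epsilon> * \<bar>ct
  l\<bar>)\<close>. In the rows \<open>Pl\<close> that reciprocal is cancelled by the scale \<open>\<epsilon>\<close> of the
  block \<open>(Pl, Om)\<close> of the unknown, which in turn makes \<open>s0\<close> vanish on this block.
\<close>

definition e0 where "e0 i = (if i \<in> Op then 1 / ct i else 1 / c i)"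
definition v0 where "v0 l = (if l \<in> Om then 1 / \<bar>ct l\<bar> else 1 / \<bar>c l\<bar>)"
definition f0 where "f0 i l = (if i \<in> Op \<and> l \<in> Mi then 0 else v0 l)"
definition s0 :: "'s \<Rightarrow> 's \<Rightarrow> real" where "s0 k j = (if k \<in> Pl \<and> j \<in> Om then 0 else 1)"

lemma e0_pos: "i \<in> P \<Longrightarrow> 0 < e0 i"
  by (auto simp: e0_def sets)

lemma v0_pos: "l \<in> N \<Longrightarrow> 0 < v0 l"
  by (auto simp: v0_def sets)

lemma weights_cancel:
  assumes "i \<in> P" "j \<in> N"
  shows "e0 i * (\<theta> * c i) * s0 i j + f0 i j * (\<theta> * c j) = 0"
  using assms by (auto simp: e0_def v0_def f0_def s0_def sets)

lemma data0: "riccati_data P N e0 f0 s0 A'"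
  using set_facts(1) e0_pos v0_pos A_off
  by unfold_locales (auto simp: f0_def s0_def less_imp_le)

text \<open>
  The certificates \<open>a\<close> and \<open>b\<close> restricted to the phases of rate zero remain certificates there:
  on these phases the tilted matrix agrees with \<open>A\<close>, and the terms left out are nonnegative.
\<close>

lemma limit_exists:
  obtains y0 H a b where "\<And>i j. i \<in> P \<Longrightarrow> j \<in> N \<Longrightarrow> 0 \<le> y0 i j"
    and "\<And>i j. i \<in> P \<Longrightarrow> j \<in> N \<Longrightarrow> ric P N e0 f0 s0 A' y0 i j = 0"
    and "\<And>i j. i \<in> P \<Longrightarrow> j \<in> N \<Longrightarrow> (0::real) < H i j"
    and "\<And>i j. i \<in> P \<Longrightarrow> j \<in> N \<Longrightarrow> dric P N e0 f0 s0 A' y0 H i j < 0"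
    and "\<And>i. i \<in> Op \<Longrightarrow> (0::real) < a i"
    and "\<And>i. i \<in> Op \<Longrightarrow> (\<Sum>k\<in>Op. (e0 i * A' i k + (\<Sum>l\<in>Om. y0 i l * v0 l * A' l k)) * a k) < 0"
    and "\<And>l. l \<in> Om \<Longrightarrow> (0::real) < b l"
    and "\<And>j. j \<in> Om \<Longrightarrow> (\<Sum>l\<in>Om. b l * (v0 l * (A' l j + (\<Sum>k\<in>Op. A' l k * y0 k j)))) < 0"
    and "\<exists>h. (\<forall>i\<in>Ze. 0 < h i) \<and> (\<forall>i\<in>Ze. (\<Sum>j\<in>Ze. A' i j * h j) < 0)"
proof -
  obtain \<theta> h where \<theta>: "0 < \<theta>" and h: "\<And>i. (0::real) < h i"
    and Ah: "\<And>i. (\<Sum>j\<in>UNIV. A $ i $ j * h j) + \<theta> * c i * h i < 0"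
    by (rule negative_drift_lyapunov[OF gen stat drift], rule that)
  (* The tilted generator, which has the same limit Riccati map. *)
  define T where "T = (\<lambda>i j. A' i j + (if i = j then \<theta> * c i else 0))"
  have Th: "(\<Sum>j\<in>UNIV. T i j * h j) < 0" for i
  proof -
    have "(\<Sum>j\<in>UNIV. T i j * h j)
        = (\<Sum>j\<in>UNIV. A $ i $ j * h j + (if j = i then \<theta> * c i * h i else 0))"
      by (intro sum.cong) (auto simp: T_def A'_def distrib_right)
    then show ?thesis using Ah[of i] by (simp add: sum.distrib)
  qed
  have T_off: "0 \<le> T i j" if "i \<noteq> j" for i j using that A_off by (simp add: T_def)
  obtain g where g: "\<And>i. (0::real) < g i" and gT: "\<And>j. (\<Sum>i\<in>UNIV. g i * T i j) < 0"
    by (rule metzler_left_vector[of UNIV T h]) (use T_off h Th in auto)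
  have split: "(\<Sum>i\<in>P. q i) + (\<Sum>i\<in>N. q i) = (\<Sum>i\<in>UNIV. q i)" for q :: "'s \<Rightarrow> real"
    using sum.union_disjoint[of P N q] set_facts(1,2) by simp
  interpret X: excessive_riccati P N e0 f0 s0 T h g
    using set_facts(1) e0_pos v0_pos T_off h g Th gT
    by unfold_locales (auto simp: f0_def s0_def less_imp_le split dest: set_disjoint)
  have ric_T: "ric P N e0 f0 s0 T Y i j = ric P N e0 f0 s0 A' Y i j"
    "dric P N e0 f0 s0 T Y D i j = dric P N e0 f0 s0 A' Y D i j" if "i \<in> P" "j \<in> N" for Y D i j
    unfolding T_def using set_facts(1) that weights_cancel[OF that]
    by (simp_all add: ric_diagonal dric_diagonal)
  obtain y0 where y0: "\<And>i j. i \<in> P \<Longrightarrow> j \<in> N \<Longrightarrow> 0 \<le> y0 i j \<and> X.Ric y0 i j = 0"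
    and row: "\<And>i. i \<in> P \<Longrightarrow> X.row y0 i \<le> h i" and col: "\<And>l. l \<in> N \<Longrightarrow> X.col y0 l \<le> g l"
    by (rule X.bounded_solution_exists, rule that)
  define K where "K i k = e0 i * T i k + (\<Sum>l\<in>N. f0 i l * y0 i l * T l k)" for i k
  define U where "U l j = T l j + lin P s0 T y0 l j" for l j
  obtain a b where a: "\<And>i. i \<in> P \<Longrightarrow> 0 < a i" and Ka: "\<And>i. i \<in> P \<Longrightarrow> (\<Sum>k\<in>P. K i k * a k) < 0"
    and b: "\<And>l. l \<in> N \<Longrightarrow> 0 < b l" and bU: "\<And>j. j \<in> N \<Longrightarrow> (\<Sum>l\<in>N. b l * U l j) < 0"
    unfolding K_def U_def by (rule X.stable_vectors[of y0]) (use y0 row col in auto)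
  have offs: "0 \<le> T l k" "0 \<le> T k l" if "l \<in> N" "k \<in> P" for l k
    using that set_facts(1) by (auto intro!: T_off)
  have K_off: "0 \<le> K i k" if "i \<in> P" "k \<in> P" "i \<noteq> k" for i k
    unfolding K_def using that X.e X.f y0 T_off offs
    by (intro add_nonneg_nonneg sum_nonneg mult_nonneg_nonneg) auto
  have U_off: "0 \<le> U l j" if "l \<in> N" "j \<in> N" "l \<noteq> j" for l j
    unfolding U_def lin_def using that X.s y0 T_off offs
    by (intro add_nonneg_nonneg sum_nonneg mult_nonneg_nonneg) auto
  obtain H where H: "\<And>i j. i \<in> P \<Longrightarrow> j \<in> N \<Longrightarrow> (0::real) < H i j"
    "\<And>i j. i \<in> P \<Longrightarrow> j \<in> N \<Longrightarrow> dric P N e0 f0 s0 T y0 H i j < 0"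
    by (rule singular_certificate[of P Pl Op N Om Mi s0 f0 v0 e0 T y0 a b])
       (use set_facts a b Ka bU K_off U_off v0_pos in \<open>auto simp: s0_def f0_def K_def U_def\<close>)
  have K0: "(\<Sum>k\<in>Op. (e0 i * A' i k + (\<Sum>l\<in>Om. y0 i l * v0 l * A' l k)) * a k) < 0" if i: "i \<in> Op" for i
  proof -
    have "(\<Sum>l\<in>N. f0 i l * y0 i l * T l k) = (\<Sum>l\<in>Om. y0 i l * v0 l * A' l k)" if "k \<in> Op" for k
    proof -
      have "(\<Sum>l\<in>N. f0 i l * y0 i l * T l k) = (\<Sum>l\<in>Om. f0 i l * y0 i l * T l k)"
        using i by (intro sum.mono_neutral_right) (auto simp: f0_def)
      also have "\<dots> = (\<Sum>l\<in>Om. y0 i l * v0 l * A' l k)"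
        using i that set_facts by (intro sum.cong) (auto simp: f0_def T_def)
      finally show ?thesis .
    qed
    then have "K i k = e0 i * A' i k + (\<Sum>l\<in>Om. y0 i l * v0 l * A' l k)" if "k \<in> Op" for k
      using that i by (simp add: K_def T_def Op_def)
    moreover have "(\<Sum>k\<in>P. K i k * a k) = (\<Sum>k\<in>Pl. K i k * a k) + (\<Sum>k\<in>Op. K i k * a k)"
      using set_facts by (intro sum.union_disjoint) auto
    moreover have "0 \<le> (\<Sum>k\<in>Pl. K i k * a k)"
      using a i by (intro sum_nonneg mult_nonneg_nonneg K_off) (auto simp: less_imp_le dest: set_disjoint)
    ultimately show ?thesis using Ka[of i] i by simp
  qed
  have U0: "(\<Sum>l\<in>Om. b l / v0 l * (v0 l * (A' l j + (\<Sum>k\<in>Op. A' l k * y0 k j)))) < 0" if j: "j \<in> Om" for j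
  proof -
    have "lin P s0 T y0 l j = (\<Sum>k\<in>Op. A' l k * y0 k j)" if "l \<in> Om" for l
    proof -
      have "lin P s0 T y0 l j = (\<Sum>k\<in>Op. T l k * (s0 k j * y0 k j))"
        unfolding lin_def using j by (intro sum.mono_neutral_right) (auto simp: s0_def)
      also have "\<dots> = (\<Sum>k\<in>Op. A' l k * y0 k j)"
        using j that set_facts by (intro sum.cong) (auto simp: s0_def T_def)
      finally show ?thesis .
    qed
    then have "b l * U l j = b l / v0 l * (v0 l * (A' l j + (\<Sum>k\<in>Op. A' l k * y0 k j)))" if "l \<in> Om" for l
      using that j v0_pos[of l] by (simp add: U_def T_def Om_def)
    moreover have "(\<Sum>l\<in>N. b l * U l j) = (\<Sum>l\<in>Om. b l * U l j) + (\<Sum>l\<in>Mi. b l * U l j)"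
      using set_facts by (intro sum.union_disjoint) auto
    moreover have "0 \<le> (\<Sum>l\<in>Mi. b l * U l j)"
      using b j by (intro sum_nonneg mult_nonneg_nonneg U_off) (auto simp: less_imp_le dest: set_disjoint)
    ultimately show ?thesis using bU[of j] j by simp
  qed
  have Z: "(\<Sum>j\<in>Ze. A' i j * h j) < 0" if "i \<in> Ze" for i
  proof -
    have "(\<Sum>j\<in>Ze. A' i j * h j) = (\<Sum>j\<in>Ze. T i j * h j)"
      using that by (intro sum.cong) (auto simp: T_def Ze_def)
    also have "\<dots> \<le> (\<Sum>j\<in>UNIV. T i j * h j)"
    proof (rule sum_mono2)
      fix b assume "b \<in> UNIV - Ze"
      then have "i \<noteq> b" using that by auto
      then show "0 \<le> T i b * h b" using T_off h by (simp add: less_imp_le)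
    qed auto
    finally show ?thesis using Th[of i] by linarith
  qed
  have "\<exists>h. (\<forall>i\<in>Ze. 0 < h i) \<and> (\<forall>i\<in>Ze. (\<Sum>j\<in>Ze. A' i j * h j) < 0)"
    using Z h by blast
  moreover have "0 < b l / v0 l" if "l \<in> Om" for l using b v0_pos that by simp
  moreover have "ric P N e0 f0 s0 A' y0 i j = 0" "dric P N e0 f0 s0 A' y0 H i j < 0"
    if "i \<in> P" "j \<in> N" for i j
    using y0 H ric_T that by metis+
  ultimately show ?thesis
    using that[of y0 H a "\<lambda>l. b l / v0 l"] y0 H(1) a K0 U0 by blast
qed

end

section \<open>Minimality of the analytic branch\<close>

text \<open>
  Convergence and value of a series at a point in one predicate, so that identities between
  series can be evaluated by structural rules.
\<close>

definition evs :: "real \<Rightarrow> real fps \<Rightarrow> real \<Rightarrow> bool" where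
  "evs \<epsilon> f x \<longleftrightarrow> ereal (norm \<epsilon>) < fps_conv_radius f \<and> eval_fps f \<epsilon> = x"

lemma evs_add: "evs \<epsilon> f x \<Longrightarrow> evs \<epsilon> g y \<Longrightarrow> evs \<epsilon> (f + g) (x + y)"
  unfolding evs_def using fps_conv_radius_add[of f g] by (auto simp: eval_fps_add elim!: order_less_le_trans[rotated])

lemma evs_mult: "evs \<epsilon> f x \<Longrightarrow> evs \<epsilon> g y \<Longrightarrow> evs \<epsilon> (f * g) (x * y)"
  unfolding evs_def using fps_conv_radius_mult[of f g] by (auto simp: eval_fps_mult elim!: order_less_le_trans[rotated])

lemma evs_const: "evs \<epsilon> (fps_const x) x"
  by (simp add: evs_def)

lemma evs_X: "evs \<epsilon> fps_X \<epsilon>"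
  by (simp add: evs_def)

lemma evs_one: "evs \<epsilon> 1 1"
  by (simp add: evs_def)

lemma evs_zero: "evs \<epsilon> 0 0"
  by (simp add: evs_def)

lemma evs_sum: "(\<And>q. q \<in> S \<Longrightarrow> evs \<epsilon> (f q) (x q)) \<Longrightarrow> evs \<epsilon> (\<Sum>q\<in>S. f q) (\<Sum>q\<in>S. x q)"
  by (induction S rule: infinite_finite_induct) (auto simp: evs_zero intro!: evs_add)

lemma evs_inverse:
  assumes "evs \<epsilon> f x" "ereal (norm \<epsilon>) < fps_conv_radius (inverse f)" "fps_nth f 0 \<noteq> 0"
  shows "evs \<epsilon> (inverse f) (1 / x)"
proof -
  have "evs \<epsilon> (f * inverse f) (x * eval_fps (inverse f) \<epsilon>)"
    using assms by (intro evs_mult) (auto simp: evs_def)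
  moreover have "f * inverse f = 1" using assms(3) by (metis inverse_mult_eq_1 mult.commute)
  ultimately have "x * eval_fps (inverse f) \<epsilon> = 1" by (simp add: evs_def)
  then have "eval_fps (inverse f) \<epsilon> = 1 / x"
    by (metis mult_zero_left nonzero_mult_div_cancel_left zero_neq_one)
  then show ?thesis using assms(2) by (simp add: evs_def)
qed

lemma evs_sums: "evs \<epsilon> f x \<Longrightarrow> (\<lambda>n. fps_nth f n * \<epsilon> ^ n) sums x"
  unfolding evs_def using sums_eval_fps[of \<epsilon> f] by auto

lemma evs_lin:
  assumes "\<And>i. i \<in> P \<Longrightarrow> evs \<epsilon> (s i j) (s' i j)" "\<And>i. i \<in> P \<Longrightarrow> evs \<epsilon> (Y i j) (Y' i j)"
  shows "evs \<epsilon> (lin P s (\<lambda>i j. fps_const (A i j)) Y l j) (lin P s' A Y' l j)"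
  unfolding lin_def by (intro evs_sum evs_mult evs_const assms)

lemma evs_ric:
  assumes "evs \<epsilon> (e i) (e' i)" "\<And>l. l \<in> N \<Longrightarrow> evs \<epsilon> (f i l) (f' i l)"
    "\<And>k. k \<in> P \<Longrightarrow> evs \<epsilon> (s k j) (s' k j)"
    "\<And>k. k \<in> P \<Longrightarrow> evs \<epsilon> (Y k j) (Y' k j)" "\<And>l. l \<in> N \<Longrightarrow> evs \<epsilon> (Y i l) (Y' i l)"
  shows "evs \<epsilon> (ric P N e f s (\<lambda>i j. fps_const (A i j)) Y i j) (ric P N e' f' s' A Y' i j)"
  unfolding ric_def by (intro evs_sum evs_mult evs_add evs_const evs_lin assms)

lemma eventually_in_radius:
  assumes "0 < R"
  shows "\<forall>\<^sub>F \<epsilon> in at_right (0::real). ereal (norm \<epsilon>) < R"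
proof -
  obtain t where t: "0 < ereal t" "ereal t < R" using ereal_dense2[OF assms] by blast
  have "\<forall>\<^sub>F \<epsilon> in at_right 0. \<epsilon> \<in> {0<..<t}" by (rule eventually_at_right_real) (use t in auto)
  then show ?thesis
  proof eventually_elim
    case (elim \<epsilon>)
    then have "ereal (norm \<epsilon>) < ereal t" by simp
    then show ?case using t(2) by (rule less_trans)
  qed
qed

lemma eventually_evs: "0 < fps_conv_radius f \<Longrightarrow> \<forall>\<^sub>F \<epsilon> in at_right 0. evs \<epsilon> f (eval_fps f \<epsilon>)"
  using eventually_in_radius[of "fps_conv_radius f"] by (simp add: evs_def)

lemma tendsto_eval_fps:
  assumes "0 < fps_conv_radius (f :: real fps)"
  shows "((\<lambda>\<epsilon>. eval_fps f \<epsilon>) \<longlongrightarrow> fps_nth f 0) (at_right 0)"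
proof -
  have "continuous (at 0 within {0<..}) (eval_fps f)"
    by (rule continuous_eval_fps) (use assms in \<open>auto simp: zero_ereal_def\<close>)
  then show ?thesis by (simp add: continuous_within eval_fps_at_0)
qed

lemma eventually_ball2:
  assumes "\<And>i j. i \<in> (S::'s::finite set) \<Longrightarrow> j \<in> (R::'s set) \<Longrightarrow> eventually (Q i j) F"
  shows "eventually (\<lambda>x. \<forall>i\<in>S. \<forall>j\<in>R. Q i j x) F"
  by (intro eventually_ball_finite ballI assms finite)

text \<open>
  By Taylor expansion \<open>E \<eta> = y + \<eta> H\<close> is a strict supersolution of the limit equation
  for small \<open>\<eta>\<close>, and \<open>H\<close> is still a certificate at \<open>E \<eta>\<close>. With \<open>\<eta>\<close> fixed, both
  strict inequalities and the bound \<open>\<bar>Y\<bar> < E \<eta>\<close> persist for small \<open>\<epsilon>\<close>,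
  and a solution below a certified supersolution is the least one.
\<close>

lemma branch_is_least:
  fixes e :: "'s::finite \<Rightarrow> real fps" and f s Y :: "'s \<Rightarrow> 's \<Rightarrow> real fps" and A :: "'s \<Rightarrow> 's \<Rightarrow> real"
  assumes rad: "\<And>i. 0 < fps_conv_radius (e i)" "\<And>i l. 0 < fps_conv_radius (f i l)"
      "\<And>k j. 0 < fps_conv_radius (s k j)" "\<And>i j. 0 < fps_conv_radius (Y i j)"
    and data: "\<forall>\<^sub>F \<epsilon> in at_right 0. riccati_data P N (\<lambda>i. eval_fps (e i) \<epsilon>)
      (\<lambda>i l. eval_fps (f i l) \<epsilon>) (\<lambda>k j. eval_fps (s k j) \<epsilon>) A"
    and ric: "\<And>i j. i \<in> P \<Longrightarrow> j \<in> N \<Longrightarrow> ric P N e f s (\<lambda>i j. fps_const (A i j)) Y i j = 0"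
    and Y0: "\<And>i j. i \<in> P \<Longrightarrow> j \<in> N \<Longrightarrow> 0 \<le> fps_nth (Y i j) 0"
    and H: "\<And>i j. i \<in> P \<Longrightarrow> j \<in> N \<Longrightarrow> 0 < H i j"
    and cert: "\<And>i j. i \<in> P \<Longrightarrow> j \<in> N \<Longrightarrow> dric P N (\<lambda>i. fps_nth (e i) 0) (\<lambda>i l. fps_nth (f i l) 0)
      (\<lambda>k j. fps_nth (s k j) 0) A (\<lambda>i j. fps_nth (Y i j) 0) H i j < 0"
  shows "\<forall>\<^sub>F \<epsilon> in at_right 0.
     (\<forall>i\<in>P. \<forall>j\<in>N. 0 \<le> eval_fps (Y i j) \<epsilon> \<and> ric P N (\<lambda>i. eval_fps (e i) \<epsilon>)
       (\<lambda>i l. eval_fps (f i l) \<epsilon>) (\<lambda>k j. eval_fps (s k j) \<epsilon>) A (\<lambda>i j. eval_fps (Y i j) \<epsilon>) i j = 0) \<and>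
     (\<forall>Z. (\<forall>i\<in>P. \<forall>j\<in>N. 0 \<le> Z i j \<and> ric P N (\<lambda>i. eval_fps (e i) \<epsilon>)
       (\<lambda>i l. eval_fps (f i l) \<epsilon>) (\<lambda>k j. eval_fps (s k j) \<epsilon>) A Z i j = 0) \<longrightarrow>
       (\<forall>i\<in>P. \<forall>j\<in>N. eval_fps (Y i j) \<epsilon> \<le> Z i j))"
proof -
  let ?ez = "\<lambda>i. fps_nth (e i) 0" and ?fz = "\<lambda>i l. fps_nth (f i l) 0" and ?sz = "\<lambda>k j. fps_nth (s k j) 0"
  let ?y = "\<lambda>i j. fps_nth (Y i j) 0"
  let ?e = "\<lambda>\<epsilon> i. eval_fps (e i) \<epsilon>" and ?f = "\<lambda>\<epsilon> i l. eval_fps (f i l) \<epsilon>" and ?s = "\<lambda>\<epsilon> k j. eval_fps (s k j) \<epsilon>"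
  let ?Y = "\<lambda>\<epsilon> i j. eval_fps (Y i j) \<epsilon>"
  have ric0: "ric P N ?ez ?fz ?sz A ?y i j = 0" if ij: "i \<in> P" "j \<in> N" for i j
  proof -
    have "fps_nth (ric P N e f s (\<lambda>i j. fps_const (A i j)) Y i j) 0 = ric P N ?ez ?fz ?sz A ?y i j"
      by (simp add: ric_def lin_def fps_sum_nth)
    then show ?thesis using ric[OF ij] by simp
  qed
  define E where "E \<eta> i j = ?y i j + \<eta> * H i j" for \<eta> i j
  have "\<forall>\<^sub>F \<eta> in at_right 0. 0 < \<eta> \<and> (\<forall>i\<in>P. \<forall>j\<in>N. ric P N ?ez ?fz ?sz A (E \<eta>) i j < 0) \<and>
      (\<forall>i\<in>P. \<forall>j\<in>N. dric P N ?ez ?fz ?sz A (E \<eta>) H i j < 0)"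
  proof (intro eventually_conj eventually_at_right_less eventually_ball2)
    fix i j assume ij: "i \<in> P" "j \<in> N"
    show "\<forall>\<^sub>F \<eta> in at_right 0. dric P N ?ez ?fz ?sz A (E \<eta>) H i j < 0"
      unfolding E_def dric_add_scale using small_perturbation_negative[OF cert[OF ij]]
      by (simp add: add.commute)
    let ?q = "\<Sum>l\<in>N. ?fz i l * H i l * lin P ?sz A H l j"
    have "\<forall>\<^sub>F \<eta> in at_right 0. 0 < \<eta> \<and> \<eta> * ?q + dric P N ?ez ?fz ?sz A ?y H i j < 0"
      by (intro eventually_conj eventually_at_right_less small_perturbation_negative cert ij)
    then show "\<forall>\<^sub>F \<eta> in at_right 0. ric P N ?ez ?fz ?sz A (E \<eta>) i j < 0"
    proof eventually_elim
      case (elim \<eta>)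
      have "ric P N ?ez ?fz ?sz A (E \<eta>) i j = \<eta> * (\<eta> * ?q + dric P N ?ez ?fz ?sz A ?y H i j)"
        unfolding E_def ric_add_scale ric0[OF ij] by (simp add: algebra_simps)
      then show ?case using elim mult_pos_neg[of \<eta>] by simp
    qed
  qed
  then obtain \<eta> where \<eta>: "0 < \<eta>" "\<And>i j. i \<in> P \<Longrightarrow> j \<in> N \<Longrightarrow> ric P N ?ez ?fz ?sz A (E \<eta>) i j < 0"
      "\<And>i j. i \<in> P \<Longrightarrow> j \<in> N \<Longrightarrow> dric P N ?ez ?fz ?sz A (E \<eta>) H i j < 0"
    using eventually_happens'[OF trivial_limit_at_right_real] by blast
  note lims = tendsto_eval_fps[OF rad(1)] tendsto_eval_fps[OF rad(2)] tendsto_eval_fps[OF rad(3)]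
  have ev1: "\<forall>\<^sub>F \<epsilon> in at_right 0. \<forall>i\<in>P. \<forall>j\<in>N. ric P N (?e \<epsilon>) (?f \<epsilon>) (?s \<epsilon>) A (E \<eta>) i j < 0"
  proof (rule eventually_ball2)
    fix i j assume ij: "i \<in> P" "j \<in> N"
    have "((\<lambda>\<epsilon>. ric P N (?e \<epsilon>) (?f \<epsilon>) (?s \<epsilon>) A (E \<eta>) i j)
       \<longlongrightarrow> ric P N ?ez ?fz ?sz A (E \<eta>) i j) (at_right 0)"
      unfolding ric_def lin_def by (intro tendsto_intros lims)
    then show "\<forall>\<^sub>F \<epsilon> in at_right 0. ric P N (?e \<epsilon>) (?f \<epsilon>) (?s \<epsilon>) A (E \<eta>) i j < 0"
      by (rule order_tendstoD(2)) (rule \<eta>(2)[OF ij])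
  qed
  have ev2: "\<forall>\<^sub>F \<epsilon> in at_right 0. \<forall>i\<in>P. \<forall>j\<in>N. dric P N (?e \<epsilon>) (?f \<epsilon>) (?s \<epsilon>) A (E \<eta>) H i j < 0"
  proof (rule eventually_ball2)
    fix i j assume ij: "i \<in> P" "j \<in> N"
    have "((\<lambda>\<epsilon>. dric P N (?e \<epsilon>) (?f \<epsilon>) (?s \<epsilon>) A (E \<eta>) H i j)
       \<longlongrightarrow> dric P N ?ez ?fz ?sz A (E \<eta>) H i j) (at_right 0)"
      unfolding dric_def lin_def by (intro tendsto_intros lims)
    then show "\<forall>\<^sub>F \<epsilon> in at_right 0. dric P N (?e \<epsilon>) (?f \<epsilon>) (?s \<epsilon>) A (E \<eta>) H i j < 0"
      by (rule order_tendstoD(2)) (rule \<eta>(3)[OF ij])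
  qed
  have ev3: "\<forall>\<^sub>F \<epsilon> in at_right 0. \<forall>i\<in>P. \<forall>j\<in>N. \<bar>?Y \<epsilon> i j\<bar> < E \<eta> i j"
  proof (rule eventually_ball2)
    fix i j assume ij: "i \<in> P" "j \<in> N"
    have "((\<lambda>\<epsilon>. \<bar>?Y \<epsilon> i j\<bar>) \<longlongrightarrow> \<bar>?y i j\<bar>) (at_right 0)"
      by (intro tendsto_rabs tendsto_eval_fps rad)
    then show "\<forall>\<^sub>F \<epsilon> in at_right 0. \<bar>?Y \<epsilon> i j\<bar> < E \<eta> i j"
      by (rule order_tendstoD(2)) (use Y0[OF ij] H[OF ij] \<eta>(1) in \<open>simp add: E_def\<close>)
  qed
  have ev4: "\<forall>\<^sub>F \<epsilon> in at_right 0. \<forall>i\<in>P. \<forall>j\<in>N. ric P N (?e \<epsilon>) (?f \<epsilon>) (?s \<epsilon>) A (?Y \<epsilon>) i j = 0"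
  proof -
    have 1: "\<forall>\<^sub>F \<epsilon> in at_right 0. \<forall>i\<in>UNIV. \<forall>j\<in>UNIV. evs \<epsilon> (e i) (?e \<epsilon> i) \<and> evs \<epsilon> (f i j) (?f \<epsilon> i j) \<and>
        evs \<epsilon> (s i j) (?s \<epsilon> i j) \<and> evs \<epsilon> (Y i j) (?Y \<epsilon> i j)"
      by (intro eventually_ball2 eventually_conj eventually_evs rad)
    then show ?thesis
    proof eventually_elim
      case (elim \<epsilon>)
      then have ev: "evs \<epsilon> (ric P N e f s (\<lambda>i j. fps_const (A i j)) Y i j)
          (ric P N (?e \<epsilon>) (?f \<epsilon>) (?s \<epsilon>) A (?Y \<epsilon>) i j)" for i j
        by (intro evs_ric) auto
      have "ric P N (?e \<epsilon>) (?f \<epsilon>) (?s \<epsilon>) A (?Y \<epsilon>) i j = 0" if "i \<in> P" "j \<in> N" for i j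
        using ev[of i j] ric[OF that] by (simp add: evs_def)
      then show ?case by blast
    qed
  qed
  from data ev1 ev2 ev3 ev4 show ?thesis
  proof eventually_elim
    case (elim \<epsilon>)
    interpret R: riccati_data P N "?e \<epsilon>" "?f \<epsilon>" "?s \<epsilon>" A by (rule elim(1))
    have E: "0 \<le> E \<eta> i j \<and> R.Ric (E \<eta>) i j \<le> 0" if "i \<in> P" "j \<in> N" for i j
      using elim(2) Y0[OF that] H[OF that] \<eta>(1) that by (auto simp: E_def less_imp_le)
    have cert': "R.DRic (E \<eta>) H i j < 0" if "i \<in> P" "j \<in> N" for i j
      using elim(3) that by blast
    have X: "\<bar>?Y \<epsilon> i j\<bar> \<le> E \<eta> i j \<and> R.Ric (?Y \<epsilon>) i j = 0" if "i \<in> P" "j \<in> N" for i j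
      using elim(4,5) that by (auto simp: less_imp_le)
    note L = R.certified_solution_least[of "E \<eta>" H "?Y \<epsilon>", OF E H cert' X]
    show ?case
    proof (intro conjI ballI allI impI)
      fix i j assume "i \<in> P" "j \<in> N"
      then show "0 \<le> ?Y \<epsilon> i j" "R.Ric (?Y \<epsilon>) i j = 0" using L(1) X by blast+
    next
      fix Z i j assume "\<forall>i\<in>P. \<forall>j\<in>N. 0 \<le> Z i j \<and> R.Ric Z i j = 0" "i \<in> P" "j \<in> N"
      then show "?Y \<epsilon> i j \<le> Z i j" using L(2)[of Z i j] by auto
    qed
  qed
qed

section \<open>Block matrices of full size\<close>

lemma blk_nth: "(M\<langle>I, J\<rangle>) $ i $ j = (if i \<in> I \<and> j \<in> J then M $ i $ j else 0)"
  by (simp add: blk_def)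

lemma blk_eq_iff: "M = M\<langle>I, J\<rangle> \<longleftrightarrow> (\<forall>i j. i \<notin> I \<or> j \<notin> J \<longrightarrow> M $ i $ j = 0)"
  by (auto simp: vec_eq_iff blk_nth)

lemma blk_supportD: "M = M\<langle>I, J\<rangle> \<Longrightarrow> i \<notin> I \<or> j \<notin> J \<Longrightarrow> M $ i $ j = 0"
  unfolding blk_eq_iff by blast

lemma mult_nth: "((M :: real ^ 's ^ 's) ** N) $ i $ j = (\<Sum>k\<in>UNIV. M $ i $ k * N $ k $ j)"
  by (simp add: matrix_matrix_mult_def)

lemma mult_nth_left:
  fixes M X :: "real ^ 's::finite ^ 's"
  assumes "M = M\<langle>I, J\<rangle>"
  shows "(M ** X) $ i $ j = (\<Sum>k\<in>J. M $ i $ k * X $ k $ j)"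
  unfolding mult_nth using blk_supportD[OF assms] by (intro sum.mono_neutral_right) auto

lemma mult_nth_right:
  fixes M X :: "real ^ 's::finite ^ 's"
  assumes "M = M\<langle>I, J\<rangle>"
  shows "(X ** M) $ i $ j = (\<Sum>k\<in>I. X $ i $ k * M $ k $ j)"
  unfolding mult_nth using blk_supportD[OF assms] by (intro sum.mono_neutral_right) auto

lemma blk_idem: "M\<langle>I, J\<rangle> = (M\<langle>I, J\<rangle>)\<langle>I, J\<rangle>"
  by (simp add: vec_eq_iff blk_nth)

lemma mult_blk_left_nth:
  fixes M X :: "real ^ 's::finite ^ 's"
  shows "(M\<langle>I, J\<rangle> ** X) $ i $ j = (if i \<in> I then \<Sum>k\<in>J. M $ i $ k * X $ k $ j else 0)"
  unfolding mult_nth_left[OF blk_idem] by (simp add: blk_nth)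

lemma mult_blk_right_nth:
  fixes M X :: "real ^ 's::finite ^ 's"
  shows "(X ** M\<langle>I, J\<rangle>) $ i $ j = (if j \<in> J then \<Sum>k\<in>I. X $ i $ k * M $ k $ j else 0)"
  unfolding mult_nth_right[OF blk_idem] by (simp add: blk_nth)

lemma diag_mult_nth: "(diag_mat d ** M) $ i $ j = d i * (M :: real ^ 's::finite ^ 's) $ i $ j"
  by (simp add: mult_nth diag_mat_def if_distrib[of "\<lambda>x. x * _"] cong: if_cong)

lemma mult_diag_nth: "((M :: real ^ 's::finite ^ 's) ** diag_mat d) $ i $ j = M $ i $ j * d j"
  by (simp add: mult_nth diag_mat_def if_distrib[of "\<lambda>x. _ * x"] cong: if_cong)

lemma diag_nth: "diag_mat d $ i $ j = (if i = j then d i else 0)"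
  by (simp add: diag_mat_def)

lemma matrix_minus_left: "(- A) ** B = - ((A :: real ^ 's::finite ^ 's) ** B)"
  by (simp add: vec_eq_iff mult_nth sum_negf)

lemma matrix_minus_right: "A ** (- B) = - ((A :: real ^ 's::finite ^ 's) ** B)"
  by (simp add: vec_eq_iff mult_nth sum_negf)

lemma matrix_diff_left: "(A - B) ** C = (A :: real ^ 's::finite ^ 's) ** C - B ** C"
  by (simp add: vec_eq_iff mult_nth sum_subtractf left_diff_distrib)

lemma matrix_diff_right: "A ** (B - C) = (A :: real ^ 's::finite ^ 's) ** B - A ** C"
  by (simp add: vec_eq_iff mult_nth sum_subtractf right_diff_distrib)

lemma matrix_add_left: "(A + B) ** C = (A :: real ^ 's::finite ^ 's) ** C + B ** C"
  by (simp add: vec_eq_iff mult_nth sum.distrib distrib_right)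

lemmas matrix_ring = matrix_add_ldistrib matrix_add_left matrix_minus_left matrix_minus_right
  matrix_diff_left matrix_diff_right matrix_mul_assoc[symmetric]

lemma blk_one_left:
  fixes M :: "real ^ 's::finite ^ 's"
  assumes "M = M\<langle>I, J\<rangle>"
  shows "(mat 1)\<langle>I, I\<rangle> ** M = M"
proof -
  have "M $ i $ j = 0" if "i \<notin> I" for i j using blk_supportD[OF assms] that by blast
  then show ?thesis
    by (simp add: vec_eq_iff mult_blk_left_nth mat_def if_distrib[of "\<lambda>x. x * _"] cong: if_cong)
qed

lemma blk_one_right:
  fixes M :: "real ^ 's::finite ^ 's"
  assumes "M = M\<langle>I, J\<rangle>"
  shows "M ** (mat 1)\<langle>J, J\<rangle> = M"
proof -
  have "M $ i $ j = 0" if "j \<notin> J" for i j using blk_supportD[OF assms] that by blast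
  then show ?thesis
    by (simp add: vec_eq_iff mult_blk_right_nth mat_def if_distrib[of "\<lambda>x. _ * x"] cong: if_cong)
qed

text \<open>
  The unit matrix of the block acts as identity on both inverses because they are supported in
  the block.
\<close>

lemma blk_inv_eqI:
  assumes N: "is_blk_inverse I M N"
  shows "blk_inv I M = N"
  unfolding blk_inv_def
proof (rule the_equality)
  show "is_blk_inverse I M N" by (rule N)
next
  fix N' assume N': "is_blk_inverse I M N'"
  have s: "N = N\<langle>I, I\<rangle>" "N' = N'\<langle>I, I\<rangle>" using N N' unfolding is_blk_inverse_def by blast+
  have "N' = N' ** (M ** N)"
    using N blk_one_right[OF s(2)] unfolding is_blk_inverse_def by metis
  also have "\<dots> = (N' ** M) ** N" by (simp add: matrix_mul_assoc)
  also have "\<dots> = N"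
    using N' blk_one_left[OF s(1)] unfolding is_blk_inverse_def by metis
  finally show "N' = N" .
qed

lemma blk_inv_props:
  assumes "blk_invertible I M"
  shows "blk_inv I M = (blk_inv I M)\<langle>I, I\<rangle>" "M ** blk_inv I M = (mat 1)\<langle>I, I\<rangle>"
    "blk_inv I M ** M = (mat 1)\<langle>I, I\<rangle>"
proof -
  have "is_blk_inverse I M (blk_inv I M)"
    using assms blk_inv_eqI unfolding blk_invertible_def by metis
  then show "blk_inv I M = (blk_inv I M)\<langle>I, I\<rangle>" "M ** blk_inv I M = (mat 1)\<langle>I, I\<rangle>"
    "blk_inv I M ** M = (mat 1)\<langle>I, I\<rangle>" unfolding is_blk_inverse_def by blast+
qed

lemma right_divide:
  assumes "blk_invertible J M" "X = X\<langle>I, J\<rangle>" "X ** M = R"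
  shows "X = R ** blk_inv J M"
  using blk_inv_props(2)[OF assms(1)] blk_one_right[OF assms(2)] assms(3) by (metis matrix_mul_assoc)

lemma left_divide:
  assumes "blk_invertible I M" "X = X\<langle>I, J\<rangle>" "M ** X = R"
  shows "X = blk_inv I M ** R"
  using blk_inv_props(3)[OF assms(1)] blk_one_left[OF assms(2)] assms(3) by (metis matrix_mul_assoc)

lemma nonneg_mult:
  fixes M N :: "real ^ 's::finite ^ 's"
  assumes "0 \<le> M" "0 \<le> N"
  shows "0 \<le> M ** N"
  using assms by (auto simp: less_eq_vec_def mult_nth intro!: sum_nonneg)

lemma blk_nonneg: "0 \<le> M \<Longrightarrow> 0 \<le> M\<langle>I, J\<rangle>"
  by (simp add: less_eq_vec_def blk_nth)

lemma blk_diff: "X = X\<langle>I, J\<rangle> \<Longrightarrow> Z = Z\<langle>I, J\<rangle> \<Longrightarrow> X - Z = (X - Z)\<langle>I, J\<rangle>"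
  for X Z :: "real ^ 's ^ 's"
  unfolding blk_eq_iff by auto

lemma left_solution:
  assumes M: "blk_invertible I M" and R: "R = R\<langle>I, J\<rangle>"
  shows "blk_inv I M ** R = (blk_inv I M ** R)\<langle>I, J\<rangle>" and "M ** (blk_inv I M ** R) = R"
proof -
  note s = blk_inv_props(1)[OF M]
  have "(blk_inv I M ** R) $ i $ j = 0" if "i \<notin> I \<or> j \<notin> J" for i j
    unfolding mult_nth_left[OF s] using that blk_supportD[OF R, of _ j] blk_supportD[OF s, of i]
    by (intro sum.neutral) auto
  then show "blk_inv I M ** R = (blk_inv I M ** R)\<langle>I, J\<rangle>" unfolding blk_eq_iff by blast
  show "M ** (blk_inv I M ** R) = R"
    unfolding matrix_mul_assoc blk_inv_props(2)[OF M] by (rule blk_one_left[OF R])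
qed

lemma right_solution:
  assumes M: "blk_invertible J M" and R: "R = R\<langle>I, J\<rangle>"
  shows "R ** blk_inv J M = (R ** blk_inv J M)\<langle>I, J\<rangle>" and "(R ** blk_inv J M) ** M = R"
proof -
  note s = blk_inv_props(1)[OF M]
  have "(R ** blk_inv J M) $ i $ j = 0" if "i \<notin> I \<or> j \<notin> J" for i j
    unfolding mult_nth_left[OF R] using that blk_supportD[OF R, of i] blk_supportD[OF s, of _ j]
    by (intro sum.neutral) auto
  then show "R ** blk_inv J M = (R ** blk_inv J M)\<langle>I, J\<rangle>" unfolding blk_eq_iff by blast
  show "(R ** blk_inv J M) ** M = R"
    unfolding matrix_mul_assoc[symmetric] blk_inv_props(3)[OF M] by (rule blk_one_right[OF R])
qed

lemma diag_blk_inv: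
  assumes "\<And>i. i \<in> I \<Longrightarrow> d i \<noteq> 0"
  shows "blk_inv I ((diag_mat d)\<langle>I, I\<rangle>) = diag_mat (\<lambda>i. if i \<in> I then 1 / d i else 0)"
  by (rule blk_inv_eqI)
     (use assms in \<open>auto simp: is_blk_inverse_def vec_eq_iff blk_nth mult_diag_nth diag_mult_nth diag_nth mat_def\<close>)

lemma diag_blk: "(diag_mat d)\<langle>I, I\<rangle> = diag_mat (\<lambda>i. if i \<in> I then d i else 0)"
  by (simp add: vec_eq_iff blk_nth diag_nth)

lemma abs_diag_mat: "\<bar>diag_mat d\<bar> = diag_mat (\<lambda>i. \<bar>d i\<bar>)"
  by (simp add: vec_eq_iff abs_vec_def diag_mat_def)

lemma abs_diag_blk: "\<bar>(diag_mat d)\<langle>I, I\<rangle>\<bar> = (diag_mat (\<lambda>i. \<bar>d i\<bar>))\<langle>I, I\<rangle>"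
  by (simp add: vec_eq_iff abs_vec_def blk_nth diag_nth)

lemma metzler_blk_invertible:
  fixes M :: "real ^ 's::finite ^ 's"
  assumes supp: "M = M\<langle>I, I\<rangle>" and off: "\<And>i j. i \<in> I \<Longrightarrow> j \<in> I \<Longrightarrow> i \<noteq> j \<Longrightarrow> 0 \<le> M $ i $ j"
    and h: "\<And>i. i \<in> I \<Longrightarrow> 0 < h i" "\<And>i. i \<in> I \<Longrightarrow> (\<Sum>j\<in>I. M $ i $ j * h j) < 0"
  shows "blk_invertible I (- M)" and "0 \<le> blk_inv I (- M)"
proof -
  obtain B where B: "\<And>i j. i \<in> I \<Longrightarrow> j \<in> I \<Longrightarrow> (0::real) \<le> B i j"
    "\<And>i j. i \<in> I \<Longrightarrow> j \<in> I \<Longrightarrow> (\<Sum>k\<in>I. M $ i $ k * B k j) = (if i = j then - 1 else 0)"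
    "\<And>i j. i \<in> I \<Longrightarrow> j \<in> I \<Longrightarrow> (\<Sum>k\<in>I. B i k * M $ k $ j) = (if i = j then - 1 else 0)"
    by (rule metzler_inverse[of I "\<lambda>i j. M $ i $ j" h]) (use off h that in auto)
  define R :: "real ^ 's ^ 's" where "R = (\<chi> i j. if i \<in> I \<and> j \<in> I then B i j else 0)"
  have Rs: "R = R\<langle>I, I\<rangle>" by (simp add: R_def vec_eq_iff blk_nth)
  have ms: "- M = (- M)\<langle>I, I\<rangle>" using supp unfolding blk_eq_iff by simp
  have "is_blk_inverse I (- M) R"
    unfolding is_blk_inverse_def
  proof (intro conjI)
    show "R = R\<langle>I, I\<rangle>" by (rule Rs)
    have "(\<Sum>k\<in>I. (- M) $ i $ k * R $ k $ j) = (mat 1 :: real ^ 's ^ 's)\<langle>I, I\<rangle> $ i $ j" for i j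
      using B(2)[of i j] blk_supportD[OF supp, of i]
      by (auto simp: R_def blk_nth mat_def sum_negf)
    then show "- M ** R = (mat 1)\<langle>I, I\<rangle>" by (simp add: vec_eq_iff mult_nth_left[OF ms])
    have "(\<Sum>k\<in>I. R $ i $ k * (- M) $ k $ j) = (mat 1 :: real ^ 's ^ 's)\<langle>I, I\<rangle> $ i $ j" for i j
      using B(3)[of i j] blk_supportD[OF supp, of _ j]
      by (auto simp: R_def blk_nth mat_def sum_negf)
    then show "R ** - M = (mat 1)\<langle>I, I\<rangle>" by (simp add: vec_eq_iff mult_nth_right[OF ms])
  qed
  moreover from this have "blk_inv I (- M) = R" by (rule blk_inv_eqI)
  moreover have "0 \<le> R" using B(1) by (auto simp: R_def less_eq_vec_def)
  ultimately show "blk_invertible I (- M)" "0 \<le> blk_inv I (- M)"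
    unfolding blk_invertible_def by auto
qed

abbreviation one2 :: "'s \<Rightarrow> 's \<Rightarrow> real" where "one2 \<equiv> \<lambda>_ _. 1"

text \<open>
  The bridge between the block matrix equation and the entrywise map \<open>ric\<close>.
\<close>

lemma riccati_nth:
  fixes X T :: "real ^ 's::finite ^ 's"
  assumes dP: "\<And>i. i \<in> P \<Longrightarrow> d i \<noteq> 0" and dN: "\<And>i. i \<in> N \<Longrightarrow> d i \<noteq> 0" and X: "X = X\<langle>P, N\<rangle>"
  shows "riccati P N T (diag_mat d) X $ i $ j = (if i \<in> P \<and> j \<in> N then
     ric P N (\<lambda>i. 1 / d i) (\<lambda>_ l. 1 / \<bar>d l\<bar>) one2 (\<lambda>i j. T $ i $ j) (\<lambda>i j. X $ i $ j) i j else 0)"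
proof -
  have inv: "blk_inv P ((diag_mat d)\<langle>P, P\<rangle>) = diag_mat (\<lambda>i. if i \<in> P then 1 / d i else 0)"
    "blk_inv N \<bar>(diag_mat d)\<langle>N, N\<rangle>\<bar> = diag_mat (\<lambda>i. if i \<in> N then 1 / \<bar>d i\<bar> else 0)"
    unfolding abs_diag_blk by (rule diag_blk_inv, simp add: dP dN)+
  have L: "(T\<langle>I, N\<rangle> + T\<langle>I, P\<rangle> ** X) $ l $ j
      = (if l \<in> I \<and> j \<in> N then T $ l $ j + lin P one2 (\<lambda>i j. T $ i $ j) (\<lambda>i j. X $ i $ j) l j else 0)"
    for I l j
  proof (cases "j \<in> N")
    case False
    then have "X $ k $ j = 0" for k using blk_supportD[OF X] by blast
    then show ?thesis using False by (simp add: blk_nth mult_blk_left_nth)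
  qed (simp add: blk_nth mult_blk_left_nth lin_def)
  have XD: "X ** diag_mat v = (X ** diag_mat v)\<langle>P, N\<rangle>" for v
    using X unfolding blk_eq_iff by (simp add: mult_diag_nth)
  have "riccati P N T (diag_mat d) X $ i $ j
    = (if i \<in> P then 1 / d i else 0) * (T\<langle>P, N\<rangle> + T\<langle>P, P\<rangle> ** X) $ i $ j
      + (\<Sum>l\<in>N. X $ i $ l * (if l \<in> N then 1 / \<bar>d l\<bar> else 0) * (T\<langle>N, N\<rangle> + T\<langle>N, P\<rangle> ** X) $ l $ j)"
    unfolding riccati_def inv vector_add_component mult_nth_left[OF XD] mult_diag_nth diag_mult_nth ..
  also have "(\<Sum>l\<in>N. X $ i $ l * (if l \<in> N then 1 / \<bar>d l\<bar> else 0) * (T\<langle>N, N\<rangle> + T\<langle>N, P\<rangle> ** X) $ l $ j)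
    = (\<Sum>l\<in>N. if i \<in> P \<and> j \<in> N then 1 / \<bar>d l\<bar> * X $ i $ l *
        (T $ l $ j + lin P one2 (\<lambda>i j. T $ i $ j) (\<lambda>i j. X $ i $ j) l j) else 0)"
    using blk_supportD[OF X] by (intro sum.cong) (auto simp: L mult.commute simp del: vector_add_component)
  finally show ?thesis
    unfolding L by (cases "i \<in> P"; cases "j \<in> N") (simp_all add: ric_def)
qed

lemma min_nonneg_solutionI:
  fixes X T :: "real ^ 's::finite ^ 's"
  defines "R \<equiv> \<lambda>d P N. ric P N (\<lambda>i. 1 / d i) (\<lambda>_ l. 1 / \<bar>d l\<bar>) one2 (\<lambda>i j. T $ i $ j)"
  assumes dP: "\<And>i. i \<in> P \<Longrightarrow> d i \<noteq> 0" and dN: "\<And>i. i \<in> N \<Longrightarrow> d i \<noteq> 0" and X: "X = X\<langle>P, N\<rangle>"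
    and sol: "\<And>i j. i \<in> P \<Longrightarrow> j \<in> N \<Longrightarrow> 0 \<le> X $ i $ j \<and> R d P N (\<lambda>i j. X $ i $ j) i j = 0"
    and least: "\<And>Y i j. (\<And>i j. i \<in> P \<Longrightarrow> j \<in> N \<Longrightarrow> 0 \<le> Y i j \<and> R d P N Y i j = 0) \<Longrightarrow>
      i \<in> P \<Longrightarrow> j \<in> N \<Longrightarrow> X $ i $ j \<le> Y i j"
  shows "min_nonneg_solution P N T (diag_mat d) X"
  unfolding min_nonneg_solution_def
proof (intro conjI allI impI)
  show "X = X\<langle>P, N\<rangle>" by (rule X)
  have out: "X $ i $ j = 0" if "i \<notin> P \<or> j \<notin> N" for i j by (rule blk_supportD[OF X that])
  have "0 \<le> X $ i $ j" for i j using sol[of i j] out[of i j] by (cases "i \<in> P \<and> j \<in> N") auto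
  then show "0 \<le> X" by (simp add: less_eq_vec_def)
  have rn: "riccati P N T (diag_mat d) Y $ i $ j = (if i \<in> P \<and> j \<in> N then R d P N (\<lambda>i j. Y $ i $ j) i j else 0)"
    if "Y = Y\<langle>P, N\<rangle>" for Y i j
    unfolding R_def by (rule riccati_nth[OF dP dN that])
  have "riccati P N T (diag_mat d) X $ i $ j = 0" for i j
    unfolding rn[OF X] using sol by simp
  then show "riccati P N T (diag_mat d) X = 0" by (simp add: vec_eq_iff)
  fix Y assume Y: "Y = Y\<langle>P, N\<rangle> \<and> 0 \<le> Y \<and> riccati P N T (diag_mat d) Y = 0"
  then have Ys: "Y = Y\<langle>P, N\<rangle>" and Y0: "\<And>i j. 0 \<le> Y $ i $ j"
    and Yr: "\<And>i j. riccati P N T (diag_mat d) Y $ i $ j = 0" by (simp_all add: less_eq_vec_def)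
  have "0 \<le> Y $ i $ j \<and> R d P N (\<lambda>i j. Y $ i $ j) i j = 0" if "i \<in> P" "j \<in> N" for i j
    using Y0 Yr[of i j] that unfolding rn[OF Ys] by simp
  then have "X $ i $ j \<le> Y $ i $ j" if "i \<in> P" "j \<in> N" for i j
    using least[of "\<lambda>i j. Y $ i $ j"] that by blast
  then have "X $ i $ j \<le> Y $ i $ j" for i j
    using out[of i j] Y0[of i j] by (cases "i \<in> P \<and> j \<in> N") auto
  then show "X \<le> Y" by (simp add: less_eq_vec_def)
qed

lemma first_return_eqI:
  assumes "min_nonneg_solution P N T D X"
  shows "first_return P N T D = X"
  unfolding first_return_def
proof (rule the_equality)
  show "min_nonneg_solution P N T D X" by (rule assms)
next
  fix Y assume "min_nonneg_solution P N T D Y"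
  then show "Y = X" using assms unfolding min_nonneg_solution_def by (blast intro: order_antisym)
qed

text \<open>
  Multiplying row \<open>i\<close> of the equation by \<open>r i\<close> and substituting \<open>s k l * Y k l\<close> for the unknown
  only changes the weights.
\<close>

lemma ric_rescale:
  "ric P N (\<lambda>i. r i / d i) (\<lambda>i l. r i * s i l / \<bar>d l\<bar>) s A Y i j
     = r i * ric P N (\<lambda>i. 1 / d i) (\<lambda>_ l. 1 / \<bar>d l\<bar>) one2 A (\<lambda>k l. s k l * Y k l) i j"
proof -
  have L: "lin P s A Y l j = lin P one2 A (\<lambda>k l. s k l * Y k l) l j" for l by (simp add: lin_def)
  have S: "(\<Sum>l\<in>N. r i * s i l / \<bar>d l\<bar> * Y i l * u l) = r i * (\<Sum>l\<in>N. 1 / \<bar>d l\<bar> * (s i l * Y i l) * u l)"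
    for u by (simp add: sum_distrib_left mult.assoc)
  show ?thesis unfolding ric_def L S by (simp only: distrib_left[of "r i"]) simp
qed

lemma ric_weights_cong:
  assumes "e i = e' i" "\<And>l. l \<in> N \<Longrightarrow> f i l = f' i l" "\<And>k. k \<in> P \<Longrightarrow> s k j = s' k j"
  shows "ric P N e f s A Y i j = ric P N e' f' s' A Y i j"
  unfolding ric_def lin_def using assms by simp

lemma sums_matrixI:
  assumes "\<And>i j. (\<lambda>n. (f n :: real ^ 'm::finite ^ 'n::finite) $ i $ j) sums (L $ i $ j)"
  shows "f sums L"
  using assms unfolding sums_def by (auto intro!: vec_tendstoI)

lemma matrix_norm_bigo:
  fixes f :: "'a \<Rightarrow> real ^ 'm::finite ^ 'n::finite"
  assumes "\<And>i j. (\<lambda>x. f x $ i $ j) \<in> O[F](g)"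
  shows "(\<lambda>x. norm (f x)) \<in> O[F](g)"
proof -
  have le: "norm M \<le> (\<Sum>i\<in>UNIV. \<Sum>j\<in>UNIV. norm (M $ i $ j))" for M :: "real ^ 'm ^ 'n"
    unfolding norm_vec_def
    by (rule order_trans[OF L2_set_le_sum])
       (auto intro!: sum_mono L2_set_le_sum simp: norm_vec_def)
  have "(\<lambda>x. \<Sum>i\<in>UNIV. \<Sum>j\<in>UNIV. norm (f x $ i $ j)) \<in> O[F](g)"
    using assms by (intro big_sum_in_bigo) auto
  moreover have "(\<lambda>x. norm (f x)) \<in> O[F](\<lambda>x. \<Sum>i\<in>UNIV. \<Sum>j\<in>UNIV. norm (f x $ i $ j))"
  proof (rule bigoI[of _ 1], rule always_eventually, rule allI)
    fix x
    show "norm (norm (f x)) \<le> 1 * norm (\<Sum>i\<in>UNIV. \<Sum>j\<in>UNIV. norm (f x $ i $ j))"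
      using order_trans[OF le[of "f x"] abs_ge_self] by simp
  qed
  ultimately show ?thesis by (rule landau_o.big_trans[rotated])
qed

lemma eval_fps_quadratic_remainder:
  assumes "0 < fps_conv_radius (f :: real fps)"
  shows "(\<lambda>\<epsilon>. eval_fps f \<epsilon> - (fps_nth f 0 + \<epsilon> * fps_nth f 1)) \<in> O[at_right 0](\<lambda>\<epsilon>. \<epsilon>\<^sup>2)"
proof -
  let ?g = "fps_shift 2 f"
  have f: "f = fps_const (fps_nth f 0) + fps_X * (fps_const (fps_nth f 1) + fps_X * ?g)"
  proof (rule fps_ext)
    fix n show "fps_nth f n = fps_nth (fps_const (fps_nth f 0) + fps_X * (fps_const (fps_nth f 1) + fps_X * ?g)) n"
      by (cases n; cases "n - 1") (auto simp: numeral_2_eq_2)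
  qed
  have rg: "0 < fps_conv_radius ?g" using assms by simp
  have "\<forall>\<^sub>F \<epsilon> in at_right 0. evs \<epsilon> ?g (eval_fps ?g \<epsilon>)" by (rule eventually_evs[OF rg])
  then have "\<forall>\<^sub>F \<epsilon> in at_right 0. eval_fps f \<epsilon> - (fps_nth f 0 + \<epsilon> * fps_nth f 1) = \<epsilon>\<^sup>2 * eval_fps ?g \<epsilon>"
  proof eventually_elim
    case (elim \<epsilon>)
    have "evs \<epsilon> (fps_const (fps_nth f 0) + fps_X * (fps_const (fps_nth f 1) + fps_X * ?g))
        (fps_nth f 0 + \<epsilon> * (fps_nth f 1 + \<epsilon> * eval_fps ?g \<epsilon>))"
      by (intro evs_add evs_mult evs_const evs_X elim)
    then have "eval_fps f \<epsilon> = fps_nth f 0 + \<epsilon> * (fps_nth f 1 + \<epsilon> * eval_fps ?g \<epsilon>)"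
      using f by (simp add: evs_def)
    then show ?case by (simp add: algebra_simps power2_eq_square)
  qed
  moreover have "(\<lambda>\<epsilon>. eval_fps ?g \<epsilon>) \<in> O[at_right 0](\<lambda>_. 1)"
    by (rule bigoI_tendsto[of _ _ "fps_nth ?g 0"]) (use tendsto_eval_fps[OF rg] in auto)
  then have "(\<lambda>\<epsilon>. \<epsilon>\<^sup>2 * eval_fps ?g \<epsilon>) \<in> O[at_right 0](\<lambda>\<epsilon>. \<epsilon>\<^sup>2 * 1)"
    by (intro landau_o.big.mult) auto
  ultimately show ?thesis by (subst landau_o.big.in_cong) simp_all
qed

section \<open>Expansion of the first return matrix\<close>

context fluid
begin

text \<open>
  The weights of the scaled equation as power series in \<open>\<epsilon>\<close>: reciprocals of the rates
  times the powers of \<open>\<epsilon>\<close> from the change of scale. The value zero for the remaining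
  phases of rate zero is a default.
\<close>

definition ef where "ef i = (if i \<in> Op then fps_const (1 / ct i) else if c i = 0 then 0
   else inverse (fps_const (c i) + fps_X * fps_const (ct i)))"
definition vf where "vf l = (if l \<in> Om then fps_const (1 / \<bar>ct l\<bar>) else if c l = 0 then 0
   else inverse (fps_const \<bar>c l\<bar> + fps_X * fps_const (sgn (c l) * ct l)))"
definition ff where "ff i l = (if i \<in> Op \<and> l \<in> Mi then fps_X else 1) * vf l"
definition sf :: "'s \<Rightarrow> 's \<Rightarrow> real fps" where "sf k j = (if k \<in> Pl \<and> j \<in> Om then fps_X else 1)"

lemma radius_pos: "0 < fps_conv_radius (ef i)" "0 < fps_conv_radius (vf l)"
  "0 < fps_conv_radius (ff i l)" "0 < fps_conv_radius (sf i l)"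
proof -
  have aff: "0 < fps_conv_radius (fps_const x + fps_X * fps_const y :: real fps)" for x y
    using fps_conv_radius_add[of "fps_const x" "fps_X * fps_const y :: real fps"]
      fps_conv_radius_mult[of fps_X "fps_const y :: real fps"]
    by (simp add: min_def)
  show "0 < fps_conv_radius (ef i)"
    unfolding ef_def by (auto intro!: fps_conv_radius_inverse_pos aff)
  show v: "0 < fps_conv_radius (vf l)"
    unfolding vf_def by (auto intro!: fps_conv_radius_inverse_pos aff)
  then show "0 < fps_conv_radius (ff i l)"
    using fps_conv_radius_mult[of fps_X "vf l"] unfolding ff_def by (auto intro: less_le_trans)
  show "0 < fps_conv_radius (sf i l)" by (simp add: sf_def)
qed

lemma coeff0: "fps_nth (ef i) 0 = e0 i" "fps_nth (vf l) 0 = v0 l" "fps_nth (ff i l) 0 = f0 i l"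
  "fps_nth (sf i l) 0 = s0 i l"
  by (auto simp: ef_def vf_def ff_def sf_def e0_def v0_def f0_def s0_def divide_inverse sets)

lemma inverse_affine_coeff1:
  fixes x y :: real
  assumes "x \<noteq> 0"
  shows "fps_nth (inverse (fps_const x + fps_X * fps_const y)) 1 = - y / x\<^sup>2"
proof -
  let ?f = "fps_const x + fps_X * fps_const y"
  have "inverse ?f * ?f = 1" by (rule inverse_mult_eq_1) (use assms in simp)
  then have "?f * inverse ?f = 1" by (simp only: mult.commute)
  then have "fps_nth (?f * inverse ?f) 1 = 0" by simp
  then have "x * fps_nth (inverse ?f) 1 + y * (1 / x) = 0"
    using assms by (simp add: fps_mult_nth_1 inverse_eq_divide)
  then show ?thesis using assms by (simp add: field_simps power2_eq_square)
qed

lemma coeff1: "i \<in> Pl \<Longrightarrow> fps_nth (ef i) 1 = - ct i / (c i)\<^sup>2" "i \<in> Op \<Longrightarrow> fps_nth (ef i) 1 = 0"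
  "l \<in> Mi \<Longrightarrow> fps_nth (vf l) 1 = ct l / (c l)\<^sup>2" "l \<in> Om \<Longrightarrow> fps_nth (vf l) 1 = 0"
proof -
  assume "i \<in> Pl"
  then have "ef i = inverse (fps_const (c i) + fps_X * fps_const (ct i))" "c i \<noteq> 0"
    by (auto simp: ef_def sets)
  then show "fps_nth (ef i) 1 = - ct i / (c i)\<^sup>2" using inverse_affine_coeff1[of "c i" "ct i"] by simp
next
  assume "l \<in> Mi"
  then have "vf l = inverse (fps_const (- c l) + fps_X * fps_const (- ct l))" "- c l \<noteq> 0"
    by (auto simp: vf_def sets)
  then have "fps_nth (vf l) 1 = - (- ct l) / (- c l)\<^sup>2"
    using inverse_affine_coeff1[of "- c l" "- ct l"] by simp
  then show "fps_nth (vf l) 1 = ct l / (c l)\<^sup>2" by simp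
qed (simp_all add: ef_def vf_def)

lemma eventually_weights:
  "\<forall>\<^sub>F \<epsilon> in at_right 0. 0 < \<epsilon> \<and> (\<forall>i\<in>Pl. 0 < c i + \<epsilon> * ct i) \<and> (\<forall>i\<in>Mi. c i + \<epsilon> * ct i < 0) \<and>
     (\<forall>i\<in>P. evs \<epsilon> (ef i) ((if i \<in> Op then \<epsilon> else 1) / (c i + \<epsilon> * ct i))) \<and>
     (\<forall>l\<in>N. evs \<epsilon> (vf l) ((if l \<in> Om then \<epsilon> else 1) / \<bar>c l + \<epsilon> * ct l\<bar>))"
proof -
  have 1: "\<forall>\<^sub>F \<epsilon> in at_right 0. \<forall>i\<in>Pl. \<epsilon> * (- ct i) + (- c i) < 0"
    by (intro eventually_ball_finite ballI small_perturbation_negative) (auto simp: sets)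
  have 2: "\<forall>\<^sub>F \<epsilon> in at_right 0. \<forall>i\<in>Mi. \<epsilon> * ct i + c i < 0"
    by (intro eventually_ball_finite ballI small_perturbation_negative) (auto simp: sets)
  have 3: "\<forall>\<^sub>F \<epsilon> in at_right (0::real). \<forall>i\<in>UNIV. ereal (norm \<epsilon>) < fps_conv_radius (ef i)"
    by (intro eventually_ball_finite ballI eventually_in_radius radius_pos) auto
  have 4: "\<forall>\<^sub>F \<epsilon> in at_right (0::real). \<forall>i\<in>UNIV. ereal (norm \<epsilon>) < fps_conv_radius (vf i)"
    by (intro eventually_ball_finite ballI eventually_in_radius radius_pos) auto
  from 1 2 3 4 eventually_at_right_less[of "0::real"] show ?thesis
  proof eventually_elim
    case (elim \<epsilon>)
    have affine: "evs \<epsilon> (fps_const x + fps_X * fps_const y) (x + \<epsilon> * y)" for x y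
      by (intro evs_add evs_mult evs_const evs_X)
    have "evs \<epsilon> (ef i) ((if i \<in> Op then \<epsilon> else 1) / (c i + \<epsilon> * ct i))" if "i \<in> P" for i
    proof (cases "i \<in> Op")
      case True
      then show ?thesis using elim(5) evs_const[of \<epsilon> "1 / ct i"] by (simp add: ef_def Op_def)
    next
      case False
      then have i: "i \<in> Pl" "c i \<noteq> 0" using that by (auto simp: Pl_def)
      have "evs \<epsilon> (inverse (fps_const (c i) + fps_X * fps_const (ct i))) (1 / (c i + \<epsilon> * ct i))"
        by (rule evs_inverse[OF affine]) (use i False elim(3) in \<open>auto simp: ef_def dest: spec[of _ i]\<close>)
      then show ?thesis using False i by (simp add: ef_def)
    qed
    moreover have "evs \<epsilon> (vf l) ((if l \<in> Om then \<epsilon> else 1) / \<bar>c l + \<epsilon> * ct l\<bar>)" if "l \<in> N" for l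
    proof (cases "l \<in> Om")
      case True
      then have "(if l \<in> Om then \<epsilon> else 1) / \<bar>c l + \<epsilon> * ct l\<bar> = 1 / \<bar>ct l\<bar>"
        using elim(5) by (simp add: Om_def abs_mult)
      then show ?thesis using True evs_const[of \<epsilon> "1 / \<bar>ct l\<bar>"] by (simp add: vf_def)
    next
      case False
      then have l: "l \<in> Mi" "c l < 0" using that by (auto simp: Mi_def)
      have "evs \<epsilon> (inverse (fps_const \<bar>c l\<bar> + fps_X * fps_const (sgn (c l) * ct l)))
          (1 / (\<bar>c l\<bar> + \<epsilon> * (sgn (c l) * ct l)))"
        by (rule evs_inverse[OF affine]) (use l False elim(4) in \<open>auto simp: vf_def dest: spec[of _ l]\<close>)
      moreover have "\<bar>c l\<bar> + \<epsilon> * (sgn (c l) * ct l) = \<bar>c l + \<epsilon> * ct l\<bar>"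
        using l elim(2) by (auto simp: add.commute)
      moreover have "vf l = inverse (fps_const \<bar>c l\<bar> + fps_X * fps_const (sgn (c l) * ct l))"
        using False l unfolding vf_def by (simp only: if_False) auto
      ultimately show ?thesis using False by (simp only: if_False)
    qed
    ultimately show ?case using elim(1,2,5) by (auto simp: add.commute)
  qed
qed

end

text \<open>
  \<open>Y\<close> is the solution of the scaled equation as a power series and \<open>H\<close> the certificate at its
  constant term; \<open>a\<close> and \<open>b\<close> certify the matrices \<open>K\<close> and \<open>U\<close> of the subsystem of the phases of
  rate zero.
\<close>

locale fluid_expansion = fluid A c ct \<xi>
  for A :: "real ^ 's ^ 's" and c ct :: "'s::finite \<Rightarrow> real" and \<xi> :: "real ^ 's" +
  fixes Y :: "'s \<Rightarrow> 's \<Rightarrow> real fps" and H :: "'s \<Rightarrow> 's \<Rightarrow> real" and a b :: "'s \<Rightarrow> real"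
  assumes Y_rad: "\<And>i j. 0 < fps_conv_radius (Y i j)"
    and Y_out: "\<And>i j. i \<notin> P \<or> j \<notin> N \<Longrightarrow> Y i j = 0"
    and Y_ric: "\<And>i j. i \<in> P \<Longrightarrow> j \<in> N \<Longrightarrow> ric P N ef ff sf (\<lambda>i j. fps_const (A' i j)) Y i j = 0"
    and Y_nonneg: "\<And>i j. i \<in> P \<Longrightarrow> j \<in> N \<Longrightarrow> 0 \<le> fps_nth (Y i j) 0"
    and H_pos: "\<And>i j. i \<in> P \<Longrightarrow> j \<in> N \<Longrightarrow> 0 < H i j"
    and cert: "\<And>i j. i \<in> P \<Longrightarrow> j \<in> N \<Longrightarrow> dric P N e0 f0 s0 A' (\<lambda>i j. fps_nth (Y i j) 0) H i j < 0"
    and a_pos: "\<And>i. i \<in> Op \<Longrightarrow> 0 < a i"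
    and Ka: "\<And>i. i \<in> Op \<Longrightarrow>
      (\<Sum>k\<in>Op. (e0 i * A' i k + (\<Sum>l\<in>Om. fps_nth (Y i l) 0 * v0 l * A' l k)) * a k) < 0"
    and b_pos: "\<And>l. l \<in> Om \<Longrightarrow> 0 < b l"
    and bU: "\<And>j. j \<in> Om \<Longrightarrow>
      (\<Sum>l\<in>Om. b l * (v0 l * (A' l j + (\<Sum>k\<in>Op. A' l k * fps_nth (Y k j) 0)))) < 0"
    and Ze_cert: "\<exists>h. (\<forall>i\<in>Ze. 0 < h i) \<and> (\<forall>i\<in>Ze. (\<Sum>j\<in>Ze. A' i j * h j) < 0)"

lemma (in fluid) expansion_exists: "\<exists>Y H a b. fluid_expansion A c ct \<xi> Y H a b"
proof -
  obtain y0 H a b where y0: "\<And>i j. i \<in> P \<Longrightarrow> j \<in> N \<Longrightarrow> 0 \<le> y0 i j"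
      "\<And>i j. i \<in> P \<Longrightarrow> j \<in> N \<Longrightarrow> ric P N e0 f0 s0 A' y0 i j = 0"
    and H: "\<And>i j. i \<in> P \<Longrightarrow> j \<in> N \<Longrightarrow> (0::real) < H i j"
      "\<And>i j. i \<in> P \<Longrightarrow> j \<in> N \<Longrightarrow> dric P N e0 f0 s0 A' y0 H i j < 0"
    and a: "\<And>i. i \<in> Op \<Longrightarrow> (0::real) < a i"
      "\<And>i. i \<in> Op \<Longrightarrow> (\<Sum>k\<in>Op. (e0 i * A' i k + (\<Sum>l\<in>Om. y0 i l * v0 l * A' l k)) * a k) < 0"
    and b: "\<And>l. l \<in> Om \<Longrightarrow> (0::real) < b l"
      "\<And>j. j \<in> Om \<Longrightarrow> (\<Sum>l\<in>Om. b l * (v0 l * (A' l j + (\<Sum>k\<in>Op. A' l k * y0 k j)))) < 0"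
    and Z: "\<exists>h. (\<forall>i\<in>Ze. 0 < h i) \<and> (\<forall>i\<in>Ze. (\<Sum>j\<in>Ze. A' i j * h j) < 0)"
    by (rule limit_exists) blast
  obtain Y where Y: "\<And>i j. 0 < fps_conv_radius (Y i j)" "\<And>i j. fps_nth (Y i j) 0 = y0 i j"
    "\<And>i j. i \<in> P \<Longrightarrow> j \<in> N \<Longrightarrow> ric P N ef ff sf (\<lambda>i j. fps_const (A' i j)) Y i j = 0"
    by (rule analytic_branch[of ef ff sf P N A' y0 H])
       (use radius_pos data0 y0 H in \<open>auto simp: coeff0\<close>)
  define Y' where "Y' i j = (if i \<in> P \<and> j \<in> N then Y i j else 0)" for i j
  have Y'_eq: "Y' i j = Y i j" if "i \<in> P" "j \<in> N" for i j using that by (simp add: Y'_def)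
  have d_eq: "dric P N e0 f0 s0 A' (\<lambda>i j. fps_nth (Y' i j) 0) H i j = dric P N e0 f0 s0 A' y0 H i j"
    if "i \<in> P" "j \<in> N" for i j
  proof -
    have "lin P s0 A' (\<lambda>i j. fps_nth (Y' i j) 0) l j = lin P s0 A' y0 l j" for l
      by (rule lin_cong) (use that Y Y'_eq in auto)
    then show ?thesis unfolding dric_def using that Y Y'_eq by simp
  qed
  have "fluid_expansion A c ct \<xi> Y' H a b"
  proof
    fix i j
    show "0 < fps_conv_radius (Y' i j)" using Y(1) by (simp add: Y'_def)
    show "i \<notin> P \<or> j \<notin> N \<Longrightarrow> Y' i j = 0" by (auto simp: Y'_def)
    assume ij: "i \<in> P" "j \<in> N"
    show "ric P N ef ff sf (\<lambda>i j. fps_const (A' i j)) Y' i j = 0"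
      using Y(3)[OF ij] ric_cong[OF ij, of Y' Y] Y'_eq by simp
    show "0 \<le> fps_nth (Y' i j) 0" using Y(2) y0(1)[OF ij] Y'_eq[OF ij] by simp
    show "0 < H i j" by (rule H(1)[OF ij])
    show "dric P N e0 f0 s0 A' (\<lambda>i j. fps_nth (Y' i j) 0) H i j < 0"
      unfolding d_eq[OF ij] by (rule H(2)[OF ij])
  next
    fix i assume i: "i \<in> Op"
    show "0 < a i" by (rule a(1)[OF i])
    have "fps_nth (Y' i l) 0 = y0 i l" if "l \<in> Om" for l using Y'_eq Y(2) that i by simp
    then show "(\<Sum>k\<in>Op. (e0 i * A' i k + (\<Sum>l\<in>Om. fps_nth (Y' i l) 0 * v0 l * A' l k)) * a k) < 0"
      using a(2)[OF i] by simp
  next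
    fix j assume j: "j \<in> Om"
    show "0 < b j" by (rule b(1)[OF j])
    have "fps_nth (Y' k j) 0 = y0 k j" if "k \<in> Op" for k using Y'_eq Y(2) that j by simp
    then show "(\<Sum>l\<in>Om. b l * (v0 l * (A' l j + (\<Sum>k\<in>Op. A' l k * fps_nth (Y' k j) 0)))) < 0"
      using b(2)[OF j] by simp
  qed (rule Z)
  then show ?thesis by blast
qed

context fluid_expansion
begin

text \<open>
  \<open>xf\<close> undoes the scaling of the unknown. The matrices \<open>U\<close> and \<open>K\<close> have a simple pole at zero,
  so \<open>Uf\<close> and \<open>Kf\<close> are the series of \<open>\<epsilon>\<close> times these matrices, with \<open>vt\<close> and \<open>et\<close> those
  of \<open>\<epsilon>\<close> times the reciprocal rates; hence the index shift in \<open>Uc\<close> and \<open>Kc\<close>.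
\<close>

definition y0 where "y0 i j = fps_nth (Y i j) 0"
definition xf where "xf i j = sf i j * Y i j"
definition X :: "real \<Rightarrow> real ^ 's ^ 's" where "X \<epsilon> = (\<chi> i j. eval_fps (xf i j) \<epsilon>)"
definition Pc :: "nat \<Rightarrow> real ^ 's ^ 's" where "Pc n = (\<chi> i j. fps_nth (xf i j) n)"
definition vt where "vt l = (if l \<in> Om then vf l else fps_X * vf l)"
definition et where "et i = (if i \<in> Op then ef i else fps_X * ef i)"
definition Uf where "Uf l j = (if l \<in> N \<and> j \<in> N then
   vt l * (fps_const (A' l j) + (\<Sum>k\<in>P. fps_const (A' l k) * xf k j)) else 0)"
definition Kf where "Kf i k = (if i \<in> P \<and> k \<in> P then
   et i * fps_const (A' i k) + (\<Sum>l\<in>N. xf i l * vt l * fps_const (A' l k)) else 0)"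
definition Uc :: "int \<Rightarrow> real ^ 's ^ 's" where "Uc z = (\<chi> i j. fps_nth (Uf i j) (nat (z + 1)))"
definition Kc :: "int \<Rightarrow> real ^ 's ^ 's" where "Kc z = (\<chi> i j. fps_nth (Kf i j) (nat (z + 1)))"

abbreviation "D \<epsilon> \<equiv> (diag_mat c + \<epsilon> *\<^sub>R diag_mat ct :: real ^ 's ^ 's)"

lemma D_eq: "D \<epsilon> = diag_mat (\<lambda>i. c i + \<epsilon> * ct i)"
  by (simp add: vec_eq_iff diag_nth)

lemma xf_out: "i \<notin> P \<or> j \<notin> N \<Longrightarrow> xf i j = 0"
  unfolding xf_def using Y_out by simp

lemma X_supp: "X \<epsilon> = (X \<epsilon>)\<langle>P, N\<rangle>" and Pc_supp: "Pc n = (Pc n)\<langle>P, N\<rangle>"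
  unfolding blk_eq_iff using xf_out by (auto simp: X_def Pc_def)

lemma xf_radius: "0 < fps_conv_radius (xf i j)"
proof -
  have "0 < min (fps_conv_radius (sf i j)) (fps_conv_radius (Y i j))"
    using radius_pos(4)[of i j] Y_rad[of i j] by simp
  also have "\<dots> \<le> fps_conv_radius (xf i j)" unfolding xf_def by (rule fps_conv_radius_mult)
  finally show ?thesis .
qed

text \<open>
  The scaling is by positive factors, hence monotone: it maps nonnegative solutions of the
  scaled equation to nonnegative solutions of the given one in both directions and preserves the
  order.
\<close>

lemma X_minimal: "\<forall>\<^sub>F \<epsilon> in at_right 0. min_nonneg_solution P N A (D \<epsilon>) (X \<epsilon>)"
proof -
  have s_ev: "eval_fps (sf k j) \<epsilon> = (if k \<in> Pl \<and> j \<in> Om then \<epsilon> else 1)" for k j \<epsilon>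
    by (simp add: sf_def)
  have data: "\<forall>\<^sub>F \<epsilon> in at_right 0. riccati_data P N (\<lambda>i. eval_fps (ef i) \<epsilon>)
      (\<lambda>i l. eval_fps (ff i l) \<epsilon>) (\<lambda>k j. eval_fps (sf k j) \<epsilon>) A'"
    using eventually_weights
  proof eventually_elim
    case (elim \<epsilon>)
    show ?case
    proof
      show "P \<inter> N = {}" by (rule set_facts)
      fix i assume i: "i \<in> P"
      have d: "0 < c i + \<epsilon> * ct i" using i elim by (auto simp: Op_def)
      have "eval_fps (ef i) \<epsilon> = (if i \<in> Op then \<epsilon> else 1) / (c i + \<epsilon> * ct i)"
        using elim i by (simp add: evs_def)
      then show "0 \<le> eval_fps (ef i) \<epsilon>" using d elim by simp
      fix l assume l: "l \<in> N"
      have v: "evs \<epsilon> (vf l) ((if l \<in> Om then \<epsilon> else 1) / \<bar>c l + \<epsilon> * ct l\<bar>)" using elim l by blast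
      have "evs \<epsilon> (ff i l) ((if i \<in> Op \<and> l \<in> Mi then \<epsilon> else 1) * ((if l \<in> Om then \<epsilon> else 1) / \<bar>c l + \<epsilon> * ct l\<bar>))"
        unfolding ff_def by (intro evs_mult v) (simp add: evs_X evs_one)
      then show "0 \<le> eval_fps (ff i l) \<epsilon>" using elim by (simp add: evs_def)
      show "0 \<le> eval_fps (sf i l) \<epsilon>" using elim by (simp add: s_ev)
    qed (rule A_off)
  qed
  have least: "\<forall>\<^sub>F \<epsilon> in at_right 0.
     (\<forall>i\<in>P. \<forall>j\<in>N. 0 \<le> eval_fps (Y i j) \<epsilon> \<and> ric P N (\<lambda>i. eval_fps (ef i) \<epsilon>)
       (\<lambda>i l. eval_fps (ff i l) \<epsilon>) (\<lambda>k j. eval_fps (sf k j) \<epsilon>) A' (\<lambda>i j. eval_fps (Y i j) \<epsilon>) i j = 0) \<and>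
     (\<forall>Z. (\<forall>i\<in>P. \<forall>j\<in>N. 0 \<le> Z i j \<and> ric P N (\<lambda>i. eval_fps (ef i) \<epsilon>)
       (\<lambda>i l. eval_fps (ff i l) \<epsilon>) (\<lambda>k j. eval_fps (sf k j) \<epsilon>) A' Z i j = 0) \<longrightarrow>
       (\<forall>i\<in>P. \<forall>j\<in>N. eval_fps (Y i j) \<epsilon> \<le> Z i j))"
    by (rule branch_is_least[OF radius_pos(1,3,4) Y_rad data Y_ric Y_nonneg H_pos])
       (use cert in \<open>auto simp: coeff0\<close>)
  have evY: "\<forall>\<^sub>F \<epsilon> in at_right 0. \<forall>i\<in>UNIV. \<forall>j\<in>UNIV. evs \<epsilon> (Y i j) (eval_fps (Y i j) \<epsilon>)"
    by (intro eventually_ball2 eventually_evs Y_rad)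
  from eventually_weights least evY show ?thesis
  proof eventually_elim
    case (elim \<epsilon>)
    define s where "s k j = (if k \<in> Pl \<and> j \<in> Om then \<epsilon> else 1)" for k j
    define r where "r i = (if i \<in> Op then \<epsilon> else 1)" for i
    define d where "d i = c i + \<epsilon> * ct i" for i
    have pos: "0 < \<epsilon>" and dp: "\<And>i. i \<in> P \<Longrightarrow> 0 < d i" and dn: "\<And>i. i \<in> N \<Longrightarrow> d i < 0"
      using elim(1) by (auto simp: d_def Op_def Om_def mult_pos_neg)
    have sr: "0 < s k j" "0 < r i" for k j i using pos by (auto simp: s_def r_def)
    have Xs: "X \<epsilon> $ i $ j = s i j * eval_fps (Y i j) \<epsilon>" for i j
    proof -
      have "evs \<epsilon> (xf i j) (s i j * eval_fps (Y i j) \<epsilon>)"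
        unfolding xf_def sf_def s_def using elim(3) by (intro evs_mult) (auto simp: evs_X evs_one)
      then show ?thesis by (simp add: X_def evs_def)
    qed
    have eq: "ric P N (\<lambda>i. eval_fps (ef i) \<epsilon>) (\<lambda>i l. eval_fps (ff i l) \<epsilon>) (\<lambda>k j. eval_fps (sf k j) \<epsilon>) A' Z i j
        = r i * ric P N (\<lambda>i. 1 / d i) (\<lambda>_ l. 1 / \<bar>d l\<bar>) one2 (\<lambda>i j. A $ i $ j) (\<lambda>k l. s k l * Z k l) i j"
      if ij: "i \<in> P" "j \<in> N" for Z i j
    proof -
      have "ric P N (\<lambda>i. eval_fps (ef i) \<epsilon>) (\<lambda>i l. eval_fps (ff i l) \<epsilon>) (\<lambda>k j. eval_fps (sf k j) \<epsilon>) A' Z i j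
          = ric P N (\<lambda>i. r i / d i) (\<lambda>i l. r i * s i l / \<bar>d l\<bar>) s A' Z i j"
      proof (rule ric_weights_cong)
        show "eval_fps (ef i) \<epsilon> = r i / d i"
          using elim(1) ij by (simp add: evs_def r_def d_def)
        show "eval_fps (sf k j) \<epsilon> = s k j" for k by (simp add: s_ev s_def)
        fix l assume l: "l \<in> N"
        have v: "evs \<epsilon> (vf l) ((if l \<in> Om then \<epsilon> else 1) / \<bar>d l\<bar>)"
          using elim(1) l unfolding d_def by blast
        have "evs \<epsilon> (ff i l) ((if i \<in> Op \<and> l \<in> Mi then \<epsilon> else 1) * ((if l \<in> Om then \<epsilon> else 1) / \<bar>d l\<bar>))"
          unfolding ff_def by (intro evs_mult v) (simp add: evs_X evs_one)
        then show "eval_fps (ff i l) \<epsilon> = r i * s i l / \<bar>d l\<bar>"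
          using ij l by (auto simp: evs_def r_def s_def dest: set_disjoint)
      qed
      then show ?thesis unfolding ric_rescale A'_def[abs_def] .
    qed
    show ?case
      unfolding D_eq d_def[symmetric]
    proof (rule min_nonneg_solutionI[OF _ _ X_supp])
      show "d i \<noteq> 0" if "i \<in> P" for i using dp[OF that] by simp
      show "d i \<noteq> 0" if "i \<in> N" for i using dn[OF that] by simp
      show "0 \<le> X \<epsilon> $ i $ j \<and> ric P N (\<lambda>i. 1 / d i) (\<lambda>_ l. 1 / \<bar>d l\<bar>) one2 (\<lambda>i j. A $ i $ j)
          (\<lambda>i j. X \<epsilon> $ i $ j) i j = 0" if ij: "i \<in> P" "j \<in> N" for i j
      proof
        have y: "0 \<le> eval_fps (Y i j) \<epsilon>" "ric P N (\<lambda>i. eval_fps (ef i) \<epsilon>)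
            (\<lambda>i l. eval_fps (ff i l) \<epsilon>) (\<lambda>k j. eval_fps (sf k j) \<epsilon>) A' (\<lambda>i j. eval_fps (Y i j) \<epsilon>) i j = 0"
          using elim(2) ij by blast+
        show "0 \<le> X \<epsilon> $ i $ j" unfolding Xs using y(1) sr(1)[of i j] by simp
        show "ric P N (\<lambda>i. 1 / d i) (\<lambda>_ l. 1 / \<bar>d l\<bar>) one2 (\<lambda>i j. A $ i $ j) (\<lambda>i j. X \<epsilon> $ i $ j) i j = 0"
          using y(2) sr(2)[of i] unfolding eq[OF ij] Xs by simp
      qed
      fix Z :: "'s \<Rightarrow> 's \<Rightarrow> real" and i j
      assume Z: "\<And>i j. i \<in> P \<Longrightarrow> j \<in> N \<Longrightarrow> 0 \<le> Z i j \<and> ric P N (\<lambda>i. 1 / d i) (\<lambda>_ l. 1 / \<bar>d l\<bar>) one2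
          (\<lambda>i j. A $ i $ j) Z i j = 0" and ij: "i \<in> P" "j \<in> N"
      define Z' where "Z' i j = Z i j / s i j" for i j
      have Z': "(\<lambda>k l. s k l * Z' k l) = Z"
        using sr(1) by (auto simp: Z'_def fun_eq_iff less_imp_neq[symmetric])
      have "\<forall>i\<in>P. \<forall>j\<in>N. 0 \<le> Z' i j \<and> ric P N (\<lambda>i. eval_fps (ef i) \<epsilon>)
         (\<lambda>i l. eval_fps (ff i l) \<epsilon>) (\<lambda>k j. eval_fps (sf k j) \<epsilon>) A' Z' i j = 0"
      proof (intro ballI conjI)
        fix i j assume ij: "i \<in> P" "j \<in> N"
        show "0 \<le> Z' i j" using Z[OF ij] sr(1)[of i j] by (simp add: Z'_def)
        show "ric P N (\<lambda>i. eval_fps (ef i) \<epsilon>) (\<lambda>i l. eval_fps (ff i l) \<epsilon>)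
            (\<lambda>k j. eval_fps (sf k j) \<epsilon>) A' Z' i j = 0"
          unfolding eq[OF ij] Z' using Z[OF ij] by simp
      qed
      then have "eval_fps (Y i j) \<epsilon> \<le> Z' i j" using elim(2) ij by blast
      then show "X \<epsilon> $ i $ j \<le> Z i j"
        unfolding Xs Z'_def using sr(1)[of i j] by (simp add: pos_le_divide_eq mult.commute)
    qed
  qed
qed

lemma scaled_sums:
  assumes "evs \<epsilon> f (\<epsilon> * x)" "\<epsilon> \<noteq> 0"
  shows "(\<lambda>n. \<epsilon> powi (int n - 1) * fps_nth f n) sums x"
proof -
  have "(\<lambda>n. 1 / \<epsilon> * (fps_nth f n * \<epsilon> ^ n)) sums (1 / \<epsilon> * (\<epsilon> * x))"
    by (intro sums_mult evs_sums assms)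
  moreover have "1 / \<epsilon> * (fps_nth f n * \<epsilon> ^ n) = \<epsilon> powi (int n - 1) * fps_nth f n" for n
    using assms(2) by (simp add: power_int_diff field_simps)
  ultimately show ?thesis using assms(2) by simp
qed

lemma eventually_sums: "\<forall>\<^sub>F \<epsilon> in at_right 0.
   (\<lambda>n. \<epsilon> ^ n *\<^sub>R Pc n) sums X \<epsilon> \<and>
   (\<lambda>n. (\<epsilon> powi (int n - 1)) *\<^sub>R Uc (int n - 1)) sums U_mat P N A (D \<epsilon>) (X \<epsilon>) \<and>
   (\<lambda>n. (\<epsilon> powi (int n - 1)) *\<^sub>R Kc (int n - 1)) sums K_mat P N A (D \<epsilon>) (X \<epsilon>)"
proof -
  have evx: "\<forall>\<^sub>F \<epsilon> in at_right 0. \<forall>i\<in>UNIV. \<forall>j\<in>UNIV. evs \<epsilon> (xf i j) (eval_fps (xf i j) \<epsilon>)"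
    by (intro eventually_ball2 eventually_evs xf_radius)
  from eventually_weights evx show ?thesis
  proof eventually_elim
    case (elim \<epsilon>)
    define d where "d i = c i + \<epsilon> * ct i" for i
    have pos: "0 < \<epsilon>" and dp: "\<And>i. i \<in> P \<Longrightarrow> d i \<noteq> 0" and dn: "\<And>i. i \<in> N \<Longrightarrow> d i \<noteq> 0"
      using elim(1) by (auto simp: d_def Op_def Om_def mult_pos_neg)
    have x: "evs \<epsilon> (xf i j) (X \<epsilon> $ i $ j)" for i j using elim(2) by (simp add: X_def)
    have v: "evs \<epsilon> (vt l) (\<epsilon> * (1 / \<bar>d l\<bar>))" if "l \<in> N" for l
    proof -
      have "evs \<epsilon> (vf l) ((if l \<in> Om then \<epsilon> else 1) / \<bar>d l\<bar>)" using elim(1) that unfolding d_def by blast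
      from this evs_mult[OF evs_X this] show ?thesis by (auto simp: vt_def split: if_splits)
    qed
    have e: "evs \<epsilon> (et i) (\<epsilon> * (1 / d i))" if "i \<in> P" for i
    proof -
      have "evs \<epsilon> (ef i) ((if i \<in> Op then \<epsilon> else 1) / d i)" using elim(1) that unfolding d_def by blast
      from this evs_mult[OF evs_X this] show ?thesis by (auto simp: et_def split: if_splits)
    qed
    have inv: "blk_inv P ((D \<epsilon>)\<langle>P, P\<rangle>) = diag_mat (\<lambda>i. if i \<in> P then 1 / d i else 0)"
      "blk_inv N \<bar>(D \<epsilon>)\<langle>N, N\<rangle>\<bar> = diag_mat (\<lambda>i. if i \<in> N then 1 / \<bar>d i\<bar> else 0)"
      unfolding D_eq d_def[symmetric] abs_diag_blk by (rule diag_blk_inv, simp add: dp dn)+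
    have Xout: "X \<epsilon> $ i $ j = 0" if "j \<notin> N \<or> i \<notin> P" for i j using blk_supportD[OF X_supp] that by blast
    have U: "U_mat P N A (D \<epsilon>) (X \<epsilon>) $ l $ j = (if l \<in> N \<and> j \<in> N then
        1 / \<bar>d l\<bar> * (A' l j + (\<Sum>k\<in>P. A' l k * X \<epsilon> $ k $ j)) else 0)" for l j
      unfolding U_mat_def inv diag_mult_nth vector_add_component mult_blk_left_nth
      using Xout by (simp add: blk_nth A'_def)
    have XD: "X \<epsilon> ** diag_mat w = (X \<epsilon> ** diag_mat w)\<langle>P, N\<rangle>" for w
      unfolding blk_eq_iff using Xout by (auto simp: mult_diag_nth)
    have K: "K_mat P N A (D \<epsilon>) (X \<epsilon>) $ i $ k = (if i \<in> P \<and> k \<in> P then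
        1 / d i * A' i k + (\<Sum>l\<in>N. X \<epsilon> $ i $ l * (1 / \<bar>d l\<bar>) * A' l k) else 0)" for i k
      unfolding K_mat_def inv diag_mult_nth vector_add_component mult_nth_left[OF XD] mult_diag_nth
      using Xout by (simp add: blk_nth A'_def)
    have evU: "evs \<epsilon> (Uf l j) (\<epsilon> * U_mat P N A (D \<epsilon>) (X \<epsilon>) $ l $ j)" for l j
    proof (cases "l \<in> N \<and> j \<in> N")
      case True
      then have "evs \<epsilon> (Uf l j) ((\<epsilon> * (1 / \<bar>d l\<bar>)) * (A' l j + (\<Sum>k\<in>P. A' l k * X \<epsilon> $ k $ j)))"
        unfolding Uf_def by (simp only: if_True simp_thms) (intro evs_mult evs_add evs_sum evs_const x v, simp)
      then show ?thesis using True unfolding U by (simp add: mult.assoc)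
    next
      case False
      then show ?thesis unfolding U Uf_def by (auto simp: evs_zero)
    qed
    have evK: "evs \<epsilon> (Kf i k) (\<epsilon> * K_mat P N A (D \<epsilon>) (X \<epsilon>) $ i $ k)" for i k
    proof (cases "i \<in> P \<and> k \<in> P")
      case True
      then have "evs \<epsilon> (Kf i k) ((\<epsilon> * (1 / d i)) * A' i k + (\<Sum>l\<in>N. X \<epsilon> $ i $ l * (\<epsilon> * (1 / \<bar>d l\<bar>)) * A' l k))"
        unfolding Kf_def
        by (simp only: if_True simp_thms) (intro evs_mult evs_add evs_sum evs_const x v e, simp_all)
      moreover have "(\<Sum>l\<in>N. X \<epsilon> $ i $ l * (\<epsilon> * (1 / \<bar>d l\<bar>)) * A' l k)
          = \<epsilon> * (\<Sum>l\<in>N. X \<epsilon> $ i $ l * (1 / \<bar>d l\<bar>) * A' l k)"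
        unfolding sum_distrib_left by (intro sum.cong) auto
      ultimately show ?thesis using True unfolding K by (simp add: distrib_left mult.assoc)
    next
      case False
      then show ?thesis unfolding K Kf_def by (auto simp: evs_zero)
    qed
    show ?case
    proof (intro conjI sums_matrixI)
      fix i j
      show "(\<lambda>n. (\<epsilon> ^ n *\<^sub>R Pc n) $ i $ j) sums (X \<epsilon> $ i $ j)"
        using evs_sums[OF x[of i j]] by (simp add: Pc_def mult.commute)
      show "(\<lambda>n. ((\<epsilon> powi (int n - 1)) *\<^sub>R Uc (int n - 1)) $ i $ j) sums (U_mat P N A (D \<epsilon>) (X \<epsilon>) $ i $ j)"
        using scaled_sums[OF evU[of i j]] pos by (simp add: Uc_def)
      show "(\<lambda>n. ((\<epsilon> powi (int n - 1)) *\<^sub>R Kc (int n - 1)) $ i $ j) sums (K_mat P N A (D \<epsilon>) (X \<epsilon>) $ i $ j)"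
        using scaled_sums[OF evK[of i j]] pos by (simp add: Kc_def)
    qed
  qed
qed

lemma X_bigo: "(\<lambda>\<epsilon>. norm (X \<epsilon> - (Pc 0 + \<epsilon> *\<^sub>R Pc 1))) \<in> O[at_right 0](\<lambda>\<epsilon>. \<epsilon>\<^sup>2)"
  by (rule matrix_norm_bigo) (use eval_fps_quadratic_remainder[OF xf_radius] in \<open>simp add: X_def Pc_def\<close>)

end

section \<open>Censoring the phases of rate zero\<close>

context fluid
begin

definition Cp :: "real ^ 's ^ 's" where "Cp = diag_mat (\<lambda>i. if i \<in> Pl then 1 / c i else 0)"
definition Cm :: "real ^ 's ^ 's" where "Cm = diag_mat (\<lambda>i. if i \<in> Mi then 1 / \<bar>c i\<bar> else 0)"
definition To :: "real ^ 's ^ 's" where "To = diag_mat (\<lambda>i. if i \<in> Op then 1 / ct i else 0)"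
definition Tom :: "real ^ 's ^ 's" where "Tom = diag_mat (\<lambda>i. if i \<in> Om then 1 / \<bar>ct i\<bar> else 0)"

lemma inverse_blocks:
  "blk_inv Pl ((diag_mat c)\<langle>Pl, Pl\<rangle>) = Cp" "\<bar>blk_inv Mi ((diag_mat c)\<langle>Mi, Mi\<rangle>)\<bar> = Cm"
  "blk_inv Op ((diag_mat ct)\<langle>Op, Op\<rangle>) = To" "\<bar>blk_inv Om ((diag_mat ct)\<langle>Om, Om\<rangle>)\<bar> = Tom"
  "blk_inv Mi \<bar>(diag_mat c)\<langle>Mi, Mi\<rangle>\<bar> = Cm"
  unfolding Cp_def Cm_def To_def Tom_def abs_diag_blk
  by (subst diag_blk_inv, auto simp: sets abs_diag_mat intro!: arg_cong[of _ _ diag_mat])+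

lemma disjoint_products:
  fixes M X :: "real ^ 's ^ 's"
  shows "To ** M\<langle>Om, J\<rangle> = 0" "Tom ** M\<langle>Op, J\<rangle> = 0"
  "To ** (M\<langle>Om, J\<rangle> ** X) = 0" "Tom ** (M\<langle>Op, J\<rangle> ** X) = 0"
  by (auto simp: vec_eq_iff To_def Tom_def diag_mult_nth blk_nth mult_blk_left_nth dest: set_disjoint)

lemma Ze_split: "M\<langle>Ze, J\<rangle> = M\<langle>Op, J\<rangle> + M\<langle>Om, J\<rangle>" "M\<langle>I, Ze\<rangle> = M\<langle>I, Op\<rangle> + M\<langle>I, Om\<rangle>"
  using set_facts(5) by (auto simp: vec_eq_iff blk_nth dest: set_disjoint)

text \<open>
  Candidates for the four blocks are assembled into one matrix by addition.
\<close>

lemma four_blocks: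
  fixes W Y Z V :: "real ^ 's ^ 's"
  assumes W: "W = W\<langle>Pl, Mi\<rangle>" and Y: "Y = Y\<langle>Op, Mi\<rangle>" and Z: "Z = Z\<langle>Pl, Om\<rangle>" and V: "V = V\<langle>Op, Om\<rangle>"
  shows "(W + Y + Z + V)\<langle>Pl, Mi\<rangle> = W" "(W + Y + Z + V)\<langle>Op, Mi\<rangle> = Y"
    "(W + Y + Z + V)\<langle>Pl, Om\<rangle> = Z" "(W + Y + Z + V)\<langle>Op, Om\<rangle> = V"
proof -
  let ?F = "W\<langle>Pl, Mi\<rangle> + Y\<langle>Op, Mi\<rangle> + Z\<langle>Pl, Om\<rangle> + V\<langle>Op, Om\<rangle>"
  have "?F\<langle>Pl, Mi\<rangle> = W\<langle>Pl, Mi\<rangle>" "?F\<langle>Op, Mi\<rangle> = Y\<langle>Op, Mi\<rangle>"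
    "?F\<langle>Pl, Om\<rangle> = Z\<langle>Pl, Om\<rangle>" "?F\<langle>Op, Om\<rangle> = V\<langle>Op, Om\<rangle>"
    by (auto simp: vec_eq_iff blk_nth dest: set_disjoint)
  then show "(W + Y + Z + V)\<langle>Pl, Mi\<rangle> = W" "(W + Y + Z + V)\<langle>Op, Mi\<rangle> = Y"
    "(W + Y + Z + V)\<langle>Pl, Om\<rangle> = Z" "(W + Y + Z + V)\<langle>Op, Om\<rangle> = V"
    unfolding assms[symmetric] .
qed

lemma censored_block:
  assumes "I \<subseteq> - Ze" "J \<subseteq> - Ze"
  shows "(censored Ze A)\<langle>I, J\<rangle> = A\<langle>I, J\<rangle> - A\<langle>I, Ze\<rangle> ** blk_inv Ze (A\<langle>Ze, Ze\<rangle>) ** A\<langle>Ze, J\<rangle>"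
proof -
  have 1: "(A\<langle>- Ze, - Ze\<rangle>)\<langle>I, J\<rangle> = A\<langle>I, J\<rangle>" using assms by (auto simp: vec_eq_iff blk_nth)
  have 2: "(A\<langle>- Ze, Ze\<rangle> ** R ** A\<langle>Ze, - Ze\<rangle>)\<langle>I, J\<rangle> = A\<langle>I, Ze\<rangle> ** R ** A\<langle>Ze, J\<rangle>" for R
    using assms by (auto simp: vec_eq_iff blk_nth mult_blk_left_nth mult_blk_right_nth)
  have 3: "(M + N)\<langle>I, J\<rangle> = M\<langle>I, J\<rangle> + N\<langle>I, J\<rangle>" for M N :: "real ^ 's ^ 's"
    by (simp add: vec_eq_iff blk_nth)
  show ?thesis unfolding censored_def 3 1 2 by (simp add: matrix_minus_left matrix_minus_right)
qed

lemma blk_minus: "(- M)\<langle>I, J\<rangle> = - (M\<langle>I, J\<rangle> :: real ^ 's ^ 's)"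
  by (simp add: vec_eq_iff blk_nth)

text \<open>
  Let \<open>V\<close>, \<open>Y\<close>, \<open>Z\<close>, \<open>W\<close> be candidates for the blocks of a solution of the limit equation, where
  \<open>Z\<close> is the scaled block at \<open>(Pl, Om)\<close>. If the equations of all blocks except \<open>(Pl, Mi)\<close> hold,
  then the residual of the last one is that of the censored equation for \<open>W\<close>. Indeed \<open>Np\<close> and
  \<open>Nm\<close> together are the rates into the phases of rate zero, seen from a row in \<open>Pl\<close>; the row
  vectors in \<open>\<kappa>\<close> solve \<open>\<kappa> A = - (Np + Nm)\<close> on the phases of rate zero, on the
  columns \<open>Op\<close> by the definition of \<open>L\<close> and on the columns \<open>Om\<close> by the equations for \<open>V\<close> and
  \<open>Z\<close>. So \<open>\<kappa>\<close> equals \<open>(Np + Nm) (- A)\<^sup>-\<^sup>1\<close> on these phases, the factor by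
  which censoring modifies the equation for \<open>W\<close>, and the equation for \<open>Y\<close> evaluates the product
  of \<open>\<kappa>\<close> with the transitions back.
\<close>

lemma censored_riccati:
  fixes V W Y Z :: "real ^ 's ^ 's"
  defines "K \<equiv> To ** A\<langle>Op, Op\<rangle> + V ** Tom ** A\<langle>Om, Op\<rangle>"
  assumes invK: "blk_invertible Op (- K)" and invZ: "blk_invertible Ze (A\<langle>Ze, Ze\<rangle>)"
    and Ws: "W = W\<langle>Pl, Mi\<rangle>" and Zs: "Z = Z\<langle>Pl, Om\<rangle>" and Vs: "V = V\<langle>Op, Om\<rangle>"
    and V: "To ** (A\<langle>Op, Om\<rangle> + A\<langle>Op, Op\<rangle> ** V) + V ** Tom ** (A\<langle>Om, Om\<rangle> + A\<langle>Om, Op\<rangle> ** V) = 0"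
    and Y: "To ** (A\<langle>Op, Mi\<rangle> + A\<langle>Op, Pl\<rangle> ** W + A\<langle>Op, Op\<rangle> ** Y)
      + V ** Tom ** (A\<langle>Om, Mi\<rangle> + A\<langle>Om, Pl\<rangle> ** W + A\<langle>Om, Op\<rangle> ** Y) = 0"
    and Z: "Cp ** (A\<langle>Pl, Om\<rangle> + A\<langle>Pl, Op\<rangle> ** V) + Z ** Tom ** (A\<langle>Om, Om\<rangle> + A\<langle>Om, Op\<rangle> ** V)
      + W ** Cm ** (A\<langle>Mi, Om\<rangle> + A\<langle>Mi, Op\<rangle> ** V) = 0"
  shows "riccati Pl Mi (censored Ze A) (diag_mat c) W
    = Cp ** (A\<langle>Pl, Mi\<rangle> + A\<langle>Pl, Pl\<rangle> ** W + A\<langle>Pl, Op\<rangle> ** Y)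
      + Z ** Tom ** (A\<langle>Om, Mi\<rangle> + A\<langle>Om, Pl\<rangle> ** W + A\<langle>Om, Op\<rangle> ** Y)
      + W ** Cm ** (A\<langle>Mi, Mi\<rangle> + A\<langle>Mi, Pl\<rangle> ** W + A\<langle>Mi, Op\<rangle> ** Y)"
proof -
  define R where "R = blk_inv Ze (A\<langle>Ze, Ze\<rangle>)"
  define Np where "Np = Cp ** A\<langle>Pl, Op\<rangle> + W ** Cm ** A\<langle>Mi, Op\<rangle>"
  define Nm where "Nm = Cp ** A\<langle>Pl, Om\<rangle> + W ** Cm ** A\<langle>Mi, Om\<rangle>"
  (* The part of the residual that multiplies Y on the left. *)
  define S where "S = Np + Z ** Tom ** A\<langle>Om, Op\<rangle>"
  define L where "L = S ** blk_inv Op (- K)"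
  define \<kappa> where "\<kappa> = L ** To + (Z + L ** V) ** Tom"
  have S_supp: "S = S\<langle>Pl, Op\<rangle>"
    using blk_supportD[OF Ws] blk_supportD[OF Zs]
    by (auto simp: S_def Np_def Cp_def vec_eq_iff blk_nth diag_mult_nth mult_blk_right_nth Cm_def Tom_def mult_diag_nth diag_nth)
  have LK: "L ** K = - S"
  proof -
    have "L ** (- K) = S ** (blk_inv Op (- K) ** (- K))" by (simp add: L_def matrix_mul_assoc)
    also have "\<dots> = S" unfolding blk_inv_props(3)[OF invK] by (rule blk_one_right[OF S_supp])
    finally show ?thesis by (simp add: matrix_minus_right equation_minus_iff)
  qed
  have KV: "To ** A\<langle>Op, Om\<rangle> + V ** Tom ** A\<langle>Om, Om\<rangle> = - (K ** V)"
  proof -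
    have "To ** A\<langle>Op, Om\<rangle> + V ** Tom ** A\<langle>Om, Om\<rangle> + K ** V = 0"
      using V by (simp add: K_def matrix_ring algebra_simps)
    then show ?thesis by (simp add: eq_neg_iff_add_eq_0)
  qed
  have KY: "To ** (A\<langle>Op, Mi\<rangle> + A\<langle>Op, Pl\<rangle> ** W) + V ** Tom ** (A\<langle>Om, Mi\<rangle> + A\<langle>Om, Pl\<rangle> ** W) = - (K ** Y)"
  proof -
    have "To ** (A\<langle>Op, Mi\<rangle> + A\<langle>Op, Pl\<rangle> ** W) + V ** Tom ** (A\<langle>Om, Mi\<rangle> + A\<langle>Om, Pl\<rangle> ** W) + K ** Y = 0"
      using Y by (simp add: K_def matrix_ring algebra_simps)
    then show ?thesis by (simp add: eq_neg_iff_add_eq_0)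
  qed
  have \<kappa>p: "\<kappa> ** A\<langle>Ze, Op\<rangle> = - Np"
  proof -
    have "\<kappa> ** A\<langle>Ze, Op\<rangle> = L ** K + Z ** Tom ** A\<langle>Om, Op\<rangle>"
      by (simp add: \<kappa>_def K_def Ze_split matrix_ring disjoint_products algebra_simps)
    then show ?thesis unfolding LK S_def by simp
  qed
  have \<kappa>m: "\<kappa> ** A\<langle>Ze, Om\<rangle> = - Nm"
  proof -
    have "\<kappa> ** A\<langle>Ze, Om\<rangle> = L ** (To ** A\<langle>Op, Om\<rangle> + V ** Tom ** A\<langle>Om, Om\<rangle>) + Z ** Tom ** A\<langle>Om, Om\<rangle>"
      by (simp add: \<kappa>_def Ze_split matrix_ring disjoint_products algebra_simps)
    also have "L ** (To ** A\<langle>Op, Om\<rangle> + V ** Tom ** A\<langle>Om, Om\<rangle>) = S ** V"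
      unfolding KV matrix_minus_right matrix_mul_assoc LK by (simp add: matrix_minus_left)
    finally have "\<kappa> ** A\<langle>Ze, Om\<rangle> + Nm = 0"
      using Z by (simp add: S_def Np_def Nm_def matrix_ring algebra_simps)
    then show ?thesis by (simp add: eq_neg_iff_add_eq_0)
  qed
  have "\<kappa> ** A\<langle>Ze, Ze\<rangle> = - (Np + Nm)"
    unfolding Ze_split(2) matrix_add_ldistrib \<kappa>p \<kappa>m by simp
  moreover have "\<kappa> = \<kappa>\<langle>Pl, Ze\<rangle>"
  proof -
    have "L $ i $ j = 0" if "i \<notin> Pl" for i j
    proof -
      have "L $ i $ j = (\<Sum>k\<in>Op. S $ i $ k * blk_inv Op (- K) $ k $ j)"
        unfolding L_def by (rule mult_nth_left[OF S_supp])
      then show ?thesis using that blk_supportD[OF S_supp] by simp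
    qed
    then have "(L ** V) $ i $ j = 0" if "i \<notin> Pl" for i j
      using that by (simp add: mult_nth)
    then show ?thesis
      unfolding blk_eq_iff using \<open>\<And>i j. i \<notin> Pl \<Longrightarrow> L $ i $ j = 0\<close> blk_supportD[OF Zs]
      by (auto simp: \<kappa>_def To_def Tom_def mult_diag_nth Ze_def Op_def Om_def)
  qed
  ultimately have \<kappa>: "\<kappa> = - (Np + Nm) ** R"
    unfolding R_def using right_divide[OF invZ] by blast
  have \<kappa>Y: "\<kappa> ** (A\<langle>Ze, Mi\<rangle> + A\<langle>Ze, Pl\<rangle> ** W)
      = S ** Y + Z ** Tom ** (A\<langle>Om, Mi\<rangle> + A\<langle>Om, Pl\<rangle> ** W)"
  proof -
    have "\<kappa> ** (A\<langle>Ze, Mi\<rangle> + A\<langle>Ze, Pl\<rangle> ** W)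
      = L ** (To ** (A\<langle>Op, Mi\<rangle> + A\<langle>Op, Pl\<rangle> ** W) + V ** Tom ** (A\<langle>Om, Mi\<rangle> + A\<langle>Om, Pl\<rangle> ** W))
        + Z ** Tom ** (A\<langle>Om, Mi\<rangle> + A\<langle>Om, Pl\<rangle> ** W)"
      by (simp add: \<kappa>_def Ze_split matrix_ring disjoint_products algebra_simps)
    also have "L ** (To ** (A\<langle>Op, Mi\<rangle> + A\<langle>Op, Pl\<rangle> ** W) + V ** Tom ** (A\<langle>Om, Mi\<rangle> + A\<langle>Om, Pl\<rangle> ** W)) = S ** Y"
      unfolding KY matrix_minus_right matrix_mul_assoc LK by (simp add: matrix_minus_left)
    finally show ?thesis .
  qed
  have sub: "Pl \<subseteq> - Ze" "Mi \<subseteq> - Ze" by (auto simp: sets)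
  have "riccati Pl Mi (censored Ze A) (diag_mat c) W
    = Cp ** (A\<langle>Pl, Mi\<rangle> + A\<langle>Pl, Pl\<rangle> ** W) + W ** Cm ** (A\<langle>Mi, Mi\<rangle> + A\<langle>Mi, Pl\<rangle> ** W)
      + (- (Np + Nm) ** R) ** (A\<langle>Ze, Mi\<rangle> + A\<langle>Ze, Pl\<rangle> ** W)"
    unfolding riccati_def inverse_blocks censored_block[OF sub(1) sub(1)] censored_block[OF sub(1) sub(2)]
      censored_block[OF sub(2) sub(1)] censored_block[OF sub(2) sub(2)] R_def[symmetric] Np_def Nm_def
    by (simp add: Ze_split matrix_ring algebra_simps)
  then show ?thesis
    unfolding \<kappa>[symmetric] \<kappa>Y by (simp add: S_def Np_def matrix_ring algebra_simps)
qed

end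

section \<open>The coefficient equations of orders zero and one\<close>

context fluid_expansion
begin

text \<open>
  The coefficients of \<open>A + A \<Psi>(\<epsilon>)\<close>, the common right factor in the Riccati
  equation.
\<close>

definition G :: "nat \<Rightarrow> real ^ 's ^ 's" where
  "G n = (\<chi> l j. (if n = 0 then A' l j else 0) + (\<Sum>k\<in>P. A' l k * Pc n $ k $ j))"

definition pf where "pf i l = ff i l * Y i l"
definition uf where "uf l j = fps_const (A' l j) + (\<Sum>k\<in>P. fps_const (A' l k) * xf k j)"

lemma uf_nth: "fps_nth (uf l j) n = G n $ l $ j"
  by (simp add: uf_def G_def Pc_def fps_sum_nth)

lemma ric_uf: "i \<in> P \<Longrightarrow> j \<in> N \<Longrightarrow> ef i * uf i j + (\<Sum>l\<in>N. pf i l * uf l j) = 0"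
  using Y_ric[of i j] by (simp add: ric_def lin_def uf_def pf_def xf_def)

text \<open>
  The coefficients of the left factor of the quadratic term. The scaling shows in the index: in
  the block \<open>(Pl, Om)\<close> order \<open>n\<close> of the scaled equation involves order \<open>n + 1\<close> of
  \<open>\<Psi>(\<epsilon>)\<close>, and in the block \<open>(Op, Mi)\<close> order \<open>n - 1\<close>.
\<close>

lemma pf_nth:
  "i \<in> Pl \<Longrightarrow> l \<in> Om \<Longrightarrow> fps_nth (pf i l) n = v0 l * Pc (Suc n) $ i $ l"
  "i \<in> Op \<Longrightarrow> l \<in> Om \<Longrightarrow> fps_nth (pf i l) n = v0 l * Pc n $ i $ l"
  "i \<in> Pl \<Longrightarrow> l \<in> Mi \<Longrightarrow> fps_nth (pf i l) 0 = v0 l * Pc 0 $ i $ l"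
  "i \<in> Pl \<Longrightarrow> l \<in> Mi \<Longrightarrow>
     fps_nth (pf i l) (Suc 0) = v0 l * Pc 1 $ i $ l + ct l / (c l)\<^sup>2 * Pc 0 $ i $ l"
  "i \<in> Op \<Longrightarrow> l \<in> Mi \<Longrightarrow> fps_nth (pf i l) 0 = 0"
  "i \<in> Op \<Longrightarrow> l \<in> Mi \<Longrightarrow> fps_nth (pf i l) (Suc 0) = v0 l * Pc 0 $ i $ l"
proof -
  have om: "vf l = fps_const (v0 l)" if "l \<in> Om" for l using that by (simp add: vf_def v0_def)
  note v1 = coeff1(3)[unfolded One_nat_def]
  show "i \<in> Pl \<Longrightarrow> l \<in> Om \<Longrightarrow> fps_nth (pf i l) n = v0 l * Pc (Suc n) $ i $ l"
    by (auto simp: pf_def ff_def om Pc_def xf_def sf_def dest: set_disjoint)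
  show "i \<in> Op \<Longrightarrow> l \<in> Om \<Longrightarrow> fps_nth (pf i l) n = v0 l * Pc n $ i $ l"
    by (auto simp: pf_def ff_def om Pc_def xf_def sf_def dest: set_disjoint)
  show "i \<in> Pl \<Longrightarrow> l \<in> Mi \<Longrightarrow> fps_nth (pf i l) 0 = v0 l * Pc 0 $ i $ l"
    by (auto simp: pf_def ff_def Pc_def xf_def sf_def coeff0 dest: set_disjoint)
  show "i \<in> Pl \<Longrightarrow> l \<in> Mi \<Longrightarrow>
     fps_nth (pf i l) (Suc 0) = v0 l * Pc 1 $ i $ l + ct l / (c l)\<^sup>2 * Pc 0 $ i $ l"
    by (auto simp: pf_def ff_def Pc_def xf_def sf_def coeff0 v1 fps_mult_nth_1 dest: set_disjoint)
  show "i \<in> Op \<Longrightarrow> l \<in> Mi \<Longrightarrow> fps_nth (pf i l) 0 = 0"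
    by (simp add: pf_def ff_def mult.assoc)
  show "i \<in> Op \<Longrightarrow> l \<in> Mi \<Longrightarrow> fps_nth (pf i l) (Suc 0) = v0 l * Pc 0 $ i $ l"
    by (auto simp: pf_def ff_def Pc_def xf_def sf_def coeff0 mult.assoc dest: set_disjoint)
qed

lemma sum_N: "(\<Sum>l\<in>N. q l) = (\<Sum>l\<in>Om. q l) + (\<Sum>l\<in>Mi. q l)" for q :: "'s \<Rightarrow> real"
  using set_facts by (intro sum.union_disjoint) auto

lemma sum_P: "(\<Sum>l\<in>P. q l) = (\<Sum>l\<in>Pl. q l) + (\<Sum>l\<in>Op. q l)" for q :: "'s \<Rightarrow> real"
  using set_facts by (intro sum.union_disjoint) auto

lemma order0:
  assumes "i \<in> P" "j \<in> N"
  shows "e0 i * G 0 $ i $ j + (\<Sum>l\<in>Om. fps_nth (pf i l) 0 * G 0 $ l $ j)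
    + (\<Sum>l\<in>Mi. fps_nth (pf i l) 0 * G 0 $ l $ j) = 0"
proof -
  have "fps_nth (ef i * uf i j + (\<Sum>l\<in>N. pf i l * uf l j)) 0 = 0"
    unfolding ric_uf[OF assms] by simp
  then show ?thesis by (simp add: fps_sum_nth uf_nth coeff0 sum_N)
qed

lemma order1:
  assumes "i \<in> P" "j \<in> N"
  shows "e0 i * G 1 $ i $ j + fps_nth (ef i) 1 * G 0 $ i $ j
    + (\<Sum>l\<in>Om. fps_nth (pf i l) 0 * G 1 $ l $ j + fps_nth (pf i l) 1 * G 0 $ l $ j)
    + (\<Sum>l\<in>Mi. fps_nth (pf i l) 0 * G 1 $ l $ j + fps_nth (pf i l) 1 * G 0 $ l $ j) = 0"
proof -
  have "fps_nth (ef i * uf i j + (\<Sum>l\<in>N. pf i l * uf l j)) 1 = 0"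
    unfolding ric_uf[OF assms] by simp
  then show ?thesis by (simp add: fps_sum_nth fps_mult_nth_1 uf_nth coeff0 sum_N)
qed

lemma blk_diag_blk_nth:
  fixes M X :: "real ^ 's ^ 's"
  shows "(X\<langle>I, K\<rangle> ** diag_mat w ** M\<langle>K, J\<rangle>) $ i $ j
    = (if i \<in> I \<and> j \<in> J then \<Sum>l\<in>K. w l * X $ i $ l * M $ l $ j else 0)"
  by (simp add: mult_blk_right_nth mult_diag_nth blk_nth mult.commute)

lemma e0_vals: "i \<in> Pl \<Longrightarrow> e0 i = 1 / c i" "i \<in> Op \<Longrightarrow> e0 i = 1 / ct i"
  by (auto simp: e0_def sets)

lemma v0_vals: "i \<in> Mi \<Longrightarrow> v0 i = 1 / \<bar>c i\<bar>" "i \<in> Om \<Longrightarrow> v0 i = 1 / \<bar>ct i\<bar>"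
  by (auto simp: v0_def sets)

lemma order0_Pl:
  assumes "J \<subseteq> N"
  shows "Cp ** (G 0)\<langle>Pl, J\<rangle> + (Pc 1)\<langle>Pl, Om\<rangle> ** Tom ** (G 0)\<langle>Om, J\<rangle>
    + (Pc 0)\<langle>Pl, Mi\<rangle> ** Cm ** (G 0)\<langle>Mi, J\<rangle> = 0"
proof -
  have "(Cp ** (G 0)\<langle>Pl, J\<rangle> + (Pc 1)\<langle>Pl, Om\<rangle> ** Tom ** (G 0)\<langle>Om, J\<rangle>
    + (Pc 0)\<langle>Pl, Mi\<rangle> ** Cm ** (G 0)\<langle>Mi, J\<rangle>) $ i $ j = 0" for i j
  proof (cases "i \<in> Pl \<and> j \<in> J")
    case True
    then have i: "i \<in> Pl" and ij: "i \<in> P" "j \<in> N" using assms by auto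
    show ?thesis
      using order0[OF ij] True
      by (simp add: Cp_def Cm_def Tom_def diag_mult_nth blk_diag_blk_nth blk_nth pf_nth(1,3)[OF i]
          e0_vals(1)[OF i] v0_vals)
  qed (auto simp: Cp_def Cm_def Tom_def diag_mult_nth blk_diag_blk_nth blk_nth)
  then show ?thesis by (simp add: vec_eq_iff)
qed

lemma order0_Op:
  assumes "J \<subseteq> N"
  shows "To ** (G 0)\<langle>Op, J\<rangle> + (Pc 0)\<langle>Op, Om\<rangle> ** Tom ** (G 0)\<langle>Om, J\<rangle> = 0"
proof -
  have "(To ** (G 0)\<langle>Op, J\<rangle> + (Pc 0)\<langle>Op, Om\<rangle> ** Tom ** (G 0)\<langle>Om, J\<rangle>) $ i $ j = 0" for i j
  proof (cases "i \<in> Op \<and> j \<in> J")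
    case True
    then have i: "i \<in> Op" and ij: "i \<in> P" "j \<in> N" using assms by auto
    show ?thesis
      using order0[OF ij] True
      by (simp add: To_def Tom_def diag_mult_nth blk_diag_blk_nth blk_nth pf_nth(2,5)[OF i]
          e0_vals(2)[OF i] v0_vals)
  qed (auto simp: To_def Tom_def diag_mult_nth blk_diag_blk_nth blk_nth)
  then show ?thesis by (simp add: vec_eq_iff)
qed

text \<open>
  The second coefficient enters the equation of order one through the shift in the block \<open>(Pl,
  Om)\<close>.
\<close>

lemma order1_Pl:
  assumes "J \<subseteq> N"
  shows "Cp ** (G 1)\<langle>Pl, J\<rangle> - Cp ** (diag_mat ct)\<langle>Pl, Pl\<rangle> ** Cp ** (G 0)\<langle>Pl, J\<rangle>
    + (Pc 1)\<langle>Pl, Om\<rangle> ** Tom ** (G 1)\<langle>Om, J\<rangle> + (Pc 2)\<langle>Pl, Om\<rangle> ** Tom ** (G 0)\<langle>Om, J\<rangle>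
    + (Pc 0)\<langle>Pl, Mi\<rangle> ** Cm ** (G 1)\<langle>Mi, J\<rangle> + (Pc 1)\<langle>Pl, Mi\<rangle> ** Cm ** (G 0)\<langle>Mi, J\<rangle>
    + (Pc 0)\<langle>Pl, Mi\<rangle> ** Cm ** (diag_mat ct)\<langle>Mi, Mi\<rangle> ** Cm ** (G 0)\<langle>Mi, J\<rangle> = 0" (is "?M = 0")
proof -
  have CTC: "Cp ** (diag_mat ct)\<langle>Pl, Pl\<rangle> ** Cp = diag_mat (\<lambda>i. if i \<in> Pl then ct i / (c i)\<^sup>2 else 0)"
    by (simp add: vec_eq_iff Cp_def mult_diag_nth diag_mult_nth blk_nth diag_nth power2_eq_square)
  have CmT: "(Pc 0)\<langle>Pl, Mi\<rangle> ** Cm ** (diag_mat ct)\<langle>Mi, Mi\<rangle> ** Cm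
     = (Pc 0)\<langle>Pl, Mi\<rangle> ** diag_mat (\<lambda>i. if i \<in> Mi then ct i / (c i)\<^sup>2 else 0)"
    unfolding diag_blk by (simp add: vec_eq_iff Cm_def mult_diag_nth blk_nth power2_eq_square)
  have "?M $ i $ j = 0" for i j
  proof (cases "i \<in> Pl \<and> j \<in> J")
    case True
    then have i: "i \<in> Pl" and ij: "i \<in> P" "j \<in> N" using assms by auto
    show ?thesis
      unfolding CTC CmT
      using order1[OF ij] True
      by (simp add: Cp_def Cm_def Tom_def diag_mult_nth blk_diag_blk_nth blk_nth pf_nth(1,3,4)[OF i]
          e0_vals(1)[OF i] v0_vals coeff1(1)[OF i, unfolded One_nat_def] sum.distrib numeral_2_eq_2
          distrib_right algebra_simps cong: sum.cong_simp)
  next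
    case False
    then show ?thesis
      unfolding CTC CmT by (auto simp: Cp_def Cm_def Tom_def diag_mult_nth blk_diag_blk_nth blk_nth)
  qed
  then show ?thesis by (simp add: vec_eq_iff)
qed

lemma order1_Op:
  assumes "J \<subseteq> N"
  shows "To ** (G 1)\<langle>Op, J\<rangle> + (Pc 0)\<langle>Op, Om\<rangle> ** Tom ** (G 1)\<langle>Om, J\<rangle>
    + (Pc 1)\<langle>Op, Om\<rangle> ** Tom ** (G 0)\<langle>Om, J\<rangle> + (Pc 0)\<langle>Op, Mi\<rangle> ** Cm ** (G 0)\<langle>Mi, J\<rangle> = 0" (is "?M = 0")
proof -
  have "?M $ i $ j = 0" for i j
  proof (cases "i \<in> Op \<and> j \<in> J")
    case True
    then have i: "i \<in> Op" and ij: "i \<in> P" "j \<in> N" using assms by auto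
    show ?thesis
      using order1[OF ij] True
      by (simp add: To_def Cm_def Tom_def diag_mult_nth blk_diag_blk_nth blk_nth pf_nth(2,5,6)[OF i]
          e0_vals(2)[OF i] v0_vals coeff1(2)[OF i, unfolded One_nat_def] sum.distrib
          algebra_simps cong: sum.cong_simp)
  qed (auto simp: To_def Cm_def Tom_def diag_mult_nth blk_diag_blk_nth blk_nth)
  then show ?thesis by (simp add: vec_eq_iff)
qed

lemma Pc0_Pl_Om: "(Pc 0)\<langle>Pl, Om\<rangle> = 0"
  by (auto simp: vec_eq_iff blk_nth Pc_def xf_def sf_def)

lemma G0_blk: "(G 0)\<langle>I, J\<rangle> = A\<langle>I, J\<rangle> + A\<langle>I, Pl\<rangle> ** (Pc 0)\<langle>Pl, J\<rangle> + A\<langle>I, Op\<rangle> ** (Pc 0)\<langle>Op, J\<rangle>"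
  by (simp add: vec_eq_iff blk_nth mult_blk_left_nth G_def sum_P A'_def)

lemma G1_blk: "(G 1)\<langle>I, J\<rangle> = A\<langle>I, Pl\<rangle> ** (Pc 1)\<langle>Pl, J\<rangle> + A\<langle>I, Op\<rangle> ** (Pc 1)\<langle>Op, J\<rangle>"
  by (simp add: vec_eq_iff blk_nth mult_blk_left_nth G_def sum_P A'_def)

lemma Uf_nth: "l \<in> N \<Longrightarrow> j \<in> N \<Longrightarrow> Uf l j = vt l * uf l j"
  by (simp add: Uf_def uf_def)

lemma Uc_blocks:
  assumes "J \<subseteq> N"
  shows "(Uc (-1))\<langle>Om, J\<rangle> = Tom ** (G 0)\<langle>Om, J\<rangle>" "(Uc 0)\<langle>Om, J\<rangle> = Tom ** (G 1)\<langle>Om, J\<rangle>"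
    "(Uc 0)\<langle>Mi, J\<rangle> = Cm ** (G 0)\<langle>Mi, J\<rangle>"
proof -
  have 1: "Uf l j = fps_const (v0 l) * uf l j" if "l \<in> Om" "j \<in> J" for l j
    using Uf_nth[of l j] that assms by (auto simp: vt_def vf_def v0_def)
  have 2: "Uf l j = fps_X * (vf l * uf l j)" if "l \<in> Mi" "j \<in> J" for l j
  proof -
    have "l \<in> N" "j \<in> N" "l \<notin> Om" using that assms set_disjoint(5)[of l] by auto
    then show ?thesis by (simp add: Uf_nth vt_def mult.assoc)
  qed
  show "(Uc (-1))\<langle>Om, J\<rangle> = Tom ** (G 0)\<langle>Om, J\<rangle>" "(Uc 0)\<langle>Om, J\<rangle> = Tom ** (G 1)\<langle>Om, J\<rangle>"
    by (auto simp: vec_eq_iff blk_nth Uc_def 1 Tom_def diag_mult_nth uf_nth v0_vals)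
  show "(Uc 0)\<langle>Mi, J\<rangle> = Cm ** (G 0)\<langle>Mi, J\<rangle>"
    by (auto simp: vec_eq_iff blk_nth Uc_def 2 Cm_def diag_mult_nth uf_nth v0_vals coeff0)
qed

lemma Kc_blocks:
  assumes "J \<subseteq> P"
  shows "(Kc (-1))\<langle>Op, J\<rangle> = To ** A\<langle>Op, J\<rangle> + (Pc 0)\<langle>Op, Om\<rangle> ** Tom ** A\<langle>Om, J\<rangle>"
proof -
  have "fps_nth (Kf i k) 0 = 1 / ct i * A $ i $ k + (\<Sum>l\<in>Om. v0 l * Pc 0 $ i $ l * A $ l $ k)"
    if "i \<in> Op" "k \<in> J" for i k
  proof -
    have "(\<Sum>l\<in>Mi. fps_nth (xf i l * vt l * fps_const (A' l k)) 0) = 0"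
      by (intro sum.neutral) (auto simp: vt_def dest: set_disjoint)
    moreover have "(\<Sum>l\<in>Om. fps_nth (xf i l * vt l * fps_const (A' l k)) 0)
        = (\<Sum>l\<in>Om. v0 l * Pc 0 $ i $ l * A $ l $ k)"
      by (intro sum.cong) (auto simp: vt_def vf_def v0_def Pc_def A'_def)
    moreover have "k \<in> P" "i \<in> P" using that assms by auto
    ultimately show ?thesis
      using that by (simp add: Kf_def fps_sum_nth sum_N et_def coeff0 e0_vals A'_def)
  qed
  then show ?thesis
    by (auto simp: vec_eq_iff blk_nth Kc_def To_def Tom_def diag_mult_nth blk_diag_blk_nth v0_vals)
qed

section \<open>Stability of the limit\<close>

text \<open>
  \<open>y0\<close> collects the limit of the first return matrix on all blocks except \<open>(Pl, Om)\<close>, where it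
  is the first coefficient.
\<close>

lemma Pc0_y0: "Pc 0 $ i $ j = s0 i j * y0 i j"
  by (simp add: Pc_def xf_def y0_def coeff0)

lemma Pc1_y0: "i \<in> Pl \<Longrightarrow> j \<in> Om \<Longrightarrow> Pc 1 $ i $ j = y0 i j"
  by (simp add: Pc_def xf_def y0_def sf_def)

lemma Pc0_y0': "i \<in> Op \<or> j \<in> Mi \<Longrightarrow> Pc 0 $ i $ j = y0 i j"
  using set_disjoint by (auto simp: Pc0_y0 s0_def)

lemma y0_nonneg: "0 \<le> y0 i j"
  using Y_nonneg[of i j] Y_out[of i j] by (cases "i \<in> P \<and> j \<in> N") (auto simp: y0_def)

lemma cert0: "i \<in> P \<Longrightarrow> j \<in> N \<Longrightarrow> dric P N e0 f0 s0 A' y0 H i j < 0"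
  using cert unfolding y0_def[abs_def] .

lemma ric0: "i \<in> P \<Longrightarrow> j \<in> N \<Longrightarrow> ric P N e0 f0 s0 A' y0 i j = 0"
proof -
  assume "i \<in> P" "j \<in> N"
  then have "fps_nth (ric P N ef ff sf (\<lambda>i j. fps_const (A' i j)) Y i j) 0 = 0" by (simp add: Y_ric)
  then show ?thesis by (simp add: ric_def lin_def fps_sum_nth coeff0 y0_def)
qed

interpretation R0: riccati_data P N e0 f0 s0 A' by (rule data0)

lemma limit_least:
  assumes "\<And>i j. i \<in> P \<Longrightarrow> j \<in> N \<Longrightarrow> 0 \<le> Z i j \<and> ric P N e0 f0 s0 A' Z i j = 0" "i \<in> P" "j \<in> N"
  shows "y0 i j \<le> Z i j"
  by (rule R0.certified_solution_least(2)[of y0 H y0 Z])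
     (use assms ric0 y0_nonneg H_pos cert0 in auto)

lemma G0_lin: "G 0 $ l $ j = A' l j + lin P s0 A' y0 l j"
  by (simp add: G_def lin_def Pc0_y0)

text \<open>
  \<open>A F\<close> with the weight of the limit, which leaves out the block \<open>(Pl, Om)\<close> of \<open>F\<close>. It occurs in
  the matrix form of the limit equation and of its derivative.
\<close>

definition Lm :: "real ^ 's ^ 's \<Rightarrow> real ^ 's ^ 's" where
  "Lm F = (\<chi> l j. lin P s0 A' (\<lambda>i j. F $ i $ j) l j)"

lemma Lm_blk: "(Lm F)\<langle>I, Om\<rangle> = A\<langle>I, Op\<rangle> ** F\<langle>Op, Om\<rangle>"
  "(Lm F)\<langle>I, Mi\<rangle> = A\<langle>I, Pl\<rangle> ** F\<langle>Pl, Mi\<rangle> + A\<langle>I, Op\<rangle> ** F\<langle>Op, Mi\<rangle>"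
proof -
  have "lin P s0 A' (\<lambda>i j. F $ i $ j) l j = (\<Sum>k\<in>Op. A $ l $ k * F $ k $ j)" if "j \<in> Om" for l j
  proof -
    have "(\<Sum>k\<in>Pl. A' l k * (s0 k j * F $ k $ j)) = 0" using that by (intro sum.neutral) (simp add: s0_def)
    moreover have "(\<Sum>k\<in>Op. A' l k * (s0 k j * F $ k $ j)) = (\<Sum>k\<in>Op. A $ l $ k * F $ k $ j)"
      by (intro sum.cong) (auto simp: s0_def A'_def dest: set_disjoint)
    ultimately show ?thesis by (simp add: lin_def sum_P)
  qed
  then show "(Lm F)\<langle>I, Om\<rangle> = A\<langle>I, Op\<rangle> ** F\<langle>Op, Om\<rangle>"
    by (simp add: vec_eq_iff blk_nth mult_blk_left_nth Lm_def)
  have "lin P s0 A' (\<lambda>i j. F $ i $ j) l j = (\<Sum>k\<in>Pl. A $ l $ k * F $ k $ j) + (\<Sum>k\<in>Op. A $ l $ k * F $ k $ j)"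
    if "j \<in> Mi" for l j
  proof -
    have "j \<notin> Om" using that set_disjoint(5) by blast
    then show ?thesis by (simp add: lin_def sum_P s0_def A'_def)
  qed
  then show "(Lm F)\<langle>I, Mi\<rangle> = A\<langle>I, Pl\<rangle> ** F\<langle>Pl, Mi\<rangle> + A\<langle>I, Op\<rangle> ** F\<langle>Op, Mi\<rangle>"
    by (simp add: vec_eq_iff blk_nth mult_blk_left_nth Lm_def)
qed

lemma f0_vals:
  "i \<in> Pl \<Longrightarrow> l \<in> Om \<Longrightarrow> f0 i l = 1 / \<bar>ct l\<bar>" "i \<in> Pl \<Longrightarrow> l \<in> Mi \<Longrightarrow> f0 i l = 1 / \<bar>c l\<bar>"
  "i \<in> Op \<Longrightarrow> l \<in> Om \<Longrightarrow> f0 i l = 1 / \<bar>ct l\<bar>" "i \<in> Op \<Longrightarrow> l \<in> Mi \<Longrightarrow> f0 i l = 0"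
  using set_disjoint by (auto simp: f0_def v0_vals)

lemma ric_matrix_Pl:
  assumes "i \<in> Pl" "j \<in> J" "J \<subseteq> N"
  shows "ric P N e0 f0 s0 A' (\<lambda>i j. F $ i $ j) i j
    = (Cp ** (A\<langle>Pl, J\<rangle> + (Lm F)\<langle>Pl, J\<rangle>) + F\<langle>Pl, Om\<rangle> ** Tom ** (A\<langle>Om, J\<rangle> + (Lm F)\<langle>Om, J\<rangle>)
      + F\<langle>Pl, Mi\<rangle> ** Cm ** (A\<langle>Mi, J\<rangle> + (Lm F)\<langle>Mi, J\<rangle>)) $ i $ j"
  using assms
  by (simp add: matrix_add_ldistrib ric_def sum_N f0_vals e0_vals Cp_def Cm_def Tom_def diag_mult_nth
      blk_diag_blk_nth blk_nth Lm_def A'_def distrib_left sum.distrib)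

lemma ric_matrix_Op:
  assumes "i \<in> Op" "j \<in> J" "J \<subseteq> N"
  shows "ric P N e0 f0 s0 A' (\<lambda>i j. F $ i $ j) i j
    = (To ** (A\<langle>Op, J\<rangle> + (Lm F)\<langle>Op, J\<rangle>) + F\<langle>Op, Om\<rangle> ** Tom ** (A\<langle>Om, J\<rangle> + (Lm F)\<langle>Om, J\<rangle>)) $ i $ j"
  using assms
  by (simp add: matrix_add_ldistrib ric_def sum_N f0_vals e0_vals To_def Tom_def diag_mult_nth
      blk_diag_blk_nth blk_nth Lm_def A'_def distrib_left sum.distrib)

lemma dric_matrix_Pl:
  assumes "i \<in> Pl" "j \<in> J" "J \<subseteq> N"
  shows "dric P N e0 f0 s0 A' y0 (\<lambda>i j. F $ i $ j) i j
    = (Cp ** (Lm F)\<langle>Pl, J\<rangle> + (Pc 1)\<langle>Pl, Om\<rangle> ** Tom ** (Lm F)\<langle>Om, J\<rangle> + (Pc 0)\<langle>Pl, Mi\<rangle> ** Cm ** (Lm F)\<langle>Mi, J\<rangle>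
      + F\<langle>Pl, Om\<rangle> ** Tom ** (G 0)\<langle>Om, J\<rangle> + F\<langle>Pl, Mi\<rangle> ** Cm ** (G 0)\<langle>Mi, J\<rangle>) $ i $ j"
  using assms
  by (simp add: dric_def sum_N f0_vals e0_vals Cp_def Cm_def Tom_def diag_mult_nth
      blk_diag_blk_nth blk_nth Lm_def sum.distrib G0_lin Pc0_y0' Pc1_y0[unfolded One_nat_def])

lemma dric_matrix_Op:
  assumes "i \<in> Op" "j \<in> J" "J \<subseteq> N"
  shows "dric P N e0 f0 s0 A' y0 (\<lambda>i j. F $ i $ j) i j
    = (To ** (Lm F)\<langle>Op, J\<rangle> + (Pc 0)\<langle>Op, Om\<rangle> ** Tom ** (Lm F)\<langle>Om, J\<rangle>
      + F\<langle>Op, Om\<rangle> ** Tom ** (G 0)\<langle>Om, J\<rangle>) $ i $ j"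
  using assms
  by (simp add: dric_def sum_N f0_vals e0_vals To_def Tom_def diag_mult_nth
      blk_diag_blk_nth blk_nth Lm_def sum.distrib G0_lin Pc0_y0')

text \<open>
  The leading coefficients of \<open>K(\<epsilon>)\<close> and \<open>U(\<epsilon>)\<close> on the phases of rate zero:
  the matrices \<open>K\<close> and \<open>U\<close> of the fluid model with rates \<open>ct\<close> restricted to these phases.
\<close>

abbreviation "Koo \<equiv> (Kc (-1))\<langle>Op, Op\<rangle>"
abbreviation "Uoo \<equiv> (Uc (-1))\<langle>Om, Om\<rangle>"

lemma subs: "Om \<subseteq> N" "Mi \<subseteq> N" "Pl \<subseteq> P" "Op \<subseteq> P" by auto

lemma invertible_Ze: "blk_invertible Ze (A\<langle>Ze, Ze\<rangle>)"
proof -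
  obtain h where h: "\<forall>i\<in>Ze. 0 < h i" "\<forall>i\<in>Ze. (\<Sum>j\<in>Ze. A' i j * h j) < 0" using Ze_cert by blast
  have "blk_invertible Ze (- (A\<langle>Ze, Ze\<rangle>))"
    by (rule metzler_blk_invertible(1)[OF blk_idem, of _ _ h])
       (use h A_off in \<open>auto simp: blk_nth A'_def\<close>)
  then obtain N where "is_blk_inverse Ze (- (A\<langle>Ze, Ze\<rangle>)) N" unfolding blk_invertible_def by blast
  then have "is_blk_inverse Ze (A\<langle>Ze, Ze\<rangle>) (- N)"
    unfolding is_blk_inverse_def by (simp add: matrix_minus_left matrix_minus_right blk_minus)
  then show ?thesis unfolding blk_invertible_def by blast
qed

lemma Koo_nth: "i \<in> Op \<Longrightarrow> k \<in> Op \<Longrightarrow> Koo $ i $ k = e0 i * A' i k + (\<Sum>l\<in>Om. y0 i l * v0 l * A' l k)"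
  unfolding Kc_blocks[OF subs(4)]
  by (simp add: To_def Tom_def diag_mult_nth blk_diag_blk_nth blk_nth Pc0_y0' e0_vals v0_vals A'_def mult.commute)

lemma Uoo_nth: "l \<in> Om \<Longrightarrow> j \<in> Om \<Longrightarrow> Uoo $ l $ j = v0 l * (A' l j + (\<Sum>k\<in>Op. A' l k * y0 k j))"
  unfolding Uc_blocks(1)[OF subs(1)] G0_blk Pc0_Pl_Om
  by (simp add: Tom_def diag_mult_nth blk_nth mult_blk_left_nth Pc0_y0' v0_vals A'_def)

text \<open>
  \<open>Koo\<close> is Metzler with certificate \<open>a\<close>, and likewise \<open>Uoo\<close> with \<open>b\<close>. The nonnegativity of the
  inverses is used when a solution of the censored equation is extended.
\<close>

lemma invertible_Koo: "blk_invertible Op (- Koo)" "0 \<le> blk_inv Op (- Koo)"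
proof -
  have off: "0 \<le> Koo $ i $ k" if "i \<in> Op" "k \<in> Op" "i \<noteq> k" for i k
  proof -
    have "l \<noteq> k" if "l \<in> Om" for l using that \<open>k \<in> Op\<close> set_disjoint by blast
    then show ?thesis
      unfolding Koo_nth[OF that(1,2)] using that y0_nonneg
      by (intro add_nonneg_nonneg sum_nonneg mult_nonneg_nonneg A_off less_imp_le[OF e0_pos]
          less_imp_le[OF v0_pos]) auto
  qed
  have Ka': "(\<Sum>k\<in>Op. Koo $ i $ k * a k) < 0" if "i \<in> Op" for i
    using Ka[OF that] that by (simp add: Koo_nth y0_def)
  show "blk_invertible Op (- Koo)" "0 \<le> blk_inv Op (- Koo)"
    using metzler_blk_invertible[OF blk_idem[of "Kc (-1)" Op Op] off a_pos Ka'] by auto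
qed

lemma invertible_Uoo: "blk_invertible Om (- Uoo)" "0 \<le> blk_inv Om (- Uoo)"
proof -
  have off: "0 \<le> Uoo $ l $ j" if "l \<in> Om" "j \<in> Om" "l \<noteq> j" for l j
  proof -
    have "l \<noteq> k" if "k \<in> Op" for k using that \<open>l \<in> Om\<close> set_disjoint by blast
    then show ?thesis
      unfolding Uoo_nth[OF that(1,2)] using that y0_nonneg
      by (intro add_nonneg_nonneg sum_nonneg mult_nonneg_nonneg A_off less_imp_le[OF v0_pos]) auto
  qed
  have bU': "(\<Sum>l\<in>Om. b l * Uoo $ l $ j) < 0" if "j \<in> Om" for j
    using bU[OF that] that by (simp add: Uoo_nth y0_def)
  obtain h where h: "\<And>i. i \<in> Om \<Longrightarrow> 0 < h i" "\<And>i. i \<in> Om \<Longrightarrow> (\<Sum>j\<in>Om. Uoo $ i $ j * h j) < 0"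
    by (rule metzler_right_vector[of Om "\<lambda>l j. Uoo $ l $ j" b]) (use off b_pos bU' that in auto)
  show "blk_invertible Om (- Uoo)" "0 \<le> blk_inv Om (- Uoo)"
    using metzler_blk_invertible[OF blk_idem[of "Uc (-1)" Om Om] off h] by auto
qed

lemma sub_data: "riccati_data Op Om (\<lambda>i. 1 / ct i) (\<lambda>_ l. 1 / \<bar>ct l\<bar>) one2 (\<lambda>i j. A $ i $ j)"
  using set_facts A_off by unfold_locales (auto simp: Op_def Om_def A'_def)

interpretation RZ: riccati_data Op Om "\<lambda>i. 1 / ct i" "\<lambda>_ l. 1 / \<bar>ct l\<bar>" one2 "\<lambda>i j. A $ i $ j"
  by (rule sub_data)

text \<open>
  In the columns \<open>Om\<close> the weight \<open>s0\<close> removes the rows \<open>Pl\<close>, so the entries at \<open>(Op, Om)\<close> form a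
  closed subsystem. It inherits the solution \<open>y0\<close> and the certificate \<open>H\<close> by restriction.
\<close>

lemma lin_sub:
  assumes "j \<in> Om"
  shows "lin P s0 A' F l j = lin Op one2 (\<lambda>i j. A $ i $ j) F l j"
proof -
  have "(\<Sum>k\<in>Pl. A' l k * (s0 k j * F k j)) = 0" using assms by (intro sum.neutral) (simp add: s0_def)
  moreover have "(\<Sum>k\<in>Op. A' l k * (s0 k j * F k j)) = (\<Sum>k\<in>Op. A $ l $ k * (1 * F k j))"
    by (intro sum.cong) (auto simp: s0_def A'_def dest: set_disjoint)
  ultimately show ?thesis by (simp add: lin_def sum_P)
qed

lemma sub_eq:
  assumes "i \<in> Op" "j \<in> Om"
  shows "ric P N e0 f0 s0 A' Z i j = ric Op Om (\<lambda>i. 1 / ct i) (\<lambda>_ l. 1 / \<bar>ct l\<bar>) one2 (\<lambda>i j. A $ i $ j) Z i j"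
    "dric P N e0 f0 s0 A' Z F i j
      = dric Op Om (\<lambda>i. 1 / ct i) (\<lambda>_ l. 1 / \<bar>ct l\<bar>) one2 (\<lambda>i j. A $ i $ j) Z F i j"
  using assms by (simp_all add: ric_def dric_def sum_N f0_vals e0_vals lin_sub A'_def)

lemma min_Op_Om: "min_nonneg_solution Op Om A (diag_mat ct) ((Pc 0)\<langle>Op, Om\<rangle>)"
proof (rule min_nonneg_solutionI[OF _ _ blk_idem])
  fix i j assume ij: "i \<in> Op" "j \<in> Om"
  have "RZ.Ric (\<lambda>i j. (Pc 0)\<langle>Op, Om\<rangle> $ i $ j) i j = RZ.Ric y0 i j"
    by (rule ric_cong[OF ij]) (simp add: blk_nth Pc0_y0')
  also have "\<dots> = 0" using sub_eq(1)[OF ij, of y0] ric0[of i j] ij by simp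
  finally show "0 \<le> (Pc 0)\<langle>Op, Om\<rangle> $ i $ j \<and> RZ.Ric (\<lambda>i j. (Pc 0)\<langle>Op, Om\<rangle> $ i $ j) i j = 0"
    using ij y0_nonneg by (simp add: blk_nth Pc0_y0')
next
  fix Z and i j
  assume Z: "\<And>i j. i \<in> Op \<Longrightarrow> j \<in> Om \<Longrightarrow> 0 \<le> Z i j \<and> RZ.Ric Z i j = 0" and ij: "i \<in> Op" "j \<in> Om"
  have "y0 i j \<le> Z i j"
  proof (rule RZ.certified_solution_least(2)[of y0 H y0])
    fix i j assume ij: "i \<in> Op" "j \<in> Om"
    show "0 < H i j" using H_pos ij by simp
    show "RZ.DRic y0 H i j < 0" using cert0[of i j] sub_eq(2)[OF ij, of y0 H] ij by simp
    show "0 \<le> y0 i j \<and> RZ.Ric y0 i j \<le> 0" "\<bar>y0 i j\<bar> \<le> y0 i j \<and> RZ.Ric y0 i j = 0"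
      using ric0[of i j] sub_eq(1)[OF ij, of y0] ij y0_nonneg by simp_all
    show "0 \<le> Z i j \<and> RZ.Ric Z i j \<le> 0" using Z[OF ij] by simp
  qed (use ij in auto)
  then show "(Pc 0)\<langle>Op, Om\<rangle> $ i $ j \<le> Z i j" using ij by (simp add: blk_nth Pc0_y0')
qed (auto simp: Op_def Om_def)

lemma sylvester_Op_Om_injective:
  assumes F: "F = F\<langle>Op, Om\<rangle>" and eq: "Koo ** F + F ** Uoo = 0"
  shows "F = 0"
proof -
  have "F $ i $ j = 0" if ij: "i \<in> Op" "j \<in> Om" for i j
  proof (rule RZ.dominance[of H y0 y0 "\<lambda>i j. F $ i $ j"])
    fix i j assume ij: "i \<in> Op" "j \<in> Om"
    show "0 < H i j" using H_pos ij by simp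
    show "RZ.DRic y0 H i j < 0" using cert0[of i j] sub_eq(2)[OF ij, of y0 H] ij by simp
    show "\<bar>y0 i j\<bar> \<le> y0 i j" using y0_nonneg by simp
    have "(Koo ** F + F ** Uoo) $ i $ j = RZ.DRic y0 (\<lambda>i j. F $ i $ j) i j"
    proof -
      have "(Koo ** F) $ i $ j = (\<Sum>k\<in>Op. Koo $ i $ k * F $ k $ j)" by (rule mult_nth_left[OF blk_idem])
      moreover have "(F ** Uoo) $ i $ j = (\<Sum>l\<in>Om. F $ i $ l * Uoo $ l $ j)" by (rule mult_nth_left[OF F])
      ultimately show ?thesis
        unfolding dric_K_U using ij
        by (simp add: Koo_nth Uoo_nth e0_vals v0_vals A'_def lin_def mult_ac)
    qed
    then show "RZ.DRic y0 (\<lambda>i j. F $ i $ j) i j = 0" using eq by simp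
  qed (use ij in auto)
  then have "F $ i $ j = 0" for i j using blk_supportD[OF F, of i j] by blast
  then show ?thesis by (simp add: vec_eq_iff)
qed

text \<open>
  The three hypotheses, together with a zero block at \<open>(Op, Om)\<close>, say that \<open>F = w + y + z\<close> is in
  the kernel of the limit linearisation: up to the scaling, the triple consists of variations of
  the first coefficient at \<open>(Pl, Mi)\<close> and \<open>(Op, Mi)\<close> and of the second one at \<open>(Pl, Om)\<close>.
\<close>

lemma linearization_injective:
  assumes w: "w = w\<langle>Pl, Mi\<rangle>" and y: "y = y\<langle>Op, Mi\<rangle>" and z: "z = z\<langle>Pl, Om\<rangle>"
    and eq_y: "Koo ** y + (Kc (-1))\<langle>Op, Pl\<rangle> ** w = 0"
    and eq_z: "z ** Uoo + w ** (Uc 0)\<langle>Mi, Om\<rangle> = 0"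
    and eq_w: "(Cp ** A\<langle>Pl, Pl\<rangle> + (Pc 0)\<langle>Pl, Mi\<rangle> ** Cm ** A\<langle>Mi, Pl\<rangle>) ** w + w ** (Uc 0)\<langle>Mi, Mi\<rangle>
      + (Cp ** A\<langle>Pl, Op\<rangle> + (Pc 0)\<langle>Pl, Mi\<rangle> ** Cm ** A\<langle>Mi, Op\<rangle>) ** y + z ** (Uc (-1))\<langle>Om, Mi\<rangle>
      + (Pc 1)\<langle>Pl, Om\<rangle> ** (Tom ** (A\<langle>Om, Pl\<rangle> ** w + A\<langle>Om, Op\<rangle> ** y)) = 0"
  shows "w = 0"
proof -
  define F where "F = w + y + z + 0"
  have "(0 :: real ^ 's ^ 's) = 0\<langle>Op, Om\<rangle>" by (simp add: vec_eq_iff blk_nth)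
  note blks = four_blocks[OF w y z this, folded F_def]
  have L: "(Lm F)\<langle>I, Om\<rangle> = 0" "(Lm F)\<langle>I, Mi\<rangle> = A\<langle>I, Pl\<rangle> ** w + A\<langle>I, Op\<rangle> ** y" for I
    unfolding Lm_blk blks by simp_all
  have "F $ i $ j = 0" if ij: "i \<in> P" "j \<in> N" for i j
  proof (rule R0.dominance[OF H_pos cert0, of y0 "\<lambda>i j. F $ i $ j"])
    fix i j assume ij: "i \<in> P" "j \<in> N"
    show "\<bar>y0 i j\<bar> \<le> y0 i j" using y0_nonneg by simp
    consider "i \<in> Pl" "j \<in> Om" | "i \<in> Pl" "j \<in> Mi" | "i \<in> Op" "j \<in> Om" | "i \<in> Op" "j \<in> Mi"
      using ij by auto
    then show "R0.DRic y0 (\<lambda>i j. F $ i $ j) i j = 0"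
    proof cases
      case 1
      show ?thesis unfolding dric_matrix_Pl[OF 1 subs(1)] L blks
        using eq_z by (simp add: Uc_blocks[OF subs(1)] matrix_mul_assoc del: vector_add_component)
    next
      case 2
      show ?thesis unfolding dric_matrix_Pl[OF 2 subs(2)] L blks
        using eq_w by (simp add: Uc_blocks[OF subs(2)] matrix_ring algebra_simps del: vector_add_component)
    next
      case 3
      show ?thesis unfolding dric_matrix_Op[OF 3 subs(1)] L blks by simp
    next
      case 4
      show ?thesis unfolding dric_matrix_Op[OF 4 subs(2)] L blks
        using eq_y by (simp add: Kc_blocks[OF subs(3)] Kc_blocks[OF subs(4)] matrix_ring algebra_simps
            del: vector_add_component)
    qed
  qed (use ij in auto)
  then have "F\<langle>Pl, Mi\<rangle> $ i $ j = 0" for i j by (simp add: blk_nth)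
  then show ?thesis unfolding blks by (simp add: vec_eq_iff)
qed

text \<open>
  Here \<open>y\<close> and \<open>z\<close> are held fixed, so the operator is not a block of the limit linearisation in
  itself: its \<open>U\<close> contains the returns from \<open>Mi\<close> to \<open>Mi\<close> by way of \<open>Op\<close>, while its \<open>K\<close> has no
  excursion through the phases of rate zero. Absorbing these returns into the transitions within
  \<open>Mi\<close>, as in the matrix \<open>B\<close>, makes it the linearisation of a Riccati map for \<open>Pl\<close> and \<open>Mi\<close>
  alone. The certificate \<open>H\<close> restricts, because all terms left out are nonnegative.
\<close>

lemma sylvester_Pl_Mi_injective:
  assumes w: "w = w\<langle>Pl, Mi\<rangle>"
    and eq: "(Cp ** A\<langle>Pl, Pl\<rangle> + (Pc 0)\<langle>Pl, Mi\<rangle> ** Cm ** A\<langle>Mi, Pl\<rangle>) ** w + w ** (Uc 0)\<langle>Mi, Mi\<rangle> = 0"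
  shows "w = 0"
proof -
  define B where "B l j = A' l j + (if l \<in> Mi \<and> j \<in> Mi then \<Sum>k\<in>Op. A' l k * y0 k j else 0)" for l j
  have B_off: "A' l j \<le> B l j" if "l \<in> Pl \<union> Mi" for l j
  proof -
    have "0 \<le> (\<Sum>k\<in>Op. A' l k * y0 k j)" if "l \<in> Mi"
      using that set_disjoint y0_nonneg by (intro sum_nonneg mult_nonneg_nonneg A_off) auto
    then show ?thesis by (simp add: B_def)
  qed
  interpret R1: riccati_data Pl Mi e0 "\<lambda>_. v0" one2 B
    using set_facts e0_pos v0_pos order_trans[OF A_off B_off]
    by unfold_locales (auto simp: less_imp_le)
  have lin_B: "B l j + lin Pl one2 B y0 l j = A' l j + lin P s0 A' y0 l j" if "l \<in> Mi" "j \<in> Mi" for l j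
  proof -
    have "j \<notin> Om" using that set_disjoint by blast
    moreover have "B l k = A' l k" if "k \<in> Pl" for k using that set_disjoint by (auto simp: B_def)
    ultimately show ?thesis using that by (simp add: lin_def sum_P s0_def B_def)
  qed
  have B_Pl: "B l k = A' l k" if "k \<in> Pl" for l k using that set_disjoint by (auto simp: B_def)
  have less: "R1.DRic y0 H i j < 0" if ij: "i \<in> Pl" "j \<in> Mi" for i j
  proof -
    have jO: "j \<notin> Om" "i \<notin> Op" using ij set_disjoint by blast+
    have lin1: "lin Pl one2 B H l j \<le> lin P s0 A' H l j" if "l \<in> insert i Mi" for l
    proof -
      have "0 \<le> (\<Sum>k\<in>Op. A' l k * H k j)"
        using that ij set_disjoint H_pos by (intro sum_nonneg mult_nonneg_nonneg A_off) (auto simp: less_imp_le)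
      then show ?thesis using jO B_Pl by (simp add: lin_def sum_P s0_def)
    qed
    have pos: "0 \<le> (\<Sum>l\<in>Om. f0 i l * y0 i l * lin P s0 A' H l j + f0 i l * H i l * (A' l j + lin P s0 A' y0 l j))"
    proof (rule sum_nonneg)
      fix l assume l: "l \<in> Om"
      have lj: "l \<noteq> j" using l jO by auto
      have "0 \<le> lin P s0 A' F l j" if "\<And>k. k \<in> P \<Longrightarrow> 0 \<le> F k j" for F
        using that l set_disjoint unfolding lin_def
        by (intro sum_nonneg mult_nonneg_nonneg A_off R0.s) (use ij in auto)
      then have "0 \<le> lin P s0 A' H l j" "0 \<le> lin P s0 A' y0 l j"
        using H_pos[of _ j] y0_nonneg ij by (auto simp: less_imp_le)
      then show "0 \<le> f0 i l * y0 i l * lin P s0 A' H l j + f0 i l * H i l * (A' l j + lin P s0 A' y0 l j)"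
        using R0.f[of i l] l ij y0_nonneg[of i l] H_pos[of i l] A_off[OF lj]
        by (intro add_nonneg_nonneg mult_nonneg_nonneg) (auto simp: less_imp_le)
    qed
    have "R1.DRic y0 H i j \<le> e0 i * lin P s0 A' H i j
        + (\<Sum>l\<in>Mi. f0 i l * y0 i l * lin P s0 A' H l j + f0 i l * H i l * (A' l j + lin P s0 A' y0 l j))"
      unfolding dric_def
    proof (intro add_mono sum_mono)
      show "e0 i * lin Pl one2 B H i j \<le> e0 i * lin P s0 A' H i j"
        using lin1 e0_pos[of i] ij by (intro mult_left_mono) (auto simp: less_imp_le)
      fix l assume l: "l \<in> Mi"
      have f: "f0 i l = v0 l" using jO by (simp add: f0_def)
      show "v0 l * y0 i l * lin Pl one2 B H l j \<le> f0 i l * y0 i l * lin P s0 A' H l j"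
        unfolding f using lin1[of l] l v0_pos[of l] y0_nonneg[of i l] by (intro mult_left_mono) auto
      show "v0 l * H i l * (B l j + lin Pl one2 B y0 l j) \<le> f0 i l * H i l * (A' l j + lin P s0 A' y0 l j)"
        unfolding f lin_B[OF l ij(2)] by simp
    qed
    also have "\<dots> \<le> dric P N e0 f0 s0 A' y0 H i j"
      unfolding dric_def sum_N using pos by simp
    also have "\<dots> < 0" using cert0 ij by simp
    finally show ?thesis .
  qed
  have "w $ i $ j = 0" if ij: "i \<in> Pl" "j \<in> Mi" for i j
  proof (rule R1.dominance[of H y0 y0 "\<lambda>i j. w $ i $ j"])
    fix i j assume ij: "i \<in> Pl" "j \<in> Mi"
    show "0 < H i j" using H_pos ij by simp
    show "R1.DRic y0 H i j < 0" by (rule less[OF ij])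
    show "\<bar>y0 i j\<bar> \<le> y0 i j" using y0_nonneg by simp
    have KPl: "(Cp ** A\<langle>Pl, Pl\<rangle> + (Pc 0)\<langle>Pl, Mi\<rangle> ** Cm ** A\<langle>Mi, Pl\<rangle>)
        = (Cp ** A\<langle>Pl, Pl\<rangle> + (Pc 0)\<langle>Pl, Mi\<rangle> ** Cm ** A\<langle>Mi, Pl\<rangle>)\<langle>Pl, Pl\<rangle>"
      by (auto simp: vec_eq_iff blk_nth Cp_def Cm_def diag_mult_nth blk_diag_blk_nth)
    have "((Cp ** A\<langle>Pl, Pl\<rangle> + (Pc 0)\<langle>Pl, Mi\<rangle> ** Cm ** A\<langle>Mi, Pl\<rangle>) ** w) $ i $ j
        = (\<Sum>k\<in>Pl. (e0 i * B i k + (\<Sum>l\<in>Mi. v0 l * y0 i l * B l k)) * (1 * w $ k $ j))"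
      unfolding mult_nth_left[OF KPl] using ij B_Pl
      by (intro sum.cong)
         (auto simp: Cp_def Cm_def diag_mult_nth blk_diag_blk_nth blk_nth e0_vals v0_vals Pc0_y0' A'_def)
    moreover have "(w ** (Uc 0)\<langle>Mi, Mi\<rangle>) $ i $ j = (\<Sum>l\<in>Mi. v0 l * w $ i $ l * (B l j + lin Pl one2 B y0 l j))"
      unfolding Uc_blocks(3)[OF subs(2)] mult_nth_left[OF w] using ij lin_B
      by (intro sum.cong) (auto simp: Cm_def diag_mult_nth blk_nth G0_lin v0_vals)
    ultimately have "R1.DRic y0 (\<lambda>i j. w $ i $ j) i j
        = ((Cp ** A\<langle>Pl, Pl\<rangle> + (Pc 0)\<langle>Pl, Mi\<rangle> ** Cm ** A\<langle>Mi, Pl\<rangle>) ** w + w ** (Uc 0)\<langle>Mi, Mi\<rangle>) $ i $ j"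
      unfolding dric_K_U by simp
    then show "R1.DRic y0 (\<lambda>i j. w $ i $ j) i j = 0" unfolding eq by simp
  qed (use ij in auto)
  then have "w $ i $ j = 0" for i j using blk_supportD[OF w, of i j] by blast
  then show ?thesis by (simp add: vec_eq_iff)
qed

section \<open>The limit of the first return matrix\<close>

lemma inverse_blocks_nonneg: "0 \<le> Cp" "0 \<le> Cm" "0 \<le> To" "0 \<le> Tom"
  by (auto simp: less_eq_vec_def Cp_def Cm_def To_def Tom_def diag_nth sets)

lemma A_block_nonneg: "I \<inter> J = {} \<Longrightarrow> 0 \<le> A\<langle>I, J\<rangle>"
  by (auto simp: less_eq_vec_def blk_nth A'_def[symmetric] intro!: A_off)

lemma Pc0_nonneg: "0 \<le> Pc 0"
  using y0_nonneg by (auto simp: less_eq_vec_def Pc0_y0 s0_def)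

lemma Koo_eq: "Koo = To ** A\<langle>Op, Op\<rangle> + (Pc 0)\<langle>Op, Om\<rangle> ** Tom ** A\<langle>Om, Op\<rangle>"
  by (rule Kc_blocks) simp

lemma Uoo_eq: "Uoo = Tom ** (A\<langle>Om, Om\<rangle> + A\<langle>Om, Op\<rangle> ** (Pc 0)\<langle>Op, Om\<rangle>)"
  by (simp add: Uc_blocks G0_blk Pc0_Pl_Om)

lemma V_eq: "To ** (A\<langle>Op, Om\<rangle> + A\<langle>Op, Op\<rangle> ** (Pc 0)\<langle>Op, Om\<rangle>)
    + (Pc 0)\<langle>Op, Om\<rangle> ** Tom ** (A\<langle>Om, Om\<rangle> + A\<langle>Om, Op\<rangle> ** (Pc 0)\<langle>Op, Om\<rangle>) = 0"
  using order0_Op[OF subs(1)] unfolding G0_blk Pc0_Pl_Om by simp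

text \<open>
  For minimality, a nonnegative solution \<open>W\<close> of the censored equation is completed to a
  nonnegative solution of the limit equation. The block at \<open>(Op, Om)\<close> is taken from \<open>y0\<close>; the
  blocks at \<open>(Op, Mi)\<close> and \<open>(Pl, Om)\<close> are then given by linear equations with the matrices \<open>-
  Koo\<close> and \<open>- Uoo\<close>, whose inverses are nonnegative; and the equation at \<open>(Pl, Mi)\<close> holds by
  censoring. The least solution \<open>y0\<close> is below this completion, hence its block at \<open>(Pl, Mi)\<close> is
  below \<open>W\<close>.
\<close>

lemma min_Pl_Mi: "min_nonneg_solution Pl Mi (censored Ze A) (diag_mat c) ((Pc 0)\<langle>Pl, Mi\<rangle>)"
proof (rule min_nonneg_solutionI[OF _ _ blk_idem])
  show nzP: "c i \<noteq> 0" if "i \<in> Pl" for i using that by (auto simp: sets)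
  show nzM: "c i \<noteq> 0" if "i \<in> Mi" for i using that by (auto simp: sets)
  let ?R = "\<lambda>Z. ric Pl Mi (\<lambda>i. 1 / c i) (\<lambda>_ l. 1 / \<bar>c l\<bar>) one2 (\<lambda>i j. censored Ze A $ i $ j) Z"
  let ?V = "(Pc 0)\<langle>Op, Om\<rangle>"
  have rn: "riccati Pl Mi (censored Ze A) (diag_mat c) F $ i $ j
      = (if i \<in> Pl \<and> j \<in> Mi then ?R (\<lambda>i j. F $ i $ j) i j else 0)" if "F = F\<langle>Pl, Mi\<rangle>" for F i j
    by (rule riccati_nth[OF nzP nzM that])
  note cens = censored_riccati[where V = ?V, folded Koo_eq, OF invertible_Koo(1) invertible_Ze _ _ blk_idem V_eq]
  fix i j assume ij: "i \<in> Pl" "j \<in> Mi"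
  have "riccati Pl Mi (censored Ze A) (diag_mat c) ((Pc 0)\<langle>Pl, Mi\<rangle>) = 0"
  proof -
    have Yh: "To ** (A\<langle>Op, Mi\<rangle> + A\<langle>Op, Pl\<rangle> ** (Pc 0)\<langle>Pl, Mi\<rangle> + A\<langle>Op, Op\<rangle> ** (Pc 0)\<langle>Op, Mi\<rangle>)
      + ?V ** Tom ** (A\<langle>Om, Mi\<rangle> + A\<langle>Om, Pl\<rangle> ** (Pc 0)\<langle>Pl, Mi\<rangle> + A\<langle>Om, Op\<rangle> ** (Pc 0)\<langle>Op, Mi\<rangle>) = 0"
      using order0_Op[OF subs(2)] unfolding G0_blk .
    have Zh: "Cp ** (A\<langle>Pl, Om\<rangle> + A\<langle>Pl, Op\<rangle> ** ?V)
      + (Pc 1)\<langle>Pl, Om\<rangle> ** Tom ** (A\<langle>Om, Om\<rangle> + A\<langle>Om, Op\<rangle> ** ?V)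
      + (Pc 0)\<langle>Pl, Mi\<rangle> ** Cm ** (A\<langle>Mi, Om\<rangle> + A\<langle>Mi, Op\<rangle> ** ?V) = 0"
      using order0_Pl[OF subs(1)] unfolding G0_blk Pc0_Pl_Om by simp
    show ?thesis
      by (rule trans[OF cens[OF blk_idem blk_idem Yh Zh] order0_Pl[OF subs(2), unfolded G0_blk]])
  qed
  then show "0 \<le> (Pc 0)\<langle>Pl, Mi\<rangle> $ i $ j \<and> ?R (\<lambda>i j. (Pc 0)\<langle>Pl, Mi\<rangle> $ i $ j) i j = 0"
    using rn[OF blk_idem, of "Pc 0" i j] ij blk_nonneg[OF Pc0_nonneg, of Pl Mi] by (simp add: less_eq_vec_def)
next
  let ?R = "\<lambda>Z. ric Pl Mi (\<lambda>i. 1 / c i) (\<lambda>_ l. 1 / \<bar>c l\<bar>) one2 (\<lambda>i j. censored Ze A $ i $ j) Z"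
  let ?V = "(Pc 0)\<langle>Op, Om\<rangle>"
  fix f and i j
  assume f: "\<And>i j. i \<in> Pl \<Longrightarrow> j \<in> Mi \<Longrightarrow> 0 \<le> f i j \<and> ?R f i j = 0" and ij: "i \<in> Pl" "j \<in> Mi"
  define W :: "real ^ 's ^ 's" where "W = (\<chi> i j. if i \<in> Pl \<and> j \<in> Mi then f i j else 0)"
  have Ws: "W = W\<langle>Pl, Mi\<rangle>" and W0: "0 \<le> W" using f by (auto simp: W_def vec_eq_iff blk_nth less_eq_vec_def)
  have ricW: "riccati Pl Mi (censored Ze A) (diag_mat c) W = 0"
  proof -
    have "riccati Pl Mi (censored Ze A) (diag_mat c) W $ i $ j
        = (if i \<in> Pl \<and> j \<in> Mi then ?R (\<lambda>i j. W $ i $ j) i j else 0)" for i j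
      by (rule riccati_nth[OF _ _ Ws]) (auto simp: sets)
    moreover have "?R (\<lambda>i j. W $ i $ j) i j = ?R f i j" if "i \<in> Pl" "j \<in> Mi" for i j
      by (rule ric_cong[OF that]) (simp add: W_def)
    ultimately show ?thesis using f by (simp add: vec_eq_iff)
  qed
  (* The inhomogeneous terms of the linear equations for the two missing blocks. *)
  define SY where "SY = To ** (A\<langle>Op, Mi\<rangle> + A\<langle>Op, Pl\<rangle> ** W) + ?V ** Tom ** (A\<langle>Om, Mi\<rangle> + A\<langle>Om, Pl\<rangle> ** W)"
  define SZ where "SZ = Cp ** (A\<langle>Pl, Om\<rangle> + A\<langle>Pl, Op\<rangle> ** ?V) + W ** Cm ** (A\<langle>Mi, Om\<rangle> + A\<langle>Mi, Op\<rangle> ** ?V)"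
  define Yw where "Yw = blk_inv Op (- Koo) ** SY"
  define Zw where "Zw = SZ ** blk_inv Om (- Uoo)"
  have SYs: "SY = SY\<langle>Op, Mi\<rangle>"
    using blk_supportD[OF Ws]
    by (auto simp: SY_def vec_eq_iff blk_nth matrix_add_ldistrib To_def Tom_def diag_mult_nth mult_blk_left_nth
        matrix_mul_assoc[symmetric])
  have SZs: "SZ = SZ\<langle>Pl, Om\<rangle>"
    using blk_supportD[OF Ws]
    by (auto simp: SZ_def vec_eq_iff blk_nth matrix_add_ldistrib Cp_def diag_mult_nth mult_blk_right_nth
        mult_nth_left[OF Ws] matrix_mul_assoc mult_diag_nth Cm_def diag_nth)
  note Yw = left_solution[OF invertible_Koo(1) SYs, folded Yw_def]
    and Zw = right_solution[OF invertible_Uoo(1) SZs, folded Zw_def]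
  have KY: "Koo ** Yw = - SY" using Yw(2) by (simp add: matrix_minus_left minus_equation_iff eq_commute)
  have ZU: "Zw ** Uoo = - SZ" using Zw(2) by (simp add: matrix_minus_right minus_equation_iff eq_commute)
  have Yeq: "To ** (A\<langle>Op, Mi\<rangle> + A\<langle>Op, Pl\<rangle> ** W + A\<langle>Op, Op\<rangle> ** Yw)
      + ?V ** Tom ** (A\<langle>Om, Mi\<rangle> + A\<langle>Om, Pl\<rangle> ** W + A\<langle>Om, Op\<rangle> ** Yw) = 0"
  proof -
    have "To ** (A\<langle>Op, Mi\<rangle> + A\<langle>Op, Pl\<rangle> ** W + A\<langle>Op, Op\<rangle> ** Yw)
      + ?V ** Tom ** (A\<langle>Om, Mi\<rangle> + A\<langle>Om, Pl\<rangle> ** W + A\<langle>Om, Op\<rangle> ** Yw) = SY + Koo ** Yw"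
      unfolding SY_def Koo_eq by (simp add: matrix_ring algebra_simps)
    then show ?thesis unfolding KY by simp
  qed
  have Zeq: "Cp ** (A\<langle>Pl, Om\<rangle> + A\<langle>Pl, Op\<rangle> ** ?V) + Zw ** Tom ** (A\<langle>Om, Om\<rangle> + A\<langle>Om, Op\<rangle> ** ?V)
      + W ** Cm ** (A\<langle>Mi, Om\<rangle> + A\<langle>Mi, Op\<rangle> ** ?V) = 0"
  proof -
    have "Cp ** (A\<langle>Pl, Om\<rangle> + A\<langle>Pl, Op\<rangle> ** ?V) + Zw ** Tom ** (A\<langle>Om, Om\<rangle> + A\<langle>Om, Op\<rangle> ** ?V)
      + W ** Cm ** (A\<langle>Mi, Om\<rangle> + A\<langle>Mi, Op\<rangle> ** ?V) = SZ + Zw ** Uoo"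
      unfolding SZ_def Uoo_eq by (simp add: matrix_ring algebra_simps)
    then show ?thesis unfolding ZU by simp
  qed
  have V0: "0 \<le> ?V" by (rule blk_nonneg[OF Pc0_nonneg])
  have disj: "Op \<inter> Mi = {}" "Op \<inter> Pl = {}" "Om \<inter> Mi = {}" "Om \<inter> Pl = {}" "Pl \<inter> Om = {}" "Pl \<inter> Op = {}"
    "Mi \<inter> Om = {}" "Mi \<inter> Op = {}" using set_disjoint by auto
  have Yw0: "0 \<le> Yw"
    unfolding Yw_def SY_def
    by (intro nonneg_mult add_nonneg_nonneg invertible_Koo(2) inverse_blocks_nonneg A_block_nonneg disj W0 V0)
  have Zw0: "0 \<le> Zw"
    unfolding Zw_def SZ_def
    by (intro nonneg_mult add_nonneg_nonneg invertible_Uoo(2) inverse_blocks_nonneg A_block_nonneg disj W0 V0)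
  define F where "F = W + Yw + Zw + ?V"
  have F0: "0 \<le> F" unfolding F_def using W0 Yw0 Zw0 V0 by (intro add_nonneg_nonneg)
  note blks = four_blocks[OF Ws Yw(1) Zw(1) blk_idem[of "Pc 0"], folded F_def]
  have L: "A\<langle>I, Om\<rangle> + (Lm F)\<langle>I, Om\<rangle> = A\<langle>I, Om\<rangle> + A\<langle>I, Op\<rangle> ** ?V"
    "A\<langle>I, Mi\<rangle> + (Lm F)\<langle>I, Mi\<rangle> = A\<langle>I, Mi\<rangle> + A\<langle>I, Pl\<rangle> ** W + A\<langle>I, Op\<rangle> ** Yw" for I
    unfolding Lm_blk blks by simp_all
  have Weq: "Cp ** (A\<langle>Pl, Mi\<rangle> + A\<langle>Pl, Pl\<rangle> ** W + A\<langle>Pl, Op\<rangle> ** Yw)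
      + Zw ** Tom ** (A\<langle>Om, Mi\<rangle> + A\<langle>Om, Pl\<rangle> ** W + A\<langle>Om, Op\<rangle> ** Yw)
      + W ** Cm ** (A\<langle>Mi, Mi\<rangle> + A\<langle>Mi, Pl\<rangle> ** W + A\<langle>Mi, Op\<rangle> ** Yw) = 0"
    using censored_riccati[where V = ?V, folded Koo_eq, OF invertible_Koo(1) invertible_Ze Ws Zw(1) blk_idem V_eq
        Yeq Zeq] ricW by simp
  have "y0 i j \<le> F $ i $ j"
  proof (rule limit_least)
    fix i j assume ij: "i \<in> P" "j \<in> N"
    consider "i \<in> Pl" "j \<in> Om" | "i \<in> Pl" "j \<in> Mi" | "i \<in> Op" "j \<in> Om" | "i \<in> Op" "j \<in> Mi"
      using ij by auto
    then have "ric P N e0 f0 s0 A' (\<lambda>i j. F $ i $ j) i j = 0"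
    proof cases
      case 1
      show ?thesis unfolding ric_matrix_Pl[OF 1 subs(1)] L blks Zeq by simp
    next
      case 2
      show ?thesis unfolding ric_matrix_Pl[OF 2 subs(2)] L blks Weq by simp
    next
      case 3
      show ?thesis unfolding ric_matrix_Op[OF 3 subs(1)] L blks V_eq by simp
    next
      case 4
      show ?thesis unfolding ric_matrix_Op[OF 4 subs(2)] L blks Yeq by simp
    qed
    then show "0 \<le> F $ i $ j \<and> ric P N e0 f0 s0 A' (\<lambda>i j. F $ i $ j) i j = 0"
      using F0 by (simp add: less_eq_vec_def)
  qed (use ij in auto)
  also have "F $ i $ j = W $ i $ j" using arg_cong[OF blks(1), of "\<lambda>M. M $ i $ j"] ij by (simp add: blk_nth)
  finally show "(Pc 0)\<langle>Pl, Mi\<rangle> $ i $ j \<le> f i j" using ij by (simp add: blk_nth Pc0_y0' W_def)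
qed

section \<open>The first-order coefficient\<close>

lemma eventually_expansion:
  "\<exists>\<delta>>0. \<forall>\<epsilon>\<in>{0<..<\<delta>}.
        (\<forall>i\<in>Pl. 0 < c i + \<epsilon> * ct i) \<and> (\<forall>i\<in>Mi. c i + \<epsilon> * ct i < 0) \<and>
        min_nonneg_solution P N A (D \<epsilon>) (first_return P N A (D \<epsilon>)) \<and>
        (\<lambda>n. \<epsilon> ^ n *\<^sub>R Pc n) sums first_return P N A (D \<epsilon>) \<and>
        (\<lambda>n. (\<epsilon> powi (int n - 1)) *\<^sub>R Uc (int n - 1)) sums U_mat P N A (D \<epsilon>) (first_return P N A (D \<epsilon>)) \<and>
        (\<lambda>n. (\<epsilon> powi (int n - 1)) *\<^sub>R Kc (int n - 1)) sums K_mat P N A (D \<epsilon>) (first_return P N A (D \<epsilon>))"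
    (is "\<exists>\<delta>>0. \<forall>\<epsilon>\<in>_. ?Q \<epsilon>")
proof -
  from eventually_weights X_minimal eventually_sums have "\<forall>\<^sub>F \<epsilon> in at_right 0. ?Q \<epsilon>"
  proof eventually_elim
    case (elim \<epsilon>)
    then show ?case unfolding first_return_eqI[OF elim(2)] by blast
  qed
  then show ?thesis unfolding eventually_at_right_field by (auto simp: Ball_def)
qed

lemma first_return_bigo:
  "(\<lambda>\<epsilon>. norm (first_return P N A (D \<epsilon>) - (Pc 0 + \<epsilon> *\<^sub>R Pc 1))) \<in> O[at_right 0](\<lambda>\<epsilon>. \<epsilon>\<^sup>2)"
proof -
  have "\<forall>\<^sub>F \<epsilon> in at_right 0. norm (first_return P N A (D \<epsilon>) - (Pc 0 + \<epsilon> *\<^sub>R Pc 1))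
      = norm (X \<epsilon> - (Pc 0 + \<epsilon> *\<^sub>R Pc 1))"
    using X_minimal by eventually_elim (simp add: first_return_eqI)
  then show ?thesis using X_bigo by (subst landau_o.big.in_cong)
qed

lemma U_coefficients:
  "Uoo = Tom ** A\<langle>Om, Om\<rangle> + Tom ** A\<langle>Om, Op\<rangle> ** (Pc 0)\<langle>Op, Om\<rangle>"
  "(Uc (-1))\<langle>Om, Mi\<rangle> = Tom ** (A\<langle>Om, Mi\<rangle> + A\<langle>Om, Pl\<rangle> ** (Pc 0)\<langle>Pl, Mi\<rangle> + A\<langle>Om, Op\<rangle> ** (Pc 0)\<langle>Op, Mi\<rangle>)"
  "(Uc 0)\<langle>Om, Om\<rangle> = Tom ** (A\<langle>Om, Pl\<rangle> ** (Pc 1)\<langle>Pl, Om\<rangle> + A\<langle>Om, Op\<rangle> ** (Pc 1)\<langle>Op, Om\<rangle>)"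
  "(Uc 0)\<langle>Om, Mi\<rangle> = Tom ** (A\<langle>Om, Pl\<rangle> ** (Pc 1)\<langle>Pl, Mi\<rangle> + A\<langle>Om, Op\<rangle> ** (Pc 1)\<langle>Op, Mi\<rangle>)"
  "(Uc 0)\<langle>Mi, Om\<rangle> = Cm ** (A\<langle>Mi, Om\<rangle> + A\<langle>Mi, Op\<rangle> ** (Pc 0)\<langle>Op, Om\<rangle>)"
  "(Uc 0)\<langle>Mi, Mi\<rangle> = Cm ** (A\<langle>Mi, Mi\<rangle> + A\<langle>Mi, Pl\<rangle> ** (Pc 0)\<langle>Pl, Mi\<rangle> + A\<langle>Mi, Op\<rangle> ** (Pc 0)\<langle>Op, Mi\<rangle>)"
  unfolding Uc_blocks[OF subs(1)] Uc_blocks[OF subs(2)] G0_blk G1_blk Pc0_Pl_Om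
  by (simp_all add: matrix_add_ldistrib matrix_mul_assoc)

lemma K_coefficients:
  "Koo = To ** A\<langle>Op, Op\<rangle> + (Pc 0)\<langle>Op, Om\<rangle> ** Tom ** A\<langle>Om, Op\<rangle>"
  "(Kc (-1))\<langle>Op, Pl\<rangle> = To ** A\<langle>Op, Pl\<rangle> + (Pc 0)\<langle>Op, Om\<rangle> ** Tom ** A\<langle>Om, Pl\<rangle>"
  by (rule Kc_blocks[OF subs(4)], rule Kc_blocks[OF subs(3)])

lemma Pc0_Op_Mi: "(Pc 0)\<langle>Op, Mi\<rangle> = blk_inv Op (- Koo) **
   (To ** (A\<langle>Op, Mi\<rangle> + A\<langle>Op, Pl\<rangle> ** (Pc 0)\<langle>Pl, Mi\<rangle>)
    + (Pc 0)\<langle>Op, Om\<rangle> ** Tom ** (A\<langle>Om, Mi\<rangle> + A\<langle>Om, Pl\<rangle> ** (Pc 0)\<langle>Pl, Mi\<rangle>))" (is "_ = _ ** ?S")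
proof (rule left_divide[OF invertible_Koo(1) blk_idem])
  have "?S + Koo ** (Pc 0)\<langle>Op, Mi\<rangle> = 0"
    using order0_Op[OF subs(2)] unfolding G0_blk Koo_eq by (simp add: matrix_ring algebra_simps)
  then show "- Koo ** (Pc 0)\<langle>Op, Mi\<rangle> = ?S" by (simp add: matrix_minus_left neg_eq_iff_add_eq_0 add.commute)
qed

lemma Pc1_Pl_Om: "(Pc 1)\<langle>Pl, Om\<rangle> =
   (Cp ** (A\<langle>Pl, Om\<rangle> + A\<langle>Pl, Op\<rangle> ** (Pc 0)\<langle>Op, Om\<rangle>)
    + (Pc 0)\<langle>Pl, Mi\<rangle> ** Cm ** (A\<langle>Mi, Om\<rangle> + A\<langle>Mi, Op\<rangle> ** (Pc 0)\<langle>Op, Om\<rangle>))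
   ** blk_inv Om (- Uoo)" (is "_ = ?S ** _")
proof (rule right_divide[OF invertible_Uoo(1) blk_idem])
  have "?S + (Pc 1)\<langle>Pl, Om\<rangle> ** Uoo = 0"
    using order0_Pl[OF subs(1)] unfolding G0_blk Uoo_eq Pc0_Pl_Om by (simp add: matrix_ring algebra_simps)
  then show "(Pc 1)\<langle>Pl, Om\<rangle> ** - Uoo = ?S" by (simp add: matrix_minus_right neg_eq_iff_add_eq_0 add.commute)
qed

text \<open>
  The coefficient solves the equation because this is the equation of order one at \<open>(Op, Om)\<close>;
  uniqueness is the kernel argument in the subsystem of the phases of rate zero.
\<close>

lemma sylvester_Op_Om:
  assumes F: "F = F\<langle>Op, Om\<rangle>"
  shows "Koo ** F + F ** Uoo =
     - ((To ** A\<langle>Op, Pl\<rangle> + (Pc 0)\<langle>Op, Om\<rangle> ** Tom ** A\<langle>Om, Pl\<rangle>) ** (Pc 1)\<langle>Pl, Om\<rangle>)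
     - (Pc 0)\<langle>Op, Mi\<rangle> ** Cm ** (A\<langle>Mi, Om\<rangle> + A\<langle>Mi, Pl\<rangle> ** (Pc 0)\<langle>Pl, Om\<rangle> + A\<langle>Mi, Op\<rangle> ** (Pc 0)\<langle>Op, Om\<rangle>)
   \<longleftrightarrow> F = (Pc 1)\<langle>Op, Om\<rangle>" (is "_ = ?r \<longleftrightarrow> _")
proof -
  have "Koo ** (Pc 1)\<langle>Op, Om\<rangle> + (Pc 1)\<langle>Op, Om\<rangle> ** Uoo - ?r = 0"
    using order1_Op[OF subs(1)] unfolding G0_blk G1_blk Koo_eq Uoo_eq Pc0_Pl_Om
    by (simp add: matrix_ring algebra_simps)
  then have sol: "Koo ** (Pc 1)\<langle>Op, Om\<rangle> + (Pc 1)\<langle>Op, Om\<rangle> ** Uoo = ?r" by simp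
  show ?thesis
  proof
    assume "Koo ** F + F ** Uoo = ?r"
    with sol have "(Koo ** F + F ** Uoo) - (Koo ** (Pc 1)\<langle>Op, Om\<rangle> + (Pc 1)\<langle>Op, Om\<rangle> ** Uoo) = 0"
      by simp
    then have "Koo ** (F - (Pc 1)\<langle>Op, Om\<rangle>) + (F - (Pc 1)\<langle>Op, Om\<rangle>) ** Uoo = 0"
      unfolding matrix_diff_left matrix_diff_right by (simp add: algebra_simps)
    then have "F - (Pc 1)\<langle>Op, Om\<rangle> = 0"
      by (rule sylvester_Op_Om_injective[OF blk_diff[OF F blk_idem]])
    then show "F = (Pc 1)\<langle>Op, Om\<rangle>" by simp
  qed (use sol in simp)
qed

abbreviation "Tp \<equiv> (diag_mat ct)\<langle>Pl, Pl\<rangle>"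
abbreviation "Tm \<equiv> (diag_mat ct)\<langle>Mi, Mi\<rangle>"

text \<open>
  The blocks of the coefficients at \<open>(Op, Mi)\<close> and \<open>(Pl, Om)\<close> as functions of an arbitrary
  candidate \<open>x\<close> for the block at \<open>(Pl, Mi)\<close>, and the Sylvester equation \<open>syl\<close> with these blocks
  as parameters. Both readings of uniqueness are instances of \<open>syl\<close>: the parameters may be held
  fixed at their true values or vary with \<open>x\<close>.
\<close>

definition P1_Op_Mi where "P1_Op_Mi x = blk_inv Op (- Koo) **
   ((Kc (-1))\<langle>Op, Pl\<rangle> ** x + (Pc 1)\<langle>Op, Om\<rangle> ** (Uc (-1))\<langle>Om, Mi\<rangle> + (Pc 0)\<langle>Op, Mi\<rangle> ** (Uc 0)\<langle>Mi, Mi\<rangle>)"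

definition P2_Pl_Om where "P2_Pl_Om x =
   (- (Cp ** Tp ** Cp ** (A\<langle>Pl, Om\<rangle> + A\<langle>Pl, Op\<rangle> ** (Pc 0)\<langle>Op, Om\<rangle>))
    + Cp ** (A\<langle>Pl, Pl\<rangle> ** (Pc 1)\<langle>Pl, Om\<rangle> + A\<langle>Pl, Op\<rangle> ** (Pc 1)\<langle>Op, Om\<rangle>)
    + (Pc 1)\<langle>Pl, Om\<rangle> ** (Uc 0)\<langle>Om, Om\<rangle>
    + (x + (Pc 0)\<langle>Pl, Mi\<rangle> ** Cm ** Tm) ** (Uc 0)\<langle>Mi, Om\<rangle>
    + (Pc 0)\<langle>Pl, Mi\<rangle> ** Cm ** (A\<langle>Mi, Pl\<rangle> ** (Pc 1)\<langle>Pl, Om\<rangle> + A\<langle>Mi, Op\<rangle> ** (Pc 1)\<langle>Op, Om\<rangle>))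
   ** blk_inv Om (- Uoo)"

definition syl where "syl y V Z x \<longleftrightarrow>
   (Cp ** A\<langle>Pl, Pl\<rangle> + (Pc 0)\<langle>Pl, Mi\<rangle> ** Cm ** A\<langle>Mi, Pl\<rangle>) ** x
   + x ** (Uc 0)\<langle>Mi, Mi\<rangle>
   + (Cp ** A\<langle>Pl, Op\<rangle> + (Pc 0)\<langle>Pl, Mi\<rangle> ** Cm ** A\<langle>Mi, Op\<rangle>) ** y
   + Z ** (Uc (-1))\<langle>Om, Mi\<rangle>
   + (Pc 1)\<langle>Pl, Om\<rangle> ** V
   = Cp ** Tp ** Cp **
       (A\<langle>Pl, Mi\<rangle> + A\<langle>Pl, Pl\<rangle> ** (Pc 0)\<langle>Pl, Mi\<rangle> + A\<langle>Pl, Op\<rangle> ** (Pc 0)\<langle>Op, Mi\<rangle>)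
     - (Pc 0)\<langle>Pl, Mi\<rangle> ** Cm ** Tm ** (Uc 0)\<langle>Mi, Mi\<rangle>"

definition U0_Om_Mi where "U0_Om_Mi x = Tom ** (A\<langle>Om, Pl\<rangle> ** x + A\<langle>Om, Op\<rangle> ** P1_Op_Mi x)"

lemma Pc1_Op_Mi: "(Pc 1)\<langle>Op, Mi\<rangle> = P1_Op_Mi ((Pc 1)\<langle>Pl, Mi\<rangle>)"
  unfolding P1_Op_Mi_def
proof (rule left_divide[OF invertible_Koo(1) blk_idem])
  let ?S = "(Kc (-1))\<langle>Op, Pl\<rangle> ** (Pc 1)\<langle>Pl, Mi\<rangle> + (Pc 1)\<langle>Op, Om\<rangle> ** (Uc (-1))\<langle>Om, Mi\<rangle> + (Pc 0)\<langle>Op, Mi\<rangle> ** (Uc 0)\<langle>Mi, Mi\<rangle>"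
  have "?S + Koo ** (Pc 1)\<langle>Op, Mi\<rangle> = 0"
    using order1_Op[OF subs(2)] unfolding G0_blk G1_blk K_coefficients U_coefficients
    by (simp add: matrix_ring algebra_simps)
  then show "- Koo ** (Pc 1)\<langle>Op, Mi\<rangle> = ?S" by (simp add: matrix_minus_left neg_eq_iff_add_eq_0 add.commute)
qed

lemma Pc2_Pl_Om: "(Pc 2)\<langle>Pl, Om\<rangle> = P2_Pl_Om ((Pc 1)\<langle>Pl, Mi\<rangle>)"
  unfolding P2_Pl_Om_def
proof (rule right_divide[OF invertible_Uoo(1) blk_idem])
  let ?S = "- (Cp ** Tp ** Cp ** (A\<langle>Pl, Om\<rangle> + A\<langle>Pl, Op\<rangle> ** (Pc 0)\<langle>Op, Om\<rangle>))
    + Cp ** (A\<langle>Pl, Pl\<rangle> ** (Pc 1)\<langle>Pl, Om\<rangle> + A\<langle>Pl, Op\<rangle> ** (Pc 1)\<langle>Op, Om\<rangle>)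
    + (Pc 1)\<langle>Pl, Om\<rangle> ** (Uc 0)\<langle>Om, Om\<rangle>
    + ((Pc 1)\<langle>Pl, Mi\<rangle> + (Pc 0)\<langle>Pl, Mi\<rangle> ** Cm ** Tm) ** (Uc 0)\<langle>Mi, Om\<rangle>
    + (Pc 0)\<langle>Pl, Mi\<rangle> ** Cm ** (A\<langle>Mi, Pl\<rangle> ** (Pc 1)\<langle>Pl, Om\<rangle> + A\<langle>Mi, Op\<rangle> ** (Pc 1)\<langle>Op, Om\<rangle>)"
  have "?S + (Pc 2)\<langle>Pl, Om\<rangle> ** Uoo = 0"
    using order1_Pl[OF subs(1)] unfolding G0_blk G1_blk U_coefficients Pc0_Pl_Om
    by (simp add: matrix_ring algebra_simps)
  then show "(Pc 2)\<langle>Pl, Om\<rangle> ** - Uoo = ?S" by (simp add: matrix_minus_right neg_eq_iff_add_eq_0 add.commute)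
qed

lemma syl_solution: "syl ((Pc 1)\<langle>Op, Mi\<rangle>) ((Uc 0)\<langle>Om, Mi\<rangle>) ((Pc 2)\<langle>Pl, Om\<rangle>) ((Pc 1)\<langle>Pl, Mi\<rangle>)"
proof -
  show ?thesis
    using order1_Pl[OF subs(2)] unfolding syl_def G0_blk G1_blk U_coefficients
    by (simp add: matrix_ring algebra_simps)
qed

lemma matrix_zero: "M ** 0 = (0 :: real ^ 's ^ 's)" "0 ** M = (0 :: real ^ 's ^ 's)"
  by (simp_all add: vec_eq_iff mult_nth)

lemma sum5_diff:
  fixes p q r s t :: "'g::ab_group_add"
  assumes "p + q + r + s + t = u" "p' + q' + r' + s' + t' = u"
  shows "(p - p') + (q - q') + (r - r') + (s - s') + (t - t') = 0"
proof -
  have "(p - p') + (q - q') + (r - r') + (s - s') + (t - t')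
      = (p + q + r + s + t) - (p' + q' + r' + s' + t')" by (simp add: algebra_simps)
  then show ?thesis by (simp only: assms diff_self)
qed

lemma syl_diff:
  assumes "syl y V Z x" "syl y' V' Z' x'"
  shows "(Cp ** A\<langle>Pl, Pl\<rangle> + (Pc 0)\<langle>Pl, Mi\<rangle> ** Cm ** A\<langle>Mi, Pl\<rangle>) ** (x - x')
   + (x - x') ** (Uc 0)\<langle>Mi, Mi\<rangle>
   + (Cp ** A\<langle>Pl, Op\<rangle> + (Pc 0)\<langle>Pl, Mi\<rangle> ** Cm ** A\<langle>Mi, Op\<rangle>) ** (y - y')
   + (Z - Z') ** (Uc (-1))\<langle>Om, Mi\<rangle>
   + (Pc 1)\<langle>Pl, Om\<rangle> ** (V - V') = 0"
  using sum5_diff[OF assms[unfolded syl_def]] unfolding matrix_diff_left matrix_diff_right .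

lemma sylvester_fixed:
  assumes x: "x = x\<langle>Pl, Mi\<rangle>"
  shows "syl ((Pc 1)\<langle>Op, Mi\<rangle>) ((Uc 0)\<langle>Om, Mi\<rangle>) ((Pc 2)\<langle>Pl, Om\<rangle>) x \<longleftrightarrow> x = (Pc 1)\<langle>Pl, Mi\<rangle>"
proof
  assume "syl ((Pc 1)\<langle>Op, Mi\<rangle>) ((Uc 0)\<langle>Om, Mi\<rangle>) ((Pc 2)\<langle>Pl, Om\<rangle>) x"
  from syl_diff[OF this syl_solution]
  have "(Cp ** A\<langle>Pl, Pl\<rangle> + (Pc 0)\<langle>Pl, Mi\<rangle> ** Cm ** A\<langle>Mi, Pl\<rangle>) ** (x - (Pc 1)\<langle>Pl, Mi\<rangle>)
      + (x - (Pc 1)\<langle>Pl, Mi\<rangle>) ** (Uc 0)\<langle>Mi, Mi\<rangle> = 0"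
    by (simp only: diff_self matrix_zero add_0_right)
  then have "x - (Pc 1)\<langle>Pl, Mi\<rangle> = 0"
    by (rule sylvester_Pl_Mi_injective[OF blk_diff[OF x blk_idem]])
  then show "x = (Pc 1)\<langle>Pl, Mi\<rangle>" by simp
qed (use syl_solution in simp)

text \<open>
  Two solutions differ by \<open>w\<close>, and the eliminated blocks by \<open>y\<close> and \<open>z\<close>. The formulas that
  define these blocks are affine, so \<open>w\<close>, \<open>y\<close>, \<open>z\<close> satisfy the homogeneous equations that were
  shown to have only the zero solution.
\<close>

lemma sylvester_eliminated:
  assumes x: "x = x\<langle>Pl, Mi\<rangle>"
  shows "syl (P1_Op_Mi x) (U0_Om_Mi x) (P2_Pl_Om x) x \<longleftrightarrow> x = (Pc 1)\<langle>Pl, Mi\<rangle>"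
proof -
  let ?x1 = "(Pc 1)\<langle>Pl, Mi\<rangle>"
  have sol: "syl (P1_Op_Mi ?x1) (U0_Om_Mi ?x1) (P2_Pl_Om ?x1) ?x1"
    using syl_solution unfolding U0_Om_Mi_def Pc1_Op_Mi[symmetric] Pc2_Pl_Om[symmetric]
    by (simp add: U_coefficients(4))
  show ?thesis
  proof
    assume s: "syl (P1_Op_Mi x) (U0_Om_Mi x) (P2_Pl_Om x) x"
    define w where "w = x - ?x1"
    define y where "y = P1_Op_Mi x - P1_Op_Mi ?x1"
    define z where "z = P2_Pl_Om x - P2_Pl_Om ?x1"
    have ws: "w = w\<langle>Pl, Mi\<rangle>" unfolding w_def by (rule blk_diff[OF x blk_idem])
    have y: "y = blk_inv Op (- Koo) ** ((Kc (-1))\<langle>Op, Pl\<rangle> ** w)"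
      unfolding y_def P1_Op_Mi_def w_def by (simp add: matrix_ring algebra_simps)
    have z: "z = (w ** (Uc 0)\<langle>Mi, Om\<rangle>) ** blk_inv Om (- Uoo)"
      unfolding z_def P2_Pl_Om_def w_def by (simp add: matrix_ring algebra_simps)
    have s1: "(Kc (-1))\<langle>Op, Pl\<rangle> ** w = ((Kc (-1))\<langle>Op, Pl\<rangle> ** w)\<langle>Op, Mi\<rangle>"
      using blk_supportD[OF ws] by (auto simp: vec_eq_iff blk_nth mult_blk_left_nth)
    have s2: "w ** (Uc 0)\<langle>Mi, Om\<rangle> = (w ** (Uc 0)\<langle>Mi, Om\<rangle>)\<langle>Pl, Om\<rangle>"
      using blk_supportD[OF ws] by (auto simp: vec_eq_iff blk_nth mult_blk_right_nth)
    note ys = left_solution[OF invertible_Koo(1) s1, folded y]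
      and zs = right_solution[OF invertible_Uoo(1) s2, folded z]
    have eq_y: "Koo ** y + (Kc (-1))\<langle>Op, Pl\<rangle> ** w = 0"
      using ys(2) by (simp add: matrix_minus_left neg_eq_iff_add_eq_0)
    have eq_z: "z ** Uoo + w ** (Uc 0)\<langle>Mi, Om\<rangle> = 0"
      using zs(2) by (simp add: matrix_minus_right neg_eq_iff_add_eq_0)
    have V: "U0_Om_Mi x - U0_Om_Mi ?x1 = Tom ** (A\<langle>Om, Pl\<rangle> ** w + A\<langle>Om, Op\<rangle> ** y)"
      unfolding U0_Om_Mi_def w_def y_def by (simp add: matrix_ring algebra_simps)
    have "w = 0"
      by (rule linearization_injective[OF ws ys(1) zs(1) eq_y eq_z])
         (use syl_diff[OF s sol, folded w_def y_def z_def] V in simp)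
    then show "x = ?x1" by (simp add: w_def)
  qed (use sol in simp)
qed

end

theorem theorem3p7:
  fixes A :: "real ^ 's ^ 's" and c ct :: "'s::finite \<Rightarrow> real" and \<xi> :: "real ^ 's"
  defines "Pl \<equiv> {i. 0 < c i}" and "Ze \<equiv> {i. c i = 0}" and "Mi \<equiv> {i. c i < 0}"
    and "Op \<equiv> {i. c i = 0 \<and> 0 < ct i}" and "Om \<equiv> {i. c i = 0 \<and> ct i < 0}"
  defines "C \<equiv> diag_mat c" and "Ct \<equiv> diag_mat ct"
  defines "Cp_inv \<equiv> blk_inv Pl (C\<langle>Pl, Pl\<rangle>)" and "Cm_inv \<equiv> \<bar>blk_inv Mi (C\<langle>Mi, Mi\<rangle>)\<bar>"
    and "Top_inv \<equiv> blk_inv Op (Ct\<langle>Op, Op\<rangle>)" and "Tom_inv \<equiv> \<bar>blk_inv Om (Ct\<langle>Om, Om\<rangle>)\<bar>"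
    and "Tp \<equiv> Ct\<langle>Pl, Pl\<rangle>" and "Tm \<equiv> Ct\<langle>Mi, Mi\<rangle>"
  defines "\<Psi> \<equiv> \<lambda>\<epsilon>. first_return (Pl \<union> Op) (Om \<union> Mi) A (C + \<epsilon> *\<^sub>R Ct)"
  assumes "generator A"
    and "stationary_vector A \<xi>"
    and "(\<xi> v* C) \<bullet> 1 < 0"
    and "\<forall>i\<in>Ze. ct i \<noteq> 0"
  shows "\<exists>(P :: nat \<Rightarrow> real ^ 's ^ 's) (U :: int \<Rightarrow> real ^ 's ^ 's) (K :: int \<Rightarrow> real ^ 's ^ 's).
    \<comment> \<open>\<open>\<Psi>(\<epsilon>)\<close> is well defined and analytic; \<open>P n\<close>, \<open>U n\<close>, \<open>K n\<close> are the coefficients of \<open>\<epsilon>\<^sup>n\<close>\<close>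
    (\<exists>\<delta>>0. \<forall>\<epsilon>\<in>{0<..<\<delta>}.
        (\<forall>i\<in>Pl. 0 < c i + \<epsilon> * ct i) \<and> (\<forall>i\<in>Mi. c i + \<epsilon> * ct i < 0) \<and>
        min_nonneg_solution (Pl \<union> Op) (Om \<union> Mi) A (C + \<epsilon> *\<^sub>R Ct) (\<Psi> \<epsilon>) \<and>
        (\<lambda>n. \<epsilon> ^ n *\<^sub>R P n) sums \<Psi> \<epsilon> \<and>
        (\<lambda>n. (\<epsilon> powi (int n - 1)) *\<^sub>R U (int n - 1)) sums
          U_mat (Pl \<union> Op) (Om \<union> Mi) A (C + \<epsilon> *\<^sub>R Ct) (\<Psi> \<epsilon>) \<and>
        (\<lambda>n. (\<epsilon> powi (int n - 1)) *\<^sub>R K (int n - 1)) sums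
          K_mat (Pl \<union> Op) (Om \<union> Mi) A (C + \<epsilon> *\<^sub>R Ct) (\<Psi> \<epsilon>)) \<and>
    (\<forall>n. P n = (P n)\<langle>Pl \<union> Op, Om \<union> Mi\<rangle>) \<and>
    (\<lambda>\<epsilon>. norm (\<Psi> \<epsilon> - (P 0 + \<epsilon> *\<^sub>R P 1))) \<in> O[at_right 0](\<lambda>\<epsilon>. \<epsilon>\<^sup>2) \<and>
    \<comment> \<open>the coefficients of \<open>U\<close> and \<open>K\<close> that occur below\<close>
    (U (-1))\<langle>Om, Om\<rangle> = Tom_inv ** A\<langle>Om, Om\<rangle> + Tom_inv ** A\<langle>Om, Op\<rangle> ** (P 0)\<langle>Op, Om\<rangle> \<and>
    (U (-1))\<langle>Om, Mi\<rangle> =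
      Tom_inv ** (A\<langle>Om, Mi\<rangle> + A\<langle>Om, Pl\<rangle> ** (P 0)\<langle>Pl, Mi\<rangle> + A\<langle>Om, Op\<rangle> ** (P 0)\<langle>Op, Mi\<rangle>) \<and>
    (U 0)\<langle>Om, Om\<rangle> =
      Tom_inv ** (A\<langle>Om, Pl\<rangle> ** (P 1)\<langle>Pl, Om\<rangle> + A\<langle>Om, Op\<rangle> ** (P 1)\<langle>Op, Om\<rangle>) \<and>
    (U 0)\<langle>Om, Mi\<rangle> =
      Tom_inv ** (A\<langle>Om, Pl\<rangle> ** (P 1)\<langle>Pl, Mi\<rangle> + A\<langle>Om, Op\<rangle> ** (P 1)\<langle>Op, Mi\<rangle>) \<and>
    (U 0)\<langle>Mi, Om\<rangle> = Cm_inv ** (A\<langle>Mi, Om\<rangle> + A\<langle>Mi, Op\<rangle> ** (P 0)\<langle>Op, Om\<rangle>) \<and>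
    (U 0)\<langle>Mi, Mi\<rangle> =
      Cm_inv ** (A\<langle>Mi, Mi\<rangle> + A\<langle>Mi, Pl\<rangle> ** (P 0)\<langle>Pl, Mi\<rangle> + A\<langle>Mi, Op\<rangle> ** (P 0)\<langle>Op, Mi\<rangle>) \<and>
    (K (-1))\<langle>Op, Op\<rangle> = Top_inv ** A\<langle>Op, Op\<rangle> + (P 0)\<langle>Op, Om\<rangle> ** Tom_inv ** A\<langle>Om, Op\<rangle> \<and>
    (K (-1))\<langle>Op, Pl\<rangle> = Top_inv ** A\<langle>Op, Pl\<rangle> + (P 0)\<langle>Op, Om\<rangle> ** Tom_inv ** A\<langle>Om, Pl\<rangle> \<and>
    \<comment> \<open>the inverses that occur exist\<close>
    blk_invertible Ze (A\<langle>Ze, Ze\<rangle>) \<and>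
    blk_invertible Op (- (K (-1))\<langle>Op, Op\<rangle>) \<and>
    blk_invertible Om (- (U (-1))\<langle>Om, Om\<rangle>) \<and>
    \<comment> \<open>the limit\<close>
    (P 0)\<langle>Pl, Om\<rangle> = 0 \<and>
    min_nonneg_solution Pl Mi (censored Ze A) C ((P 0)\<langle>Pl, Mi\<rangle>) \<and>
    min_nonneg_solution Op Om A Ct ((P 0)\<langle>Op, Om\<rangle>) \<and>
    (P 0)\<langle>Op, Mi\<rangle> =
      blk_inv Op (- (K (-1))\<langle>Op, Op\<rangle>) **
        (Top_inv ** (A\<langle>Op, Mi\<rangle> + A\<langle>Op, Pl\<rangle> ** (P 0)\<langle>Pl, Mi\<rangle>)
         + (P 0)\<langle>Op, Om\<rangle> ** Tom_inv ** (A\<langle>Om, Mi\<rangle> + A\<langle>Om, Pl\<rangle> ** (P 0)\<langle>Pl, Mi\<rangle>)) \<and>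
    \<comment> \<open>the first-order coefficient\<close>
    (P 1)\<langle>Pl, Om\<rangle> =
      (Cp_inv ** (A\<langle>Pl, Om\<rangle> + A\<langle>Pl, Op\<rangle> ** (P 0)\<langle>Op, Om\<rangle>)
       + (P 0)\<langle>Pl, Mi\<rangle> ** Cm_inv ** (A\<langle>Mi, Om\<rangle> + A\<langle>Mi, Op\<rangle> ** (P 0)\<langle>Op, Om\<rangle>))
      ** blk_inv Om (- (U (-1))\<langle>Om, Om\<rangle>) \<and>
    (\<forall>X. X = X\<langle>Op, Om\<rangle> \<longrightarrow>
      ((K (-1))\<langle>Op, Op\<rangle> ** X + X ** (U (-1))\<langle>Om, Om\<rangle> =
         - ((Top_inv ** A\<langle>Op, Pl\<rangle> + (P 0)\<langle>Op, Om\<rangle> ** Tom_inv ** A\<langle>Om, Pl\<rangle>) ** (P 1)\<langle>Pl, Om\<rangle>)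
         - (P 0)\<langle>Op, Mi\<rangle> ** Cm_inv **
             (A\<langle>Mi, Om\<rangle> + A\<langle>Mi, Pl\<rangle> ** (P 0)\<langle>Pl, Om\<rangle> + A\<langle>Mi, Op\<rangle> ** (P 0)\<langle>Op, Om\<rangle>)
       \<longleftrightarrow> X = (P 1)\<langle>Op, Om\<rangle>)) \<and>
    (let
       \<comment> \<open>the formulas for the blocks \<open>\<Psi>\<^sup>(\<^sup>1\<^sup>)\<close> at \<open>(Op, Mi)\<close>, \<open>U\<^sup>(\<^sup>0\<^sup>)\<close> at \<open>(Om, Mi)\<close> and \<open>\<Psi>\<^sup>(\<^sup>2\<^sup>)\<close> at
          \<open>(Pl, Om)\<close> as functions of the block \<open>X\<close> of \<open>\<Psi>\<^sup>(\<^sup>1\<^sup>)\<close> at \<open>(Pl, Mi)\<close>\<close>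
       P1_Op_Mi = (\<lambda>X.
         blk_inv Op (- (K (-1))\<langle>Op, Op\<rangle>) **
           ((K (-1))\<langle>Op, Pl\<rangle> ** X + (P 1)\<langle>Op, Om\<rangle> ** (U (-1))\<langle>Om, Mi\<rangle>
            + (P 0)\<langle>Op, Mi\<rangle> ** (U 0)\<langle>Mi, Mi\<rangle>));
       U0_Om_Mi = (\<lambda>X. Tom_inv ** (A\<langle>Om, Pl\<rangle> ** X + A\<langle>Om, Op\<rangle> ** P1_Op_Mi X));
       P2_Pl_Om = (\<lambda>X.
         (- (Cp_inv ** Tp ** Cp_inv ** (A\<langle>Pl, Om\<rangle> + A\<langle>Pl, Op\<rangle> ** (P 0)\<langle>Op, Om\<rangle>))
          + Cp_inv ** (A\<langle>Pl, Pl\<rangle> ** (P 1)\<langle>Pl, Om\<rangle> + A\<langle>Pl, Op\<rangle> ** (P 1)\<langle>Op, Om\<rangle>)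
          + (P 1)\<langle>Pl, Om\<rangle> ** (U 0)\<langle>Om, Om\<rangle>
          + (X + (P 0)\<langle>Pl, Mi\<rangle> ** Cm_inv ** Tm) ** (U 0)\<langle>Mi, Om\<rangle>
          + (P 0)\<langle>Pl, Mi\<rangle> ** Cm_inv **
              (A\<langle>Mi, Pl\<rangle> ** (P 1)\<langle>Pl, Om\<rangle> + A\<langle>Mi, Op\<rangle> ** (P 1)\<langle>Op, Om\<rangle>))
         ** blk_inv Om (- (U (-1))\<langle>Om, Om\<rangle>));
       \<comment> \<open>the Sylvester equation for \<open>X\<close>, given these three blocks\<close>
       sylvester = (\<lambda>Y V Z X.
         (Cp_inv ** A\<langle>Pl, Pl\<rangle> + (P 0)\<langle>Pl, Mi\<rangle> ** Cm_inv ** A\<langle>Mi, Pl\<rangle>) ** X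
         + X ** (U 0)\<langle>Mi, Mi\<rangle>
         + (Cp_inv ** A\<langle>Pl, Op\<rangle> + (P 0)\<langle>Pl, Mi\<rangle> ** Cm_inv ** A\<langle>Mi, Op\<rangle>) ** Y
         + Z ** (U (-1))\<langle>Om, Mi\<rangle>
         + (P 1)\<langle>Pl, Om\<rangle> ** V
         = Cp_inv ** Tp ** Cp_inv **
             (A\<langle>Pl, Mi\<rangle> + A\<langle>Pl, Pl\<rangle> ** (P 0)\<langle>Pl, Mi\<rangle> + A\<langle>Pl, Op\<rangle> ** (P 0)\<langle>Op, Mi\<rangle>)
           - (P 0)\<langle>Pl, Mi\<rangle> ** Cm_inv ** Tm ** (U 0)\<langle>Mi, Mi\<rangle>)
     in
       (P 1)\<langle>Op, Mi\<rangle> = P1_Op_Mi ((P 1)\<langle>Pl, Mi\<rangle>) \<and>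
       (P 2)\<langle>Pl, Om\<rangle> = P2_Pl_Om ((P 1)\<langle>Pl, Mi\<rangle>) \<and>
       \<comment> \<open>uniqueness with the other blocks kept fixed\<close>
       (\<forall>X. X = X\<langle>Pl, Mi\<rangle> \<longrightarrow>
         (sylvester ((P 1)\<langle>Op, Mi\<rangle>) ((U 0)\<langle>Om, Mi\<rangle>) ((P 2)\<langle>Pl, Om\<rangle>) X
          \<longleftrightarrow> X = (P 1)\<langle>Pl, Mi\<rangle>)) \<and>
       \<comment> \<open>uniqueness with the other blocks eliminated by their formulas\<close>
       (\<forall>X. X = X\<langle>Pl, Mi\<rangle> \<longrightarrow>
         (sylvester (P1_Op_Mi X) (U0_Om_Mi X) (P2_Pl_Om X) X
          \<longleftrightarrow> X = (P 1)\<langle>Pl, Mi\<rangle>)))"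
proof -
  have fl: "fluid A c ct \<xi>"
    using assms(15-18) by unfold_locales (auto simp: C_def Ze_def)
  obtain Y H a b where "fluid_expansion A c ct \<xi> Y H a b"
    using fluid.expansion_exists[OF fl] by blast
  then interpret E: fluid_expansion A c ct \<xi> Y H a b .
  have sets_eq: "Pl = E.Pl" "Ze = E.Ze" "Mi = E.Mi" "Op = E.Op" "Om = E.Om"
    unfolding Pl_def Ze_def Mi_def Op_def Om_def E.Pl_def E.Ze_def E.Mi_def E.Op_def E.Om_def by simp_all
  have inv_eq: "Cp_inv = E.Cp" "Cm_inv = E.Cm" "Top_inv = E.To" "Tom_inv = E.Tom"
    unfolding Cp_inv_def Cm_inv_def Top_inv_def Tom_inv_def C_def Ct_def sets_eq by (simp_all add: E.inverse_blocks)
  show ?thesis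
    unfolding Let_def \<Psi>_def inv_eq Tp_def Tm_def C_def Ct_def sets_eq
    apply (rule exI[of _ E.Pc], rule exI[of _ E.Uc], rule exI[of _ E.Kc])
    by (intro conjI allI impI E.eventually_expansion E.Pc_supp E.first_return_bigo E.U_coefficients E.K_coefficients
        E.invertible_Ze E.invertible_Koo(1) E.invertible_Uoo(1) E.Pc0_Pl_Om E.min_Pl_Mi E.min_Op_Om E.Pc0_Op_Mi
        E.Pc1_Pl_Om E.sylvester_Op_Om E.Pc1_Op_Mi[unfolded E.P1_Op_Mi_def] E.Pc2_Pl_Om[unfolded E.P2_Pl_Om_def]
        E.sylvester_fixed[unfolded E.syl_def]
        E.sylvester_eliminated[unfolded E.syl_def E.U0_Om_Mi_def E.P1_Op_Mi_def E.P2_Pl_Om_def])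
qed

end
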